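(* Let $k$ be a field with $\operatorname{char}k=0$, and let $R=k[x_1,\dots,x_N]$ and $S=k[X_1,\dots,X_N]$ be polynomial rings, with $R$ acting on $S$ by the contraction action $\circ$. Let $F\in S$ be a nonzero homogeneous binomial. Suppose that $R/\operatorname{Ann}_R(F)$ is a complete intersection. Then $R/\operatorname{Ann}_R(F)$ has the strong Lefschetz property.
   Context: The contraction action $\circ$ of $R$ on $S$ is the $k$-bilinear action determined by \[x_1^{\alpha_1}\cdots x_N^{\alpha_N}\circ X_1^{\beta_1}\cdots X_N^{\beta_N}=\begin{cases}X_1^{\beta_1-\alpha_1}\cdots X_N^{\beta_N-\alpha_N}&\text{if }\beta_i\ge \alpha_i\text{ for all }i,\\0&\text{otherwise,}\end{cases}\] for $\alpha_i,\beta_i\in\mathbb Z_{\ge 0}$. For $F\in S\setminus\{0\}$, $\operatorname{Ann}_R(F)=\{f\in R\mid f\circ F=0\}$, an $(x_1,\dots,x_N)$-primary ideal of $R$. A binomial is a linear combination, with nonzero coefficients in $k$, of two distinct monomials; homogeneity is with respect to the standard grading ($\deg x_i=\deg X_i=1$). When $F$ is homogeneous, $\operatorname{Ann}_R(F)$ is a homogeneous ideal and $R/\operatorname{Ann}_R(F)$ is a graded Artinian $k$-algebra. A graded Artinian $k$-algebra $A=\bigoplus_{i\ge 0} A_i$ has the strong Lefschetz property if there exists $z\in A_1$ such that the multiplication map $\times z^d: A_i\to A_{i+d}$ has maximal rank (i.e. is injective or surjective) for all $i,d\in\mathbb Z_{\ge 0}$. *)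

theory Defs
  imports "HOL-Library.Poly_Mapping" "HOL-Algebra.Algebraic_Closure_Type"
begin

text \<open>
  Exponent vectors are of type \<^typ>\<open>'n \<Rightarrow>\<^sub>0 nat\<close>, where the finite index type
  \<^typ>\<open>'n::finite\<close> has as many elements as there are variables. Both polynomial rings
  $R = k[x_1,\dots,x_N]$ and $S = k[X_1,\dots,X_N]$ are rendered by the same type; the product of
  \<^theory>\<open>HOL-Library.Poly_Mapping\<close> is the polynomial product.
\<close>

type_synonym ('n, 'k) mpoly = "('n \<Rightarrow>\<^sub>0 nat) \<Rightarrow>\<^sub>0 'k"

definition mdeg :: "('n::finite \<Rightarrow>\<^sub>0 nat) \<Rightarrow> nat" where
  "mdeg \<alpha> = (\<Sum>i\<in>UNIV. Poly_Mapping.lookup \<alpha> i)"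

text \<open>The homogeneous component of degree \<open>d\<close>; it contains \<open>0\<close>.\<close>

definition homogeneous_part :: "nat \<Rightarrow> ('n::finite, 'k::field) mpoly set" where
  "homogeneous_part d = {f. \<forall>\<alpha>\<in>Poly_Mapping.keys f. mdeg \<alpha> = d}"

definition homogeneous :: "('n::finite, 'k::field) mpoly \<Rightarrow> bool" where
  "homogeneous f \<longleftrightarrow> (\<exists>d. f \<in> homogeneous_part d)"

definition is_binomial :: "('n::finite, 'k::field) mpoly \<Rightarrow> bool" where
  "is_binomial F \<longleftrightarrow> (\<exists>\<alpha> \<beta> a b. \<alpha> \<noteq> \<beta> \<and> a \<noteq> 0 \<and> b \<noteq> 0 \<and>
      F = Poly_Mapping.single \<alpha> a + Poly_Mapping.single \<beta> b)"

text \<open>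
  Contraction is the bilinear extension of the rule on monomials. Divisibility is spelled out
  componentwise, because the order of \<^theory>\<open>HOL-Library.Poly_Mapping\<close> on exponent vectors is
  lexicographic. The subtraction of exponent vectors is componentwise.
\<close>

definition contract ::
  "('n::finite, 'k::field) mpoly \<Rightarrow> ('n, 'k) mpoly \<Rightarrow> ('n, 'k) mpoly" where
  "contract f F = (\<Sum>\<alpha>\<in>Poly_Mapping.keys f. \<Sum>\<beta>\<in>Poly_Mapping.keys F.
      if \<forall>i. Poly_Mapping.lookup \<alpha> i \<le> Poly_Mapping.lookup \<beta> i
      then Poly_Mapping.single (\<beta> - \<alpha>) (Poly_Mapping.lookup f \<alpha> * Poly_Mapping.lookup F \<beta>)
      else 0)"

definition Ann :: "('n::finite, 'k::field) mpoly \<Rightarrow> ('n, 'k) mpoly set" where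
  "Ann F = {f. contract f F = 0}"

abbreviation mpoly_ring :: "('n::finite, 'k::field) mpoly ring" where
  "mpoly_ring \<equiv> ring_of_type_algebra"

text \<open>
  The image of the homogeneous component of degree \<open>i\<close> in the quotient by \<open>I\<close>. For a homogeneous
  ideal \<open>I\<close> these images are the graded pieces of the quotient.
\<close>

definition quotient_part ::
  "('n::finite, 'k::field) mpoly set \<Rightarrow> nat \<Rightarrow> ('n, 'k) mpoly set set" where
  "quotient_part I i = (\<lambda>f. I +>\<^bsub>mpoly_ring\<^esub> f) ` homogeneous_part i"

definition regular_sequence :: "('a, 'm) ring_scheme \<Rightarrow> 'a list \<Rightarrow> bool" where
  "regular_sequence R fs \<longleftrightarrow>
     set fs \<subseteq> carrier R \<and>
     Idl\<^bsub>R\<^esub> (set fs) \<noteq> carrier R \<and>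
     (\<forall>i<length fs. \<forall>g\<in>carrier R.
        (fs ! i) \<otimes>\<^bsub>R\<^esub> g \<in> Idl\<^bsub>R\<^esub> (set (take i fs)) \<longrightarrow> g \<in> Idl\<^bsub>R\<^esub> (set (take i fs)))"

text \<open>For an ideal \<open>I\<close> of a polynomial ring \<open>R\<close>: the quotient of \<open>R\<close> by \<open>I\<close> is a complete intersection.\<close>

definition complete_intersection :: "('a, 'm) ring_scheme \<Rightarrow> 'a set \<Rightarrow> bool" where
  "complete_intersection R I \<longleftrightarrow> (\<exists>fs. regular_sequence R fs \<and> I = Idl\<^bsub>R\<^esub> (set fs))"

text \<open>
  The strong Lefschetz property of a ring \<open>A\<close> with graded pieces \<open>gr i\<close>. Multiplication by \<open>z\<^sup>d\<close>
  sends \<open>gr i\<close> into \<open>gr (i + d)\<close>, so the second alternative is surjectivity.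
\<close>

definition strong_Lefschetz :: "('a, 'm) ring_scheme \<Rightarrow> (nat \<Rightarrow> 'a set) \<Rightarrow> bool" where
  "strong_Lefschetz A gr \<longleftrightarrow>
     (\<exists>z\<in>gr 1. \<forall>i d. inj_on (\<lambda>a. z [^]\<^bsub>A\<^esub> (d::nat) \<otimes>\<^bsub>A\<^esub> a) (gr i) \<or>
                     (\<lambda>a. z [^]\<^bsub>A\<^esub> d \<otimes>\<^bsub>A\<^esub> a) ` gr i = gr (i + d))"


lemma contract_sum_superset:
  assumes "finite A" "finite B" "Poly_Mapping.keys f \<subseteq> A" "Poly_Mapping.keys F \<subseteq> B"
  shows "contract f F = (\<Sum>\<alpha>\<in>A. \<Sum>\<beta>\<in>B.
      if \<forall>i. Poly_Mapping.lookup \<alpha> i \<le> Poly_Mapping.lookup \<beta> i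
      then Poly_Mapping.single (\<beta> - \<alpha>) (Poly_Mapping.lookup f \<alpha> * Poly_Mapping.lookup F \<beta>)
      else 0)"
proof -
  have "contract f F = (\<Sum>\<alpha>\<in>Poly_Mapping.keys f. \<Sum>\<beta>\<in>B.
      if \<forall>i. Poly_Mapping.lookup \<alpha> i \<le> Poly_Mapping.lookup \<beta> i
      then Poly_Mapping.single (\<beta> - \<alpha>) (Poly_Mapping.lookup f \<alpha> * Poly_Mapping.lookup F \<beta>)
      else 0)"
    unfolding contract_def
    by (intro sum.cong refl sum.mono_neutral_left) (use assms in \<open>auto simp: in_keys_iff\<close>)
  also have "\<dots> = (\<Sum>\<alpha>\<in>A. \<Sum>\<beta>\<in>B.
      if \<forall>i. Poly_Mapping.lookup \<alpha> i \<le> Poly_Mapping.lookup \<beta> i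
      then Poly_Mapping.single (\<beta> - \<alpha>) (Poly_Mapping.lookup f \<alpha> * Poly_Mapping.lookup F \<beta>)
      else 0)"
    by (intro sum.mono_neutral_left) (use assms in \<open>auto simp: in_keys_iff intro!: sum.neutral\<close>)
  finally show ?thesis .
qed

lemma contract_single_single:
  "contract (Poly_Mapping.single \<alpha> a) (Poly_Mapping.single \<beta> b) =
     (if \<forall>i. Poly_Mapping.lookup \<alpha> i \<le> Poly_Mapping.lookup \<beta> i
      then Poly_Mapping.single (\<beta> - \<alpha>) (a * b) else 0)"
  by (subst contract_sum_superset[of "{\<alpha>}" "{\<beta>}"]) auto

lemma contract_add_left: "contract (f + g) F = contract f F + contract g F"
proof -
  let ?A = "Poly_Mapping.keys f \<union> Poly_Mapping.keys g"
  have "Poly_Mapping.keys (f + g) \<subseteq> ?A" by (rule Poly_Mapping.keys_add)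
  then show ?thesis
    by (subst (1 2 3) contract_sum_superset[of ?A "Poly_Mapping.keys F"])
       (auto simp: sum.distrib[symmetric] lookup_add distrib_right single_add intro!: sum.cong)
qed

lemma contract_add_right: "contract f (F + G) = contract f F + contract f G"
proof -
  let ?B = "Poly_Mapping.keys F \<union> Poly_Mapping.keys G"
  have "Poly_Mapping.keys (F + G) \<subseteq> ?B" by (rule Poly_Mapping.keys_add)
  then show ?thesis
    by (subst (1 2 3) contract_sum_superset[of "Poly_Mapping.keys f" ?B])
       (auto simp: sum.distrib[symmetric] lookup_add distrib_left single_add intro!: sum.cong)
qed

lemma contract_zero_left [simp]: "contract 0 F = 0"
  and contract_zero_right [simp]: "contract f 0 = 0"
  by (simp_all add: contract_def)

lemma mpoly_additive_induct [case_names zero single add]: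
  fixes f :: "('n::finite, 'k::field) mpoly"
  assumes "P 0" "\<And>\<alpha> a. P (Poly_Mapping.single \<alpha> a)" "\<And>f g. P f \<Longrightarrow> P g \<Longrightarrow> P (f + g)"
  shows "P f"
proof -
  have "P (\<Sum>\<alpha>\<in>A. Poly_Mapping.single \<alpha> (Poly_Mapping.lookup f \<alpha>))" if "finite A" for A
    using that by induction (auto intro: assms)
  from this[of "Poly_Mapping.keys f"]
  have "P (\<Sum>\<alpha>\<in>Poly_Mapping.keys f. Poly_Mapping.single \<alpha> (Poly_Mapping.lookup f \<alpha>))"
    by simp
  moreover have "(\<Sum>\<alpha>\<in>Poly_Mapping.keys f. Poly_Mapping.single \<alpha> (Poly_Mapping.lookup f \<alpha>)) = f"
    by (rule poly_mapping_eqI) (simp add: lookup_sum lookup_single when_def in_keys_iff)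
  ultimately show ?thesis by simp
qed

lemma contract_mult: "contract (f * g) F = contract f (contract g F)"
proof (induction F rule: mpoly_additive_induct)
  case (single \<gamma> c)
  show ?case
  proof (induction g rule: mpoly_additive_induct)
    case (single \<beta> b)
    show ?case
    proof (induction f rule: mpoly_additive_induct)
      case (single \<alpha> a)
      have *: "(\<forall>i. Poly_Mapping.lookup (\<alpha> + \<beta>) i \<le> Poly_Mapping.lookup \<gamma> i) \<longleftrightarrow>
          (\<forall>i. Poly_Mapping.lookup \<beta> i \<le> Poly_Mapping.lookup \<gamma> i) \<and>
          (\<forall>i. Poly_Mapping.lookup \<alpha> i \<le> Poly_Mapping.lookup (\<gamma> - \<beta>) i)"
        unfolding lookup_add lookup_minus
        by (metis (no_types, lifting) add_leD2 le_diff_conv2)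
      have "\<gamma> - (\<alpha> + \<beta>) = \<gamma> - \<beta> - \<alpha>"
        by (rule poly_mapping_eqI) (simp add: lookup_add lookup_minus)
      with * show ?case
        by (simp add: mult_single contract_single_single mult.assoc)
    qed (simp_all add: contract_add_left distrib_right)
  qed (simp_all add: contract_add_left contract_add_right distrib_left)
qed (simp_all add: contract_add_right)

lemma ideal_Ann:
  fixes F :: "('n::finite, 'k::field) mpoly"
  shows "ideal (Ann F) mpoly_ring"
proof -
  interpret cring "mpoly_ring :: ('n, 'k) mpoly ring"
    by (rule cring_from_type_algebra)
  have minus: "contract (- f) F = 0" if "contract f F = 0" for f
    using contract_add_left[of f "- f" F] that by simp
  show ?thesis
  proof (rule idealI)
    show "subgroup (Ann F) (add_monoid mpoly_ring)"
    proof (rule add.subgroupI)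
      fix f assume f: "f \<in> Ann F"
      have "\<ominus>\<^bsub>mpoly_ring\<^esub> f = - f"
        by (rule minus_equality) (simp_all add: ring_of_type_algebra_def)
      then show "\<ominus>\<^bsub>mpoly_ring\<^esub> f \<in> Ann F"
        using f by (simp add: Ann_def minus)
    qed (auto simp: Ann_def ring_of_type_algebra_def contract_add_left
              intro!: exI[of _ 0])
  next
    fix f g
    assume "f \<in> Ann F"
    then show "g \<otimes>\<^bsub>mpoly_ring\<^esub> f \<in> Ann F" "f \<otimes>\<^bsub>mpoly_ring\<^esub> g \<in> Ann F"
      by (simp_all add: Ann_def ring_of_type_algebra_def contract_mult mult.commute[of f g])
  qed (rule ring_axioms)
qed

end

theory Submission
  imports Defs "Jordan_Normal_Form.Determinant"
begin

text \<open>
  Write \<open>F = a X^\<alpha> + b X^\<beta>\<close> and \<open>A\<close> for the quotient by the annihilator of \<open>F\<close>. The proof has two halves: the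
  complete intersection hypothesis leaves only two kinds of binomials, and each kind is
  reduced to a monomial complete intersection, where the sum of the variables is a strong Lefschetz
  element because of an action of \<open>sl_2\<close> (\<open>monomial_complete_intersection_Lefschetz\<close>).

  A regular sequence is algebraically independent, so the annihilator has at most \<open>N\<close>
  generators (\<open>regular_sequence_length\<close>). On the other hand minimal generators can be exhibited. If
  each of the two monomials has a larger exponent than the other in at least two variables, there are
  more than \<open>N\<close> of them. So, after exchanging the monomials if necessary, \<open>X^\<alpha>\<close> exceeds \<open>X^\<beta>\<close> in a single
  variable \<open>x_p\<close>. Counting generators again (\<open>not_complete_intersection_of_one_two\<close>), one of two cases remains.

  In the first case the annihilator contains an element whose leading term is \<open>x_p ^ (\<beta> p + 1)\<close>, so that the
  monomials dividing \<open>X^\<beta>\<close> form a basis of \<open>A\<close> (\<open>box_spans_quotient\<close>). Scaling the variable \<open>x_p\<close> in the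
  linear form degenerates \<open>F\<close> to its monomial \<open>X^\<beta>\<close> without changing the dimensions of the graded pieces,
  and bijectivity is an open condition (\<open>degenerate_to_monomial_Lefschetz\<close>).

  In the second case \<open>F\<close> is a binary binomial in \<open>x_p, x_q\<close> times a monomial in the other variables
  (\<open>two_variable_binomial_Lefschetz\<close>). For a general linear form \<open>x_p + c x_q\<close>, a Wronskian
  argument, which needs characteristic 0, splits the binary quotient into strings that are symmetric about the middle degree
  (\<open>general_shift_basis\<close>). A string tensored with the quotient in the other variables is
  a monomial complete intersection, and a filtration by the strings finishes the proof.

  In both cases only injectivity of \<open>z ^ (D - 2 * i)\<close> on the degree \<open>i\<close> part is proved, where \<open>D\<close> is the
  degree of \<open>F\<close>; the duality of \<open>A\<close> gives the rest (\<open>strong_Lefschetz_of_injective\<close>).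
\<close>

section \<open>Two facts about finite linear systems\<close>

text \<open>
  Induction on the number of equations, with one elimination step. Below,
  dimension counts take this form.
\<close>

lemma underdetermined_system:
  fixes M :: "'e \<Rightarrow> 'd \<Rightarrow> 'k::field"
  assumes "finite E" "finite D" "card E < card D"
  shows "\<exists>y. (\<exists>d\<in>D. y d \<noteq> 0) \<and> (\<forall>e\<in>E. (\<Sum>d\<in>D. y d * M e d) = 0)"
  using assms
proof (induction E arbitrary: D M rule: finite_induct)
  case empty
  then obtain d where "d \<in> D" by fastforce
  then show ?case by (intro exI[of _ "\<lambda>_. 1"]) auto
next
  case (insert e E)
  show ?case
  proof (cases "\<forall>d\<in>D. M e d = 0")
    case True
    from insert have "card E < card D" by simp
    with insert.IH[OF insert.prems(1)] obtain y where
      "\<exists>d\<in>D. y d \<noteq> 0" "\<forall>e\<in>E. (\<Sum>d\<in>D. y d * M e d) = 0" by blast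
    with True show ?thesis by (intro exI[of _ y]) auto
  next
    case False
    then obtain p where p: "p \<in> D" "M e p \<noteq> 0" by blast
    \<comment> \<open>Eliminate the unknown \<open>p\<close> by means of the equation \<open>e\<close>.\<close>
    define D' where "D' = D - {p}"
    have "finite D'" "card E < card D'"
      using insert p by (auto simp: D'_def)
    from insert.IH[OF this, of "\<lambda>f d. M f d - M e d / M e p * M f p"] obtain y where
      y: "\<exists>d\<in>D'. y d \<noteq> 0"
        "\<forall>f\<in>E. (\<Sum>d\<in>D'. y d * (M f d - M e d / M e p * M f p)) = 0" by blast
    define c where "c = (\<Sum>d\<in>D'. y d * M e d) / M e p"
    define z where "z = y(p := - c)"
    have sum_z: "(\<Sum>d\<in>D. z d * M f d) = (\<Sum>d\<in>D'. y d * M f d) - c * M f p" for f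
    proof -
      have "(\<Sum>d\<in>D. z d * M f d) = z p * M f p + (\<Sum>d\<in>D'. z d * M f d)"
        unfolding D'_def using insert.prems(1) p(1) by (rule sum.remove)
      also have "(\<Sum>d\<in>D'. z d * M f d) = (\<Sum>d\<in>D'. y d * M f d)"
        by (rule sum.cong) (auto simp: z_def D'_def)
      finally show ?thesis by (simp add: z_def)
    qed
    show ?thesis
    proof (intro exI[of _ z] conjI ballI)
      show "\<exists>d\<in>D. z d \<noteq> 0" using y(1) by (auto simp: z_def D'_def)
      fix f assume "f \<in> insert e E"
      then consider "f = e" | "f \<in> E" by blast
      then show "(\<Sum>d\<in>D. z d * M f d) = 0"
      proof cases
        case 1
        then show ?thesis using p(2) by (simp add: sum_z c_def)
      next
        case 2
        have "(\<Sum>d\<in>D'. y d * (M f d - M e d / M e p * M f p)) =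
          (\<Sum>d\<in>D'. y d * M f d) - c * M f p"
          by (simp add: c_def right_diff_distrib sum_subtractf sum_divide_distrib
                sum_distrib_right mult.assoc)
        then show ?thesis using y(2) 2 by (simp add: sum_z)
      qed
    qed
  qed
qed

text \<open>
  Solvability follows as soon as every linear relation among the rows also holds among the right-hand
  sides. The induction is on the columns: if some relation \<open>y1\<close> of the remaining columns does not kill
  the new column \<open>j\<close>, it determines the coefficient \<open>c\<close> with which \<open>j\<close> must occur in a solution.
\<close>

lemma Fredholm_alternative:
  fixes Q :: "'i \<Rightarrow> 'j \<Rightarrow> 'k::field"
  assumes "finite J" "finite I"
    and "\<And>y. (\<forall>j\<in>J. (\<Sum>i\<in>I. y i * Q i j) = 0) \<Longrightarrow> (\<Sum>i\<in>I. y i * b i) = 0"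
  shows "\<exists>x. \<forall>i\<in>I. (\<Sum>j\<in>J. Q i j * x j) = b i"
  using assms(1,3)
proof (induction J arbitrary: b rule: finite_induct)
  case empty
  have "b i = 0" if "i \<in> I" for i
    using empty[of "\<lambda>i'. if i' = i then 1 else 0"] that assms(2)
    by (simp add: if_distrib[of "\<lambda>x. x * _"] cong: if_cong)
  then show ?case by auto
next
  case (insert j J)
  let ?perp = "\<lambda>y. \<forall>j\<in>J. (\<Sum>i\<in>I. y i * Q i j) = 0"
  show ?case
  proof (cases "\<exists>y. ?perp y \<and> (\<Sum>i\<in>I. y i * Q i j) \<noteq> 0")
    case True
    then obtain y1 where y1: "?perp y1" "(\<Sum>i\<in>I. y1 i * Q i j) \<noteq> 0" by blast
    define s where "s = (\<Sum>i\<in>I. y1 i * Q i j)"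
    define c where "c = (\<Sum>i\<in>I. y1 i * b i) / s"
    have s: "s \<noteq> 0" using y1(2) by (simp add: s_def)
    have "\<exists>x. \<forall>i\<in>I. (\<Sum>j\<in>J. Q i j * x j) = b i - c * Q i j"
    proof (rule insert.IH)
      fix y assume y: "?perp y"
      define t where "t = (\<Sum>i\<in>I. y i * Q i j)"
      define z where "z = (\<lambda>i. y i - t / s * y1 i)"
      have sum_z: "(\<Sum>i\<in>I. z i * w i) = (\<Sum>i\<in>I. y i * w i) - t / s * (\<Sum>i\<in>I. y1 i * w i)" for w
        by (simp add: z_def left_diff_distrib sum_subtractf sum_distrib_left mult.assoc)
      have "(\<Sum>i\<in>I. z i * b i) = 0"
      proof (rule insert.prems)
        show "\<forall>j\<in>insert j J. (\<Sum>i\<in>I. z i * Q i j) = 0"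
          using y y1(1) s by (auto simp: sum_z s_def[symmetric] t_def[symmetric])
      qed
      then have "(\<Sum>i\<in>I. y i * b i) = t * c"
        by (simp add: sum_z c_def)
      moreover have "(\<Sum>i\<in>I. y i * (b i - c * Q i j)) = (\<Sum>i\<in>I. y i * b i) - c * t"
        by (simp add: t_def right_diff_distrib sum_subtractf sum_distrib_left mult.left_commute)
      ultimately show "(\<Sum>i\<in>I. y i * (b i - c * Q i j)) = 0" by simp
    qed
    then obtain x where x: "\<forall>i\<in>I. (\<Sum>j\<in>J. Q i j * x j) = b i - c * Q i j" by blast
    have "(\<Sum>j'\<in>J. Q i j' * (x(j := c)) j') = (\<Sum>j'\<in>J. Q i j' * x j')" for i
      using insert.hyps by (intro sum.cong) auto
    then show ?thesis
      using x insert.hyps by (intro exI[of _ "x(j := c)"]) simp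
  next
    case False
    have "\<exists>x. \<forall>i\<in>I. (\<Sum>j\<in>J. Q i j * x j) = b i"
      by (rule insert.IH, rule insert.prems) (use False in auto)
    then obtain x where x: "\<forall>i\<in>I. (\<Sum>j\<in>J. Q i j * x j) = b i" by blast
    have "(\<Sum>j'\<in>J. Q i j' * (x(j := 0)) j') = (\<Sum>j'\<in>J. Q i j' * x j')" for i
      using insert.hyps by (intro sum.cong) auto
    then show ?thesis
      using x insert.hyps by (intro exI[of _ "x(j := 0)"]) simp
  qed
qed

section \<open>Coefficients, linear forms and the annihilator of a binomial\<close>

text \<open>
  Since the index type is finite, every function is an exponent vector. Exponents are treated as
  functions because their pointwise order is divisibility and their pointwise difference is division of
  monomials.
\<close>

definition coef :: "('n::finite, 'k::field) mpoly \<Rightarrow> ('n \<Rightarrow> nat) \<Rightarrow> 'k" where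
  "coef f \<eta> = Poly_Mapping.lookup f (Abs_poly_mapping \<eta>)"

definition monomial :: "('n::finite \<Rightarrow> nat) \<Rightarrow> 'k::field \<Rightarrow> ('n, 'k) mpoly" where
  "monomial \<eta> c = Poly_Mapping.single (Abs_poly_mapping \<eta>) c"

definition tdeg :: "('n::finite \<Rightarrow> nat) \<Rightarrow> nat" where
  "tdeg \<eta> = (\<Sum>l\<in>UNIV. \<eta> l)"

lemma lookup_Abs_finite [simp]:
  "Poly_Mapping.lookup (Abs_poly_mapping (\<eta> :: 'n::finite \<Rightarrow> nat)) = \<eta>"
  by (simp add: Abs_poly_mapping_inverse)

lemma Abs_finite_inject [simp]:
  "Abs_poly_mapping (\<eta> :: 'n::finite \<Rightarrow> nat) = Abs_poly_mapping \<xi> \<longleftrightarrow> \<eta> = \<xi>"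
  by (metis lookup_Abs_finite)

lemma lookup_eq_coef: "Poly_Mapping.lookup f \<mu> = coef f (Poly_Mapping.lookup \<mu>)"
  by (simp add: coef_def lookup_inverse)

lemma mpoly_eqI:
  fixes f g :: "('n::finite, 'k::field) mpoly"
  assumes "\<And>\<eta>. coef f \<eta> = coef g \<eta>"
  shows "f = g"
  by (rule poly_mapping_eqI) (simp add: lookup_eq_coef assms)

lemma coef_monomial: "coef (monomial \<eta> c) \<xi> = (if \<eta> = \<xi> then c else 0)"
  by (simp add: coef_def monomial_def lookup_single when_def)

lemma coef_add [simp]: "coef (f + g) \<xi> = coef f \<xi> + coef g \<xi>"
  by (simp add: coef_def lookup_add)

lemma coef_zero [simp]: "coef 0 \<xi> = 0"
  by (simp add: coef_def)

lemma coef_minus [simp]: "coef (- f) \<xi> = - coef f \<xi>"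
  by (simp add: coef_def)

lemma coef_diff [simp]: "coef (f - g) \<xi> = coef f \<xi> - coef g \<xi>"
  by (simp add: coef_def lookup_minus)

lemma coef_sum: "coef (sum f A) \<xi> = (\<Sum>x\<in>A. coef (f x) \<xi>)"
  by (simp add: coef_def lookup_sum)

lemma mpoly_monomial_induct [case_names zero mono add]:
  fixes f :: "('n::finite, 'k::field) mpoly"
  assumes "P 0" "\<And>\<eta> c. P (monomial \<eta> c)" "\<And>f g. P f \<Longrightarrow> P g \<Longrightarrow> P (f + g)"
  shows "P f"
proof (induction f rule: mpoly_additive_induct)
  case (single \<mu> c)
  have "Poly_Mapping.single \<mu> c = monomial (Poly_Mapping.lookup \<mu>) c"
    by (simp add: monomial_def lookup_inverse)
  then show ?case using assms(2) by simp
qed (use assms in auto)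

lemma monomial_mult_monomial: "monomial \<eta> c * monomial \<xi> e = monomial (\<lambda>l. \<eta> l + \<xi> l) (c * e)"
proof -
  have "Abs_poly_mapping \<eta> + Abs_poly_mapping \<xi> = Abs_poly_mapping (\<lambda>l. \<eta> l + \<xi> l)"
    by (rule poly_mapping_eqI) (simp add: lookup_add)
  then show ?thesis by (simp add: monomial_def mult_single)
qed

lemma monomial_zero_one: "(monomial (\<lambda>_. 0) 1 :: ('n::finite, 'k::field) mpoly) = 1"
proof -
  have "Abs_poly_mapping (\<lambda>_::'n. 0::nat) = 0"
    by (rule poly_mapping_eqI) simp
  then show ?thesis unfolding monomial_def by (simp only: single_one)
qed

lemma coef_monomial_mult:
  "coef (monomial \<eta> c * f) \<xi> = (if \<eta> \<le> \<xi> then c * coef f (\<xi> - \<eta>) else 0)"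
proof (induction f rule: mpoly_monomial_induct)
  case (mono \<mu> e)
  have "(\<lambda>l. \<eta> l + \<mu> l) = \<xi> \<longleftrightarrow> \<eta> \<le> \<xi> \<and> \<mu> = \<xi> - \<eta>"
  proof
    assume "(\<lambda>l. \<eta> l + \<mu> l) = \<xi>"
    then have "\<xi> l = \<eta> l + \<mu> l" for l by auto
    then show "\<eta> \<le> \<xi> \<and> \<mu> = \<xi> - \<eta>" by (simp add: le_fun_def fun_eq_iff)
  next
    assume "\<eta> \<le> \<xi> \<and> \<mu> = \<xi> - \<eta>"
    then show "(\<lambda>l. \<eta> l + \<mu> l) = \<xi>" by (simp add: le_fun_def fun_eq_iff)
  qed
  then show ?case by (auto simp: monomial_mult_monomial coef_monomial)
qed (auto simp: distrib_left fun_diff_def)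

lemma finite_box: "finite {\<eta>::'n::finite \<Rightarrow> nat. \<eta> \<le> \<beta>}"
proof (rule finite_subset)
  show "{\<eta>. \<eta> \<le> \<beta>} \<subseteq> PiE UNIV (\<lambda>l. {..\<beta> l})" by (auto simp: le_fun_def)
  show "finite (PiE UNIV (\<lambda>l. {..\<beta> l}))" by (intro finite_PiE) auto
qed

lemma finite_tdeg: "finite {\<eta>::'n::finite \<Rightarrow> nat. tdeg \<eta> = i}"
proof (rule finite_subset)
  show "{\<eta>::'n \<Rightarrow> nat. tdeg \<eta> = i} \<subseteq> {\<eta>. \<eta> \<le> (\<lambda>_. i)}"
    by (auto simp: le_fun_def tdeg_def intro: member_le_sum)
qed (rule finite_box)

lemma tdeg_diff: "\<eta> \<le> \<xi> \<Longrightarrow> tdeg (\<xi> - \<eta>) = tdeg \<xi> - tdeg \<eta>"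
  unfolding tdeg_def by (subst sum_subtractf_nat[symmetric]) (auto simp: le_fun_def)

lemma tdeg_mono: "\<eta> \<le> \<xi> \<Longrightarrow> tdeg \<eta> \<le> tdeg \<xi>"
  unfolding tdeg_def by (rule sum_mono) (auto simp: le_fun_def)

lemma tdeg_add: "tdeg (\<lambda>l. \<eta> l + \<xi> l) = tdeg \<eta> + tdeg \<xi>"
  by (simp add: tdeg_def sum.distrib)

lemma tdeg_upd: "tdeg (\<eta>(l := m)) + \<eta> l = tdeg \<eta> + m"
proof -
  have "tdeg (\<eta>(l := m)) = m + (\<Sum>x\<in>UNIV - {l}. (\<eta>(l := m)) x)"
    unfolding tdeg_def by (subst sum.remove[of UNIV l]) auto
  moreover have "(\<Sum>x\<in>UNIV - {l}. (\<eta>(l := m)) x) = (\<Sum>x\<in>UNIV - {l}. \<eta> x)"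
    by (rule sum.cong) auto
  moreover have "tdeg \<eta> = \<eta> l + (\<Sum>x\<in>UNIV - {l}. \<eta> x)"
    unfolding tdeg_def by (subst sum.remove[of UNIV l]) auto
  ultimately show ?thesis by simp
qed

lemma homogeneous_part_iff:
  "f \<in> homogeneous_part d \<longleftrightarrow> (\<forall>\<eta>. coef f \<eta> \<noteq> 0 \<longrightarrow> tdeg \<eta> = d)"
proof
  assume f: "f \<in> homogeneous_part d"
  show "\<forall>\<eta>. coef f \<eta> \<noteq> 0 \<longrightarrow> tdeg \<eta> = d"
  proof (intro allI impI)
    fix \<eta> assume "coef f \<eta> \<noteq> 0"
    then have "Abs_poly_mapping \<eta> \<in> Poly_Mapping.keys f"
      by (simp add: in_keys_iff coef_def)
    with f have "mdeg (Abs_poly_mapping \<eta>) = d"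
      unfolding homogeneous_part_def by blast
    then show "tdeg \<eta> = d" by (simp add: mdeg_def tdeg_def)
  qed
next
  assume "\<forall>\<eta>. coef f \<eta> \<noteq> 0 \<longrightarrow> tdeg \<eta> = d"
  then show "f \<in> homogeneous_part d"
    unfolding homogeneous_part_def mdeg_def tdeg_def
    by (simp add: in_keys_iff lookup_eq_coef)
qed

lemma coef_mult_nonzeroE:
  assumes "coef (f * g) \<eta> \<noteq> 0"
  obtains \<mu> \<rho> where "\<eta> = (\<lambda>l. \<mu> l + \<rho> l)" "coef f \<mu> \<noteq> 0" "coef g \<rho> \<noteq> 0"
proof -
  have "Abs_poly_mapping \<eta> \<in> Poly_Mapping.keys (f * g)"
    using assms by (simp add: in_keys_iff coef_def)
  then obtain a b where ab: "Abs_poly_mapping \<eta> = a + b"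
    "a \<in> Poly_Mapping.keys f" "b \<in> Poly_Mapping.keys g"
    using keys_mult[of f g] by blast
  then have "\<eta> = (\<lambda>l. Poly_Mapping.lookup a l + Poly_Mapping.lookup b l)"
    using lookup_Abs_finite[of \<eta>] by (simp add: fun_eq_iff lookup_add)
  then show ?thesis
    using ab by (intro that) (auto simp: in_keys_iff lookup_eq_coef)
qed

lemma homogeneous_part_mult:
  assumes "f \<in> homogeneous_part i" "g \<in> homogeneous_part j"
  shows "f * g \<in> homogeneous_part (i + j)"
  unfolding homogeneous_part_iff
proof (intro allI impI)
  fix \<eta> assume "coef (f * g) \<eta> \<noteq> 0"
  then obtain \<mu> \<rho> where "\<eta> = (\<lambda>l. \<mu> l + \<rho> l)" "coef f \<mu> \<noteq> 0" "coef g \<rho> \<noteq> 0"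
    by (rule coef_mult_nonzeroE)
  with assms show "tdeg \<eta> = i + j"
    unfolding homogeneous_part_iff by (simp add: tdeg_add)
qed

lemma homogeneous_part_one: "1 \<in> homogeneous_part 0"
  unfolding homogeneous_part_iff monomial_zero_one[symmetric] by (auto simp: coef_monomial tdeg_def split: if_splits)

lemma homogeneous_part_power:
  "f \<in> homogeneous_part i \<Longrightarrow> f ^ e \<in> homogeneous_part (e * i)"
proof (induction e)
  case 0
  show ?case using homogeneous_part_one by simp
next
  case (Suc e)
  then show ?case using homogeneous_part_mult[of f i "f ^ e" "e * i"] by simp
qed

lemma homogeneous_part_diff:
  "f \<in> homogeneous_part i \<Longrightarrow> g \<in> homogeneous_part i \<Longrightarrow> f - g \<in> homogeneous_part i"
  unfolding homogeneous_part_iff coef_diff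
proof (intro allI impI)
  fix \<eta>
  assume f: "\<forall>\<eta>. coef f \<eta> \<noteq> 0 \<longrightarrow> tdeg \<eta> = i" and g: "\<forall>\<eta>. coef g \<eta> \<noteq> 0 \<longrightarrow> tdeg \<eta> = i"
    and "coef f \<eta> - coef g \<eta> \<noteq> 0"
  then have "coef f \<eta> \<noteq> 0 \<or> coef g \<eta> \<noteq> 0" by auto
  then show "tdeg \<eta> = i" using f g by blast
qed

lemma mpoly_expand:
  assumes "finite B" "\<And>\<eta>. coef f \<eta> \<noteq> 0 \<Longrightarrow> \<eta> \<in> B"
  shows "f = (\<Sum>\<eta>\<in>B. monomial \<eta> (coef f \<eta>))"
proof (rule mpoly_eqI)
  fix \<xi>
  show "coef f \<xi> = coef (\<Sum>\<eta>\<in>B. monomial \<eta> (coef f \<eta>)) \<xi>"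
    using assms(1) assms(2)[of \<xi>] by (simp add: coef_sum coef_monomial) blast
qed

lemma coef_sum_monomial:
  "finite B \<Longrightarrow> coef (\<Sum>\<eta>\<in>B. monomial \<eta> (u \<eta>)) \<xi> = (if \<xi> \<in> B then u \<xi> else 0)"
  by (simp add: coef_sum coef_monomial)

definition linear_form :: "('n::finite \<Rightarrow> 'k::field) \<Rightarrow> ('n, 'k) mpoly" where
  "linear_form s = (\<Sum>l\<in>UNIV. monomial ((\<lambda>_. 0)(l := 1)) (s l))"

lemma linear_form_homogeneous: "linear_form s \<in> homogeneous_part 1"
  unfolding homogeneous_part_iff linear_form_def
proof (intro allI impI)
  fix \<eta> assume "coef (\<Sum>l\<in>UNIV. monomial ((\<lambda>_. 0)(l := 1)) (s l)) \<eta> \<noteq> 0"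
  then obtain l where "coef (monomial ((\<lambda>_. 0)(l := 1)) (s l)) \<eta> \<noteq> 0"
    unfolding coef_sum by (meson sum.not_neutral_contains_not_neutral)
  then have "\<eta> = (\<lambda>_. 0)(l := 1)" by (auto simp: coef_monomial split: if_splits)
  then show "tdeg \<eta> = 1" using tdeg_upd[of "\<lambda>_. 0" l 1] by (simp add: tdeg_def)
qed

lemma coef_linear_form_mult:
  "coef (linear_form s * f) \<eta> = (\<Sum>l\<in>UNIV. if 0 < \<eta> l then s l * coef f (\<eta>(l := \<eta> l - 1)) else 0)"
  unfolding linear_form_def sum_distrib_right coef_sum
proof (rule sum.cong[OF refl])
  fix l
  have "((\<lambda>_. 0)(l := 1) \<le> \<eta>) \<longleftrightarrow> 0 < \<eta> l" by (auto simp: le_fun_def)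
  moreover have "\<eta> - (\<lambda>_. 0)(l := 1) = \<eta>(l := \<eta> l - 1)" by (auto simp: fun_eq_iff)
  ultimately show "coef (monomial ((\<lambda>_. 0)(l := 1)) (s l) * f) \<eta> =
      (if 0 < \<eta> l then s l * coef f (\<eta>(l := \<eta> l - 1)) else 0)"
    by (simp add: coef_monomial_mult)
qed

lemma contract_monomial_monomial:
  "contract (monomial \<mu> c) (monomial \<beta> b) = (if \<mu> \<le> \<beta> then monomial (\<beta> - \<mu>) (c * b) else 0)"
proof -
  have "Abs_poly_mapping \<beta> - Abs_poly_mapping \<mu> = Abs_poly_mapping (\<beta> - \<mu>)"
    by (rule poly_mapping_eqI) (simp add: lookup_minus)
  then show ?thesis by (simp add: monomial_def contract_single_single le_fun_def)
qed

lemma coef_contract_monomial: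
  "coef (contract f (monomial \<beta> b)) \<rho> = (if \<rho> \<le> \<beta> then coef f (\<beta> - \<rho>) * b else 0)"
proof (induction f rule: mpoly_monomial_induct)
  case (mono \<mu> c)
  have **: "(\<mu> \<le> \<beta> \<and> \<beta> - \<mu> = \<rho>) \<longleftrightarrow> (\<rho> \<le> \<beta> \<and> \<mu> = \<beta> - \<rho>)"
    unfolding le_fun_def fun_eq_iff by (metis diff_diff_cancel diff_le_self minus_apply)
  have "coef (contract (monomial \<mu> c) (monomial \<beta> b)) \<rho> =
      (if \<mu> \<le> \<beta> \<and> \<beta> - \<mu> = \<rho> then c * b else 0)"
    by (simp add: contract_monomial_monomial coef_monomial)
  then show ?case unfolding ** by (simp only: coef_monomial) simp
qed (auto simp: contract_add_left distrib_right fun_diff_def)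

text \<open>
  The condition at \<open>\<rho>\<close> is the vanishing of the coefficient of \<open>X^\<rho>\<close> in the contraction. Thus
  the annihilator is cut out by linear equations that couple at most two coefficients each.
\<close>

lemma Ann_binomial_iff:
  "f \<in> Ann (monomial \<alpha> a + monomial \<beta> b) \<longleftrightarrow>
   (\<forall>\<rho>. (if \<rho> \<le> \<alpha> then a * coef f (\<alpha> - \<rho>) else 0) + (if \<rho> \<le> \<beta> then b * coef f (\<beta> - \<rho>) else 0) = 0)"
proof -
  have "coef (contract f (monomial \<alpha> a + monomial \<beta> b)) \<rho> =
    (if \<rho> \<le> \<alpha> then a * coef f (\<alpha> - \<rho>) else 0) + (if \<rho> \<le> \<beta> then b * coef f (\<beta> - \<rho>) else 0)" for \<rho>
    by (simp add: contract_add_right coef_contract_monomial mult.commute)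
  note * = this
  have "f \<in> Ann (monomial \<alpha> a + monomial \<beta> b) \<longleftrightarrow>
    (\<forall>\<rho>. coef (contract f (monomial \<alpha> a + monomial \<beta> b)) \<rho> = 0)"
    unfolding Ann_def using mpoly_eqI[of "contract f (monomial \<alpha> a + monomial \<beta> b)" 0] by fastforce
  then show ?thesis unfolding * .
qed

lemma Ann_add: "f \<in> Ann F \<Longrightarrow> g \<in> Ann F \<Longrightarrow> f + g \<in> Ann F"
  by (simp add: Ann_def contract_add_left)

lemma Ann_mult: "f \<in> Ann F \<Longrightarrow> g * f \<in> Ann F"
  by (simp add: Ann_def contract_mult)

lemma Ann_zero: "0 \<in> Ann F"
  by (simp add: Ann_def)

lemma Ann_uminus: "f \<in> Ann F \<Longrightarrow> - f \<in> Ann F"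
  using Ann_mult[of f F "-1"] by simp

lemma Ann_diff: "f \<in> Ann F \<Longrightarrow> g \<in> Ann F \<Longrightarrow> f - g \<in> Ann F"
  using Ann_add[of f F "- g"] Ann_uminus by auto

section \<open>The number of generators of a complete intersection\<close>

lemma mpoly_ring_simps:
  "carrier mpoly_ring = UNIV" "x \<otimes>\<^bsub>mpoly_ring\<^esub> y = x * y" "x \<oplus>\<^bsub>mpoly_ring\<^esub> y = x + y"
  "\<one>\<^bsub>mpoly_ring\<^esub> = 1" "\<zero>\<^bsub>mpoly_ring\<^esub> = 0"
  by (simp_all add: ring_of_type_algebra_def)

lemma mpoly_idealD:
  fixes I :: "('n::finite, 'k::field) mpoly set"
  assumes "ideal I mpoly_ring"
  shows "0 \<in> I" "a \<in> I \<Longrightarrow> b \<in> I \<Longrightarrow> a + b \<in> I" "a \<in> I \<Longrightarrow> r * a \<in> I" "a \<in> I \<Longrightarrow> b \<in> I \<Longrightarrow> a - b \<in> I"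
proof -
  interpret ideal I "mpoly_ring :: ('n, 'k) mpoly ring" by (rule assms)
  show "0 \<in> I" using additive_subgroup.zero_closed[OF is_additive_subgroup] by (simp add: mpoly_ring_simps)
  show add: "a + b \<in> I" if "a \<in> I" "b \<in> I" for a b
    using additive_subgroup.a_closed[OF is_additive_subgroup that] by (simp add: mpoly_ring_simps)
  show mult: "r * a \<in> I" if "a \<in> I" for r a
    using I_l_closed[OF that, of r] by (simp add: mpoly_ring_simps)
  show "a - b \<in> I" if "a \<in> I" "b \<in> I"
    using add[OF that(1) mult[OF that(2), of "- 1"]] by simp
qed

lemma mpoly_idealI:
  fixes I :: "('n::finite, 'k::field) mpoly set"
  assumes "0 \<in> I" "\<And>a b. a \<in> I \<Longrightarrow> b \<in> I \<Longrightarrow> a + b \<in> I" "\<And>r a. a \<in> I \<Longrightarrow> r * a \<in> I"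
  shows "ideal I mpoly_ring"
proof -
  interpret cring "mpoly_ring :: ('n, 'k) mpoly ring" by (rule cring_from_type_algebra)
  show ?thesis
  proof (rule idealI)
    show "subgroup I (add_monoid mpoly_ring)"
    proof (rule add.subgroupI)
      fix a assume a: "a \<in> I"
      have "\<ominus>\<^bsub>mpoly_ring\<^esub> a = - a"
        by (rule minus_equality) (simp_all add: mpoly_ring_simps)
      then show "\<ominus>\<^bsub>mpoly_ring\<^esub> a \<in> I" using assms(3)[OF a, of "- 1"] by simp
    qed (use assms in \<open>auto simp: mpoly_ring_simps\<close>)
  qed (use assms(3) in \<open>auto simp: mpoly_ring_simps ring_axioms mult.commute\<close>)
qed

lemma genideal_props:
  fixes S :: "('n::finite, 'k::field) mpoly set"
  shows "ideal (Idl\<^bsub>mpoly_ring\<^esub> S) mpoly_ring" "S \<subseteq> Idl\<^bsub>mpoly_ring\<^esub> S"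
    "ideal I mpoly_ring \<Longrightarrow> S \<subseteq> I \<Longrightarrow> Idl\<^bsub>mpoly_ring\<^esub> S \<subseteq> I"
proof -
  interpret cring "mpoly_ring :: ('n, 'k) mpoly ring" by (rule cring_from_type_algebra)
  show "ideal (Idl\<^bsub>mpoly_ring\<^esub> S) mpoly_ring" "S \<subseteq> Idl\<^bsub>mpoly_ring\<^esub> S"
    by (auto intro!: genideal_ideal genideal_self simp: mpoly_ring_simps)
  show "ideal I mpoly_ring \<Longrightarrow> S \<subseteq> I \<Longrightarrow> Idl\<^bsub>mpoly_ring\<^esub> S \<subseteq> I" by (rule genideal_minimal)
qed

text \<open>
  A regular sequence that generates a proper ideal is algebraically independent over the field. For a
  relation among the members from position \<open>k\<close> on, read modulo the first \<open>k\<close> of them, the part free of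
  \<open>f = fs ! k\<close> is a relation modulo \<open>f\<close> as well, so it vanishes by descending induction on \<open>k\<close>; the
  remaining part is a multiple of \<open>f\<close>, which can be cancelled, and the exponents of \<open>f\<close> have dropped.
\<close>

lemma regular_sequence_algebraically_independent:
  fixes fs :: "('n::finite, 'k::field) mpoly list"
  assumes reg: "regular_sequence mpoly_ring fs" and "k \<le> length fs"
    and "finite B" "\<forall>es\<in>B. length es = length fs - k"
    and "(\<Sum>es\<in>B. monomial (\<lambda>_. 0) (y es) * prod_list (map2 (^) (drop k fs) es))
      \<in> Idl\<^bsub>mpoly_ring\<^esub> (set (take k fs))"
  shows "\<forall>es\<in>B. y es = 0"
  using assms(2-)
proof (induction k arbitrary: B y rule: inc_induct)
  case base
  let ?J = "Idl\<^bsub>mpoly_ring\<^esub> (set fs)"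
  show ?case
  proof
    fix es assume es: "es \<in> B"
    then have "B = {[]}" "es = []" using base by auto
    with base have c: "monomial (\<lambda>_. 0) (y []) \<in> ?J" by simp
    show "y es = 0"
    proof (rule ccontr)
      assume "y es \<noteq> 0"
      then have "monomial (\<lambda>_. 0) (1 / y []) * monomial (\<lambda>_. 0) (y []) = (1 :: ('n, 'k) mpoly)"
        using \<open>es = []\<close> by (simp add: monomial_mult_monomial monomial_zero_one)
      then have "r \<in> ?J" for r
        using mpoly_idealD(3)[OF genideal_props(1) c, of "r * monomial (\<lambda>_. 0) (1 / y [])"]
        by (simp add: mult.assoc)
      then show False using reg by (auto simp: regular_sequence_def mpoly_ring_simps)
    qed
  qed
next
  case (step n)
  define f where "f = fs ! n"
  define mon where "mon = (\<lambda>es. prod_list (map2 (^) (drop (Suc n) fs) es))"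
  define c where "c = (\<lambda>a. monomial (\<lambda>_. 0) a :: ('n, 'k) mpoly)"
  let ?J = "Idl\<^bsub>mpoly_ring\<^esub> (set (take n fs))" and ?J' = "Idl\<^bsub>mpoly_ring\<^esub> (set (take (Suc n) fs))"
  have drop: "drop n fs = f # drop (Suc n) fs"
    using step.hyps by (simp add: f_def Cons_nth_drop_Suc)
  have take: "set (take (Suc n) fs) = insert f (set (take n fs))"
    using step.hyps by (simp add: f_def take_Suc_conv_app_nth)
  have JJ': "?J \<subseteq> ?J'" and fJ': "f \<in> ?J'"
    using genideal_props(3)[OF genideal_props(1), of "set (take n fs)" "set (take (Suc n) fs)"]
      genideal_props(2)[of "set (take (Suc n) fs)"] unfolding take by auto
  have nzd: "g \<in> ?J" if "f * g \<in> ?J" for g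
    using reg that step.hyps by (auto simp: regular_sequence_def mpoly_ring_simps f_def)
  have "\<forall>es\<in>B. y es = 0"
    if "finite B" "\<forall>es\<in>B. length es = Suc (length fs - Suc n) \<and> hd es < m"
      "(\<Sum>es\<in>B. c (y es) * (f ^ hd es * mon (tl es))) \<in> ?J" for m B y
    using that
  proof (induction m arbitrary: B y)
    case (Suc m)
    \<comment> \<open>Split the relation into the terms without \<open>f\<close> and \<open>f\<close> times the rest.\<close>
    define B0 where "B0 = {es. 0 # es \<in> B}"
    define B1 where "B1 = {es. es \<noteq> [] \<and> Suc (hd es) # tl es \<in> B}"
    have B: "B = (\<lambda>es. 0 # es) ` B0 \<union> (\<lambda>es. Suc (hd es) # tl es) ` B1" (is "_ = ?B0 \<union> ?B1")
    proof
      show "B \<subseteq> ?B0 \<union> ?B1"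
      proof
        fix es assume es: "es \<in> B"
        with Suc.prems(2) obtain e es' where e: "es = e # es'" by (cases es) auto
        show "es \<in> ?B0 \<union> ?B1"
        proof (cases e)
          case 0
          then show ?thesis using es e by (auto simp: B0_def)
        next
          case (Suc e')
          then have "es = Suc (hd (e' # es')) # tl (e' # es')" "e' # es' \<in> B1"
            using es e by (auto simp: B1_def)
          then show ?thesis by blast
        qed
      qed
    qed (auto simp: B0_def B1_def)
    have inj: "inj_on (\<lambda>es. 0 # es) B0" "inj_on (\<lambda>es. Suc (hd es) # tl es) B1"
      by (auto simp: inj_on_def B1_def) (metis list.collapse)
    have "finite (?B0 \<union> ?B1)" using Suc.prems(1) by (simp only: B[symmetric])
    then have fin: "finite B0" "finite B1"
      unfolding finite_Un using finite_imageD[OF _ inj(1)] finite_imageD[OF _ inj(2)] by blast+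
    define S0 where "S0 = (\<Sum>es\<in>B0. c (y (0 # es)) * mon es)"
    define S1 where "S1 = (\<Sum>es\<in>B1. c (y (Suc (hd es) # tl es)) * (f ^ hd es * mon (tl es)))"
    have "(\<Sum>es\<in>B. c (y es) * (f ^ hd es * mon (tl es))) =
      (\<Sum>es\<in>?B0. c (y es) * (f ^ hd es * mon (tl es))) + (\<Sum>es\<in>?B1. c (y es) * (f ^ hd es * mon (tl es)))"
      unfolding B by (rule sum.union_disjoint) (use fin in auto)
    also have "(\<Sum>es\<in>?B0. c (y es) * (f ^ hd es * mon (tl es))) = S0"
      by (simp add: sum.reindex[OF inj(1)] S0_def)
    also have "(\<Sum>es\<in>?B1. c (y es) * (f ^ hd es * mon (tl es))) = f * S1"
      by (simp add: sum.reindex[OF inj(2)] S1_def sum_distrib_left mult.left_commute mult.assoc)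
    finally have S: "S0 + f * S1 \<in> ?J" using Suc.prems(3) by simp
    have "S0 = (S0 + f * S1) - S1 * f" by (simp add: mult.commute)
    then have "S0 \<in> ?J'"
      using mpoly_idealD(4)[OF genideal_props(1) subsetD[OF JJ' S]
          mpoly_idealD(3)[OF genideal_props(1) fJ', of S1]] by simp
    then have "\<forall>es\<in>B0. y (0 # es) = 0"
      using fin(1) Suc.prems(2) unfolding S0_def mon_def c_def
      by (intro step.IH) (auto simp: B0_def)
    moreover from this have "S0 = 0"
      unfolding S0_def c_def
      by (intro sum.neutral ballI) (simp add: monomial_def)
    with S have "S1 \<in> ?J" using nzd by simp
    then have "\<forall>es\<in>B1. y (Suc (hd es) # tl es) = 0"
      unfolding S1_def using fin(2) Suc.prems(2) by (intro Suc.IH) (auto simp: B1_def)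
    ultimately show ?case by (subst B) auto
  qed auto
  note inner = this
  obtain m where m: "\<forall>es\<in>B. hd es < m"
    using finite_nat_set_iff_bounded[of "hd ` B"] step.prems by auto
  have len: "length fs - n = Suc (length fs - Suc n)" using step.hyps by simp
  show ?case
  proof (rule inner[of B m])
    have "prod_list (map2 (^) (drop n fs) es) = f ^ hd es * mon (tl es)" if "es \<in> B" for es
      using step.prems(2) that len by (cases es) (auto simp: drop mon_def)
    then show "(\<Sum>es\<in>B. c (y es) * (f ^ hd es * mon (tl es))) \<in> ?J"
      using step.prems(3) by (simp add: c_def)
  qed (use step.prems m len in auto)
qed

lemma coef_power_bound:
  assumes "\<And>\<eta> l. coef f \<eta> \<noteq> 0 \<Longrightarrow> \<eta> l \<le> C" "coef (f ^ e) \<eta> \<noteq> 0"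
  shows "\<eta> l \<le> e * C"
  using assms(2)
proof (induction e arbitrary: \<eta>)
  case 0
  then show ?case by (auto simp: monomial_zero_one[symmetric] coef_monomial split: if_splits)
next
  case (Suc e)
  from Suc.prems obtain \<mu> \<rho> where "\<eta> = (\<lambda>l. \<mu> l + \<rho> l)" "coef f \<mu> \<noteq> 0" "coef (f ^ e) \<rho> \<noteq> 0"
    by (auto elim: coef_mult_nonzeroE)
  then show ?case using assms(1)[of \<mu> l] Suc.IH[of \<rho>] by simp
qed

lemma coef_power_product_bound:
  assumes "\<And>f \<eta> l. f \<in> set fs \<Longrightarrow> coef f \<eta> \<noteq> 0 \<Longrightarrow> \<eta> l \<le> C"
    and "coef (prod_list (map2 (^) fs es)) \<eta> \<noteq> 0" and "length es = length fs" and "set es \<subseteq> {..<M}"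
  shows "\<eta> l \<le> length fs * (M * C)"
  using assms(3,1,2,4)
proof (induction es fs arbitrary: \<eta> rule: list_induct2)
  case Nil
  then show ?case by (auto simp: monomial_zero_one[symmetric] coef_monomial split: if_splits)
next
  case (Cons e es f fs)
  from Cons.prems obtain \<mu> \<rho> where d: "\<eta> = (\<lambda>l. \<mu> l + \<rho> l)" "coef (f ^ e) \<mu> \<noteq> 0"
    "coef (prod_list (map2 (^) fs es)) \<rho> \<noteq> 0"
    by (auto elim: coef_mult_nonzeroE)
  have "\<mu> l \<le> e * C" by (rule coef_power_bound[OF _ d(2)]) (use Cons.prems(1) in auto)
  also have "e * C \<le> M * C" using Cons.prems(3) by simp
  finally have "\<mu> l \<le> M * C" .
  moreover have "\<rho> l \<le> length fs * (M * C)" by (rule Cons.IH) (use Cons.prems d in auto)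
  ultimately show ?case using d by simp
qed

text \<open>
  More than \<open>N\<close> polynomials in \<open>N\<close> variables are algebraically dependent, by counting: there are
  \<open>M ^ n\<close> products of powers with exponents below \<open>M\<close>, while their monomials have exponents bounded
  linearly in \<open>M\<close>, which leaves only \<open>O(M ^ N)\<close> of them.
\<close>

lemma regular_sequence_length:
  fixes fs :: "('n::finite, 'k::field) mpoly list"
  assumes reg: "regular_sequence mpoly_ring fs"
  shows "length fs \<le> card (UNIV :: 'n set)"
proof (rule ccontr)
  assume "\<not> ?thesis"
  then have n: "card (UNIV :: 'n set) < length fs" by simp
  define n where "n = length fs"
  define C where "C = Max (insert 0 (\<Union>f\<in>set fs. \<Union>\<mu>\<in>Poly_Mapping.keys f. range (Poly_Mapping.lookup \<mu>)))"
  have C: "\<eta> l \<le> C" if "f \<in> set fs" "coef f \<eta> \<noteq> 0" for f \<eta> l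
  proof -
    have "Abs_poly_mapping \<eta> \<in> Poly_Mapping.keys f" using that by (simp add: in_keys_iff coef_def)
    then show ?thesis unfolding C_def
      by (intro Max_ge) (use that in \<open>auto intro!: bexI[of _ f] bexI[of _ "Abs_poly_mapping \<eta>"]\<close>)
  qed
  \<comment> \<open>Large enough for \<open>M ^ (N + 1)\<close> to beat the number of monomials.\<close>
  define M where "M = Suc ((n * C + 1) ^ card (UNIV :: 'n set))"
  define D where "D = {es. set es \<subseteq> {..<M} \<and> length es = n}"
  define E where "E = {\<eta> :: 'n \<Rightarrow> nat. \<eta> \<le> (\<lambda>_. n * (M * C))}"
  have "E = PiE UNIV (\<lambda>_. {..n * (M * C)})" by (auto simp: E_def le_fun_def)
  then have "card E = (n * (M * C) + 1) ^ card (UNIV :: 'n set)" by (simp add: card_PiE)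
  also have "\<dots> \<le> (M * (n * C + 1)) ^ card (UNIV :: 'n set)"
    by (rule power_mono) (auto simp: M_def algebra_simps)
  also have "\<dots> = M ^ card (UNIV :: 'n set) * (n * C + 1) ^ card (UNIV :: 'n set)" by (rule power_mult_distrib)
  also have "\<dots> < M ^ card (UNIV :: 'n set) * M" by (simp add: M_def)
  also have "\<dots> = M ^ Suc (card (UNIV :: 'n set))" by simp
  also have "\<dots> \<le> M ^ n" using n by (intro power_increasing) (auto simp: M_def n_def)
  also have "\<dots> = card D" by (simp add: D_def card_lists_length_eq)
  finally have less: "card E < card D" .
  have "finite E" "finite D" by (auto simp: E_def D_def finite_box finite_lists_length_eq)
  from underdetermined_system[OF this less, of "\<lambda>\<eta> es. coef (prod_list (map2 (^) fs es)) \<eta>"]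
  obtain y where y: "\<exists>es\<in>D. y es \<noteq> 0"
    "\<forall>\<eta>\<in>E. (\<Sum>es\<in>D. y es * coef (prod_list (map2 (^) fs es)) \<eta>) = 0" by blast
  have "(\<Sum>es\<in>D. monomial (\<lambda>_. 0) (y es) * prod_list (map2 (^) (drop 0 fs) es)) = 0"
  proof (rule mpoly_eqI)
    fix \<eta> :: "'n \<Rightarrow> nat"
    have z: "\<eta> - (\<lambda>_. 0) = \<eta>" "(\<lambda>_. 0) \<le> \<eta>" by (auto simp: le_fun_def)
    have "(\<Sum>es\<in>D. y es * coef (prod_list (map2 (^) fs es)) \<eta>) = 0"
    proof (cases "\<eta> \<in> E")
      case False
      have "coef (prod_list (map2 (^) fs es)) \<eta> = 0" if "es \<in> D" for es
        using coef_power_product_bound[where fs = fs and C = C and es = es and \<eta> = \<eta> and M = M] C that False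
        by (auto simp: D_def E_def le_fun_def n_def)
      then show ?thesis by simp
    qed (use y in simp)
    then show "coef (\<Sum>es\<in>D. monomial (\<lambda>_. 0) (y es) * prod_list (map2 (^) (drop 0 fs) es)) \<eta> = coef 0 \<eta>"
      by (simp add: coef_sum coef_monomial_mult z)
  qed
  then have "\<forall>es\<in>D. y es = 0"
    using reg \<open>finite D\<close> mpoly_idealD(1)[OF genideal_props(1)]
    by (intro regular_sequence_algebraically_independent[of fs 0]) (auto simp: D_def n_def)
  with y(1) show False by blast
qed

text \<open>
  The coefficients at \<open>D\<close> define a surjective linear map from the annihilator \<open>I\<close> to a space of
  dimension \<open>card D\<close>. The vanishing hypothesis says that this map kills \<open>mI\<close>, where \<open>m\<close> is the ideal
  of the variables. Hence \<open>card D\<close> is at most the dimension of \<open>I/mI\<close>, that is, at most the number of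
  generators. The generators may be inhomogeneous.
\<close>

lemma generators_lower_bound:
  fixes F :: "('n::finite, 'k::field) mpoly"
  assumes gen: "Ann F = Idl\<^bsub>mpoly_ring\<^esub> (set fs)" and "finite D"
    and crit: "\<And>\<mu> l g. \<mu> \<in> D \<Longrightarrow> 0 < \<mu> l \<Longrightarrow> g \<in> Ann F \<Longrightarrow> coef g (\<mu>(l := \<mu> l - 1)) = 0"
    and dual: "\<And>\<mu>. \<mu> \<in> D \<Longrightarrow> \<exists>g\<in>Ann F. \<forall>\<mu>'\<in>D. coef g \<mu>' = (if \<mu>' = \<mu> then 1 else 0)"
  shows "card D \<le> length fs"
proof (rule ccontr)
  assume "\<not> ?thesis"
  then have "card {..<length fs} < card D" by simp
  from underdetermined_system[OF finite_lessThan assms(2) this, of "\<lambda>i. coef (fs ! i)"]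
  obtain y where y: "\<exists>\<mu>\<in>D. y \<mu> \<noteq> 0" "\<forall>i<length fs. (\<Sum>\<mu>\<in>D. y \<mu> * coef (fs ! i) \<mu>) = 0" by auto
  \<comment> \<open>A functional that vanishes on the generators, hence on the ideal, but not on the dual elements.\<close>
  define \<phi> where "\<phi> = (\<lambda>g. \<Sum>\<mu>\<in>D. y \<mu> * coef g \<mu>)"
  have local: "coef (r * g) \<mu> = coef r (\<lambda>_. 0) * coef g \<mu>" if "\<mu> \<in> D" "g \<in> Ann F" for r g \<mu>
  proof (induction r rule: mpoly_monomial_induct)
    case (mono \<eta> c)
    show ?case
    proof (cases "\<eta> = (\<lambda>_. 0)")
      case True
      have "\<mu> - (\<lambda>_. 0) = \<mu>" "(\<lambda>_. 0) \<le> \<mu>" by (auto simp: le_fun_def)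
      then show ?thesis using True by (simp add: coef_monomial_mult coef_monomial)
    next
      case False
      then obtain l where l: "0 < \<eta> l" by (auto simp: fun_eq_iff)
      have "(\<lambda>k. ((\<lambda>_. 0)(l := 1)) k + (\<eta>(l := \<eta> l - 1)) k) = \<eta>" using l by (auto simp: fun_eq_iff)
      then have "monomial \<eta> c * g = monomial ((\<lambda>_. 0)(l := 1)) 1 * (monomial (\<eta>(l := \<eta> l - 1)) c * g)"
        by (simp add: mult.assoc[symmetric] monomial_mult_monomial)
      moreover have "coef (monomial ((\<lambda>_. 0)(l := 1)) 1 * h) \<mu> = 0" if "h \<in> Ann F" for h
      proof -
        have "\<mu> - (\<lambda>_. 0)(l := 1) = \<mu>(l := \<mu> l - 1)" by (auto simp: fun_eq_iff)
        moreover have "((\<lambda>_. 0)(l := 1)) \<le> \<mu> \<Longrightarrow> 0 < \<mu> l" by (auto simp: le_fun_def dest: spec[of _ l])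
        ultimately show ?thesis
          using crit[OF \<open>\<mu> \<in> D\<close> _ that] by (auto simp: coef_monomial_mult)
      qed
      ultimately show ?thesis
        using False Ann_mult[OF \<open>g \<in> Ann F\<close>] by (simp add: coef_monomial)
    qed
  qed (auto simp: distrib_right)
  have "\<phi> (r * g) = coef r (\<lambda>_. 0) * \<phi> g" if "g \<in> Ann F" for r g
    using that by (simp add: \<phi>_def local sum_distrib_left mult.left_commute)
  moreover have "\<phi> (g + h) = \<phi> g + \<phi> h" for g h
    by (simp add: \<phi>_def distrib_left sum.distrib)
  ultimately have "ideal {g \<in> Ann F. \<phi> g = 0} mpoly_ring"
    by (intro mpoly_idealI) (auto simp: Ann_zero Ann_add Ann_mult \<phi>_def)
  moreover have "set fs \<subseteq> {g \<in> Ann F. \<phi> g = 0}"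
    using y(2) genideal_props(2)[of "set fs"] gen by (auto simp: \<phi>_def in_set_conv_nth)
  ultimately have *: "\<phi> g = 0" if "g \<in> Ann F" for g
    using genideal_props(3)[of "{g \<in> Ann F. \<phi> g = 0}" "set fs"] that gen by auto
  have "y \<mu> = 0" if "\<mu> \<in> D" for \<mu>
  proof -
    obtain g where g: "g \<in> Ann F" "\<forall>\<mu>'\<in>D. coef g \<mu>' = (if \<mu>' = \<mu> then 1 else 0)"
      using dual[OF \<open>\<mu> \<in> D\<close>] by blast
    have "\<phi> g = (\<Sum>\<mu>'\<in>D. if \<mu>' = \<mu> then y \<mu> else 0)"
      unfolding \<phi>_def by (rule sum.cong) (use g(2) in auto)
    then show ?thesis using *[OF g(1)] that assms(2) by simp
  qed
  with y(1) show False by blast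
qed

section \<open>Reduction of the strong Lefschetz property to injectivity\<close>

text \<open>
  Write \<open>A\<close> for the quotient and \<open>D\<close> for its socle degree. Contraction to degree 0 gives a perfect pairing of
  \<open>A_i\<close> with \<open>A_{D-i}\<close>, for which multiplication by \<open>z ^ (D - 2 * i)\<close> from \<open>A_i\<close> to \<open>A_{D-i}\<close> is
  self-adjoint. An injective self-adjoint map is surjective; here this is the Fredholm alternative.
  Injectivity of \<open>z ^ e\<close> on \<open>A_i\<close> for \<open>2 * i + e \<le> D\<close> and surjectivity for \<open>2 * i + e > D\<close> follow by
  factoring these bijections.
\<close>

lemma strong_Lefschetz_of_injective:
  fixes \<alpha> \<beta> :: "'n::finite \<Rightarrow> nat" and a b :: "'k::field"
  defines "F \<equiv> monomial \<alpha> a + monomial \<beta> b"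
  assumes deg: "tdeg \<alpha> = D" "tdeg \<beta> = D" and z: "z \<in> homogeneous_part 1"
    and inj: "\<And>i f. 2 * i \<le> D \<Longrightarrow> f \<in> homogeneous_part i \<Longrightarrow> z ^ (D - 2 * i) * f \<in> Ann F \<Longrightarrow> f \<in> Ann F"
  shows "strong_Lefschetz (mpoly_ring Quot Ann F) (quotient_part (Ann F))"
proof -
  interpret I: ideal "Ann F" "mpoly_ring :: ('n, 'k) mpoly ring" by (rule ideal_Ann)
  let ?Q = "mpoly_ring Quot Ann F"
  let ?q = "(+>\<^bsub>mpoly_ring\<^esub>) (Ann F)"
  let ?mul = "\<lambda>e x. ?q z [^]\<^bsub>?Q\<^esub> (e :: nat) \<otimes>\<^bsub>?Q\<^esub> x"
  have eq: "?q f = ?q g \<longleftrightarrow> f - g \<in> Ann F" for f g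
  proof -
    have "\<ominus>\<^bsub>mpoly_ring\<^esub> g = - g" for g :: "('n, 'k) mpoly"
      by (rule I.minus_equality) (simp_all add: mpoly_ring_simps)
    then have "f \<ominus>\<^bsub>mpoly_ring\<^esub> g = f - g"
      by (simp add: a_minus_def mpoly_ring_simps)
    then show ?thesis
      using I.quotient_eq_iff_same_a_r_cos[OF ideal_Ann, of f g F] by (simp add: mpoly_ring_simps)
  qed
  have mult: "?q z [^]\<^bsub>?Q\<^esub> d \<otimes>\<^bsub>?Q\<^esub> ?q f = ?q (z ^ d * f)"
    for d :: nat and f
  proof -
    interpret Q: ring_hom_ring "mpoly_ring :: ('n, 'k) mpoly ring" ?Q ?q
      by (rule I.rcos_ring_hom_ring)
    have "z [^]\<^bsub>mpoly_ring\<^esub> d = z ^ d"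
      by (induction d) (simp_all add: mpoly_ring_simps mult.commute)
    then show ?thesis
      using Q.hom_mult[of "z [^]\<^bsub>mpoly_ring\<^esub> d" f] Q.hom_nat_pow[of z d] by (simp add: mpoly_ring_simps)
  qed
  have zpow: "z ^ d * f \<in> homogeneous_part (i + d)" if "f \<in> homogeneous_part i" for f d i
    using homogeneous_part_mult[OF homogeneous_part_power[OF z, of d] that] by (simp add: add.commute)
  have big: "f \<in> Ann F" if "f \<in> homogeneous_part j" "D < j" for f j
    unfolding F_def Ann_binomial_iff
  proof (intro allI)
    fix \<rho>
    have "coef f (\<gamma> - \<rho>) = 0" if "tdeg \<gamma> = D" "\<rho> \<le> \<gamma>" for \<gamma>
      using \<open>f \<in> homogeneous_part j\<close> \<open>D < j\<close> tdeg_diff[OF that(2)] that(1)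
      unfolding homogeneous_part_iff by (metis diff_le_self linorder_not_le)
    then show "(if \<rho> \<le> \<alpha> then a * coef f (\<alpha> - \<rho>) else 0) + (if \<rho> \<le> \<beta> then b * coef f (\<beta> - \<rho>) else 0) = 0"
      using deg by simp
  qed
  define \<phi> where "\<phi> = (\<lambda>h. a * coef h \<alpha> + b * coef h \<beta>)"
  have Ann_hom: "f \<in> Ann F \<longleftrightarrow> (\<forall>\<eta>. tdeg \<eta> = i \<longrightarrow> \<phi> (monomial \<eta> 1 * f) = 0)"
    if f: "f \<in> homogeneous_part j" and ij: "i + j = D" for f i j
  proof -
    have "(if \<rho> \<le> \<alpha> then a * coef f (\<alpha> - \<rho>) else 0) + (if \<rho> \<le> \<beta> then b * coef f (\<beta> - \<rho>) else 0) =
      \<phi> (monomial \<rho> 1 * f)" for \<rho>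
      by (simp add: \<phi>_def coef_monomial_mult)
    moreover have "\<phi> (monomial \<rho> 1 * f) = 0" if "tdeg \<rho> \<noteq> i" for \<rho>
    proof -
      have "coef f (\<gamma> - \<rho>) = 0" if "tdeg \<gamma> = D" "\<rho> \<le> \<gamma>" for \<gamma>
      proof (rule ccontr)
        assume "coef f (\<gamma> - \<rho>) \<noteq> 0"
        then have "tdeg \<gamma> - tdeg \<rho> = j"
          using f tdeg_diff[OF that(2)] unfolding homogeneous_part_iff by metis
        then show False using tdeg_mono[OF that(2)] that(1) ij \<open>tdeg \<rho> \<noteq> i\<close> by linarith
      qed
      then show ?thesis using deg by (simp add: \<phi>_def coef_monomial_mult)
    qed
    ultimately show ?thesis unfolding F_def Ann_binomial_iff by metis
  qed
  have \<phi>_lin: "\<phi> (\<Sum>x\<in>A. monomial (\<lambda>_. 0) (u x) * h x) = (\<Sum>x\<in>A. u x * \<phi> (h x))" for A :: "('n \<Rightarrow> nat) set" and u h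
  proof -
    have "\<gamma> - (\<lambda>_. 0) = \<gamma>" "(\<lambda>_. 0) \<le> \<gamma>" for \<gamma> :: "'n \<Rightarrow> nat" by (auto simp: le_fun_def)
    then show ?thesis
      by (simp add: \<phi>_def coef_sum coef_monomial_mult sum_distrib_left sum.distrib distrib_left mult.left_commute)
  qed
  have surj: "\<exists>f\<in>homogeneous_part i. g - z ^ (D - 2 * i) * f \<in> Ann F"
    if i: "2 * i \<le> D" and g: "g \<in> homogeneous_part (D - i)" for i g
  proof -
    let ?e = "D - 2 * i"
    define B where "B = {\<eta> :: 'n \<Rightarrow> nat. tdeg \<eta> = i}"
    have fin: "finite B" by (simp add: B_def finite_tdeg)
    let ?m = "\<lambda>\<eta>. monomial \<eta> (1::'k)"
    have m0: "monomial (\<lambda>_. 0) c * ?m \<eta> = monomial \<eta> c" for c \<eta>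
      by (simp add: monomial_mult_monomial)
    have hom_sum: "(\<Sum>\<eta>\<in>B. monomial \<eta> (y \<eta>)) \<in> homogeneous_part i" for y
      unfolding homogeneous_part_iff using fin by (auto simp: coef_sum_monomial B_def)
    have sum_mult: "h * (\<Sum>\<eta>\<in>B. monomial \<eta> (y \<eta>)) = (\<Sum>\<eta>\<in>B. monomial (\<lambda>_. 0) (y \<eta>) * (h * ?m \<eta>))" for h y
      by (simp add: sum_distrib_left mult.left_commute m0)
    have "\<exists>x. \<forall>\<eta>\<in>B. (\<Sum>\<xi>\<in>B. \<phi> (?m \<eta> * (z ^ ?e * ?m \<xi>)) * x \<xi>) = \<phi> (?m \<eta> * g)"
    proof (rule Fredholm_alternative[OF fin fin])
      fix y assume y: "\<forall>\<xi>\<in>B. (\<Sum>\<eta>\<in>B. y \<eta> * \<phi> (?m \<eta> * (z ^ ?e * ?m \<xi>))) = 0"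
      let ?f = "\<Sum>\<eta>\<in>B. monomial \<eta> (y \<eta>)"
      have "z ^ ?e * ?f \<in> homogeneous_part (D - i)" using zpow[OF hom_sum, of ?e] i by simp
      moreover have "\<phi> (?m \<xi> * (z ^ ?e * ?f)) = 0" if "tdeg \<xi> = i" for \<xi>
      proof -
        have "\<phi> (?m \<xi> * (z ^ ?e * ?f)) = (\<Sum>\<eta>\<in>B. y \<eta> * \<phi> ((?m \<xi> * z ^ ?e) * ?m \<eta>))"
          using sum_mult[of "?m \<xi> * z ^ ?e" y] by (simp only: mult.assoc[of "?m \<xi>"] \<phi>_lin)
        also have "\<dots> = (\<Sum>\<eta>\<in>B. y \<eta> * \<phi> (?m \<eta> * (z ^ ?e * ?m \<xi>)))" by (simp add: ac_simps)
        finally show ?thesis using y that by (simp add: B_def)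
      qed
      ultimately have "z ^ ?e * ?f \<in> Ann F" using Ann_hom[of "z ^ ?e * ?f" "D - i" i] i by auto
      then have "?f \<in> Ann F" by (rule inj[OF i hom_sum])
      then have "g * ?f \<in> Ann F" by (rule Ann_mult)
      moreover have "g * ?f \<in> homogeneous_part D"
        using homogeneous_part_mult[OF g hom_sum] i by simp
      ultimately have "\<phi> (monomial (\<lambda>_. 0) 1 * (g * ?f)) = 0"
        using Ann_hom[of "g * ?f" D 0] by (simp add: tdeg_def)
      then have "\<phi> (g * ?f) = 0" by (simp add: monomial_zero_one)
      then show "(\<Sum>\<eta>\<in>B. y \<eta> * \<phi> (?m \<eta> * g)) = 0"
        unfolding sum_mult \<phi>_lin by (simp add: mult.commute)
    qed
    then obtain x where x: "\<forall>\<eta>\<in>B. (\<Sum>\<xi>\<in>B. \<phi> (?m \<eta> * (z ^ ?e * ?m \<xi>)) * x \<xi>) = \<phi> (?m \<eta> * g)" by blast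
    let ?f = "\<Sum>\<eta>\<in>B. monomial \<eta> (x \<eta>)"
    have "z ^ ?e * ?f \<in> homogeneous_part (D - i)" using zpow[OF hom_sum, of ?e] i by simp
    then have "g - z ^ ?e * ?f \<in> homogeneous_part (D - i)" using g by (intro homogeneous_part_diff)
    moreover have "\<phi> (?m \<eta> * (g - z ^ ?e * ?f)) = 0" if "tdeg \<eta> = i" for \<eta>
    proof -
      have "\<phi> (?m \<eta> * (z ^ ?e * ?f)) = (\<Sum>\<xi>\<in>B. x \<xi> * \<phi> ((?m \<eta> * z ^ ?e) * ?m \<xi>))"
        using sum_mult[of "?m \<eta> * z ^ ?e" x] by (simp only: mult.assoc[of "?m \<eta>"] \<phi>_lin)
      also have "\<dots> = \<phi> (?m \<eta> * g)"
        using x that by (simp add: B_def mult.assoc mult.commute[of "x _"])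
      moreover have "\<phi> (p - q) = \<phi> p - \<phi> q" for p q by (simp add: \<phi>_def right_diff_distrib)
      ultimately show ?thesis by (simp add: right_diff_distrib)
    qed
    ultimately have "g - z ^ ?e * ?f \<in> Ann F"
      using Ann_hom[of "g - z ^ ?e * ?f" "D - i" i] i by auto
    with hom_sum show ?thesis by blast
  qed
  have "inj_on (?mul e) (quotient_part (Ann F) i) \<or>
    (?mul e) ` quotient_part (Ann F) i =
      quotient_part (Ann F) (i + e)" for i e :: nat
  proof (cases "2 * i + e \<le> D")
    case True
    have "f - g \<in> Ann F"
      if "f \<in> homogeneous_part i" "g \<in> homogeneous_part i" "z ^ e * f - z ^ e * g \<in> Ann F" for f g
    proof (rule inj[of i])
      have "z ^ (D - 2 * i) = z ^ (D - 2 * i - e) * z ^ e"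
        using True by (simp add: power_add[symmetric])
      then show "z ^ (D - 2 * i) * (f - g) \<in> Ann F"
        using Ann_mult[OF that(3), of "z ^ (D - 2 * i - e)"] by (simp add: algebra_simps)
    qed (use True that in \<open>auto intro: homogeneous_part_diff\<close>)
    then have "inj_on (?mul e)
        (?q ` homogeneous_part i)"
      by (intro inj_onI, elim imageE, hypsubst) (unfold mult eq, blast)
    then show ?thesis unfolding quotient_part_def ..
  next
    case False
    have onto: "\<exists>f\<in>homogeneous_part i. g - z ^ e * f \<in> Ann F" if g: "g \<in> homogeneous_part (i + e)" for g
    proof (cases "i + e \<le> D")
      case le: True
      define i' where "i' = D - (i + e)"
      have i': "2 * i' \<le> D" "D - i' = i + e" "D - 2 * i' = e + (i - i')" "i' \<le> i"
        using le False by (auto simp: i'_def)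
      obtain f where f: "f \<in> homogeneous_part i'" "g - z ^ (e + (i - i')) * f \<in> Ann F"
        using surj[OF i'(1), of g] g i' by auto
      show ?thesis
        using f(2) zpow[OF f(1), of "i - i'"] i'(4) unfolding power_add mult.assoc
        by (intro bexI[of _ "z ^ (i - i') * f"]) simp_all
    next
      case False
      have "0 \<in> homogeneous_part i" by (simp add: homogeneous_part_iff)
      then show ?thesis using big[OF g] False by (intro bexI[of _ 0]) auto
    qed
    have "(\<lambda>f. ?q (z ^ e * f)) ` homogeneous_part i = ?q ` homogeneous_part (i + e)"
    proof
      show "(\<lambda>f. ?q (z ^ e * f)) ` homogeneous_part i \<subseteq> ?q ` homogeneous_part (i + e)"
        using zpow by auto
      show "?q ` homogeneous_part (i + e) \<subseteq> (\<lambda>f. ?q (z ^ e * f)) ` homogeneous_part i"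
      proof
        fix x assume "x \<in> ?q ` homogeneous_part (i + e)"
        then obtain g where "g \<in> homogeneous_part (i + e)" "x = ?q g" by blast
        with onto obtain f where "f \<in> homogeneous_part i" "x = ?q (z ^ e * f)" using eq by blast
        then show "x \<in> (\<lambda>f. ?q (z ^ e * f)) ` homogeneous_part i" by blast
      qed
    qed
    then show ?thesis
      unfolding quotient_part_def by (simp add: image_image mult)
  qed
  moreover have "?q z \<in> quotient_part (Ann F) 1" unfolding quotient_part_def using z by blast
  ultimately show ?thesis unfolding strong_Lefschetz_def by blast
qed

section \<open>Monomial complete intersections\<close>

text \<open>
  The representation theory of \<open>sl_2\<close> in the form needed here: \<open>E\<close> raises the degree, \<open>F\<close> lowers it, and
  their commutator is the scalar \<open>2 * i - d\<close> in degree \<open>i\<close>. If \<open>E ^ (d - 2 * i)\<close> kills \<open>c\<close>, the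
  commutation formula for \<open>F\<close> and a power of \<open>E\<close> shows that \<open>F c\<close> is killed by the corresponding power
  one degree below, so \<open>F c = 0\<close> by induction; for such a primitive \<open>c\<close> the formula has no
  zero coefficient in characteristic 0 and peels off the powers of \<open>E\<close> one by one.
\<close>

lemma sl2_injective:
  fixes E F :: "('a \<Rightarrow> 'k::field_char_0) \<Rightarrow> ('a \<Rightarrow> 'k)" and V :: "nat \<Rightarrow> ('a \<Rightarrow> 'k) set"
  assumes E: "\<And>i c. c \<in> V i \<Longrightarrow> E c \<in> V (Suc i)"
    and F: "\<And>i c. c \<in> V (Suc i) \<Longrightarrow> F c \<in> V i" and F0: "\<And>c. c \<in> V 0 \<Longrightarrow> F c = (\<lambda>_. 0)"
    and E_zero: "E (\<lambda>_. 0) = (\<lambda>_. 0)" and F_zero: "F (\<lambda>_. 0) = (\<lambda>_. 0)"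
    and E_lin: "\<And>r c c'. E (\<lambda>x. c x + r * c' x) = (\<lambda>x. E c x + r * E c' x)"
    and comm: "\<And>i c x. c \<in> V i \<Longrightarrow> E (F c) x - F (E c) x = (2 * of_nat i - of_nat d) * c x"
    and "c \<in> V i" "2 * i \<le> d" "(E ^^ (d - 2 * i)) c = (\<lambda>_. 0)"
  shows "c = (\<lambda>_. 0)"
  using assms(8-)
proof (induction i arbitrary: c)
  have FE: "F ((E ^^ r) c) x = (E ^^ r) (F c) x + of_nat r * (of_nat d - 2 * of_nat i - of_nat r + 1) * (E ^^ (r - 1)) c x"
    if c: "c \<in> V i" for r i c x
  proof (induction r arbitrary: x)
    case (Suc r)
    have Er: "(E ^^ r) c \<in> V (i + r)" using c by (induction r) (auto simp: E)
    have "E (F ((E ^^ r) c)) x = (E ^^ Suc r) (F c) x +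
      of_nat r * (of_nat d - 2 * of_nat i - of_nat r + 1) * (E ^^ r) c x"
    proof -
      have "F ((E ^^ r) c) = (\<lambda>x. (E ^^ r) (F c) x + (of_nat r * (of_nat d - 2 * of_nat i - of_nat r + 1)) * (E ^^ (r - 1)) c x)"
        using Suc by auto
      then have "E (F ((E ^^ r) c)) = (\<lambda>x. E ((E ^^ r) (F c)) x + (of_nat r * (of_nat d - 2 * of_nat i - of_nat r + 1)) * E ((E ^^ (r - 1)) c) x)"
        by (simp only: E_lin)
      then show ?thesis by (cases r) simp_all
    qed
    with comm[OF Er, of x] show ?case by (simp add: algebra_simps)
  qed simp
  have lower: "c = (\<lambda>_. 0)" if c: "c \<in> V i" "F c = (\<lambda>_. 0)" "2 * i \<le> d" "(E ^^ (d - 2 * i)) c = (\<lambda>_. 0)" for c i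
  proof -
    have E0: "(E ^^ r) (\<lambda>_. 0) = (\<lambda>_. 0)" for r by (induction r) (auto simp: E_zero)
    have "(E ^^ r) c = (\<lambda>_. 0)" if "r \<le> d - 2 * i" for r
      using that
    proof (induction r rule: inc_induct)
      case base
      show ?case by (fact c(4))
    next
      case (step r)
      have "of_nat (Suc r) * (of_nat d - 2 * of_nat i - of_nat (Suc r) + 1) = (of_nat (Suc r * (d - 2 * i - r)) :: 'k)"
      proof -
        have "2 * i + r \<le> d" using step.hyps c(3) by simp
        then obtain k where k: "d = 2 * i + r + k" using le_Suc_ex by blast
        then have "d - 2 * i - r = k" by simp
        moreover have "of_nat d - 2 * of_nat i - of_nat (Suc r) + 1 = (of_nat k :: 'k)" unfolding k by simp
        ultimately show ?thesis by (simp only: of_nat_mult)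
      qed
      then have "of_nat (Suc r * (d - 2 * i - r)) * (E ^^ r) c x = 0" for x
        using FE[OF c(1), of "Suc r" x] by (simp only: step.IH c(2) E0 F_zero) simp
      moreover have "(of_nat (Suc r * (d - 2 * i - r)) :: 'k) \<noteq> 0"
        unfolding of_nat_eq_0_iff using step.hyps by simp
      ultimately show ?case by (auto simp: fun_eq_iff)
    qed
    from this[of 0] show ?thesis by simp
  qed
  {
    case 0
    then show ?case using lower[of c 0] F0 by simp
  next
    case (Suc i)
    let ?m = "d - 2 * Suc i"
    have m: "d - 2 * i = Suc (Suc ?m)" using Suc.prems by simp
    have "(E ^^ Suc ?m) (F c) x = 0" for x
    proof -
      have "(E ^^ Suc ?m) c = (\<lambda>_. 0)" using Suc.prems E_zero by simp
      moreover have "(of_nat d - 2 * of_nat (Suc i) - of_nat (Suc ?m) + 1 :: 'k) = 0"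
        using Suc.prems(2) by (simp add: of_nat_diff)
      ultimately show ?thesis
        using FE[OF Suc.prems(1), of "Suc ?m" x] F_zero by simp
    qed
    then have prev: "(E ^^ Suc ?m) (F c) = (\<lambda>_. 0)" by (rule ext)
    have "(E ^^ (d - 2 * i)) (F c) = E ((E ^^ Suc ?m) (F c))"
      unfolding m by (simp only: funpow.simps o_apply)
    also have "\<dots> = (\<lambda>_. 0)" unfolding prev by (rule E_zero)
    finally have "(E ^^ (d - 2 * i)) (F c) = (\<lambda>_. 0)" .
    moreover have "F c \<in> V i" by (rule F) (rule Suc.prems(1))
    moreover have "2 * i \<le> d" using Suc.prems(2) by simp
    ultimately have "F c = (\<lambda>_. 0)" using Suc.IH by blast
    then show ?case using lower[OF Suc.prems(1)] Suc.prems(2,3) by simp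
  }
qed

text \<open>
  Functions on exponent vectors stand for elements of the monomial complete intersection with basis
  the monomials below \<open>\<tau>\<close>. The operator \<open>raise_at\<close> is multiplication by the variable \<open>l\<close> there, and
  \<open>lower_at\<close> is the lowering operator of the irreducible representation of dimension \<open>\<tau> l + 1\<close>.
\<close>

definition raise_at :: "('n \<Rightarrow> nat) \<Rightarrow> 'n \<Rightarrow> (('n \<Rightarrow> nat) \<Rightarrow> 'k::field) \<Rightarrow> ('n \<Rightarrow> nat) \<Rightarrow> 'k" where
  "raise_at \<tau> l c \<eta> = (if 0 < \<eta> l \<and> \<eta> l \<le> \<tau> l then c (\<eta>(l := \<eta> l - 1)) else 0)"

definition lower_at :: "('n \<Rightarrow> nat) \<Rightarrow> 'n \<Rightarrow> (('n \<Rightarrow> nat) \<Rightarrow> 'k::field) \<Rightarrow> ('n \<Rightarrow> nat) \<Rightarrow> 'k" where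
  "lower_at \<tau> l c \<eta> = of_nat ((\<eta> l + 1) * (\<tau> l - \<eta> l)) * c (\<eta>(l := \<eta> l + 1))"

definition raise :: "('n::finite \<Rightarrow> nat) \<Rightarrow> (('n \<Rightarrow> nat) \<Rightarrow> 'k::field) \<Rightarrow> ('n \<Rightarrow> nat) \<Rightarrow> 'k" where
  "raise \<tau> c \<eta> = (\<Sum>l\<in>UNIV. raise_at \<tau> l c \<eta>)"

definition lower :: "('n::finite \<Rightarrow> nat) \<Rightarrow> (('n \<Rightarrow> nat) \<Rightarrow> 'k::field) \<Rightarrow> ('n \<Rightarrow> nat) \<Rightarrow> 'k" where
  "lower \<tau> c \<eta> = (\<Sum>l\<in>UNIV. lower_at \<tau> l c \<eta>)"

definition box_part :: "('n::finite \<Rightarrow> nat) \<Rightarrow> nat \<Rightarrow> (('n \<Rightarrow> nat) \<Rightarrow> 'k::field) set" where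
  "box_part \<tau> i = {c. \<forall>\<eta>. c \<eta> \<noteq> 0 \<longrightarrow> \<eta> \<le> \<tau> \<and> tdeg \<eta> = i}"

lemma raise_lower_at_commute:
  "l \<noteq> m \<Longrightarrow> raise_at \<tau> l (lower_at \<tau> m c) \<eta> = lower_at \<tau> m (raise_at \<tau> l c) \<eta>"
  by (simp add: raise_at_def lower_at_def fun_upd_twist)

lemma raise_lower_at_commutator:
  assumes "\<eta> l \<le> \<tau> l"
  shows "raise_at \<tau> l (lower_at \<tau> l c) \<eta> - lower_at \<tau> l (raise_at \<tau> l c) \<eta> =
    (2 * of_nat (\<eta> l) - of_nat (\<tau> l)) * (c \<eta> :: 'k::field)"
proof -
  have "raise_at \<tau> l (lower_at \<tau> l c) \<eta> = of_nat (\<eta> l * (\<tau> l + 1 - \<eta> l)) * c \<eta>"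
    using assms by (cases "\<eta> l") (simp_all add: raise_at_def lower_at_def fun_upd_idem)
  moreover have "lower_at \<tau> l (raise_at \<tau> l c) \<eta> = of_nat ((\<eta> l + 1) * (\<tau> l - \<eta> l)) * c \<eta>"
    using assms by (cases "\<eta> l = \<tau> l") (auto simp: raise_at_def lower_at_def)
  moreover obtain k where "\<tau> l = \<eta> l + k" using assms le_Suc_ex by blast
  ultimately show ?thesis by (simp add: algebra_simps)
qed

lemma raise_lower_commutator:
  assumes "c \<in> box_part \<tau> i"
  shows "raise \<tau> (lower \<tau> c) \<eta> - lower \<tau> (raise \<tau> c) \<eta> = (2 * of_nat i - of_nat (tdeg \<tau>)) * (c \<eta> :: 'k::field)"
proof -
  have 1: "raise \<tau> (lower \<tau> c) \<eta> = (\<Sum>l\<in>UNIV. \<Sum>m\<in>UNIV. raise_at \<tau> l (lower_at \<tau> m c) \<eta>)"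
    unfolding raise_def by (rule sum.cong) (auto simp: raise_at_def lower_def)
  have 2: "lower \<tau> (raise \<tau> c) \<eta> = (\<Sum>l\<in>UNIV. \<Sum>m\<in>UNIV. lower_at \<tau> m (raise_at \<tau> l c) \<eta>)"
    unfolding lower_def by (subst sum.swap) (rule sum.cong, auto simp: lower_at_def raise_def sum_distrib_left)
  have "raise \<tau> (lower \<tau> c) \<eta> - lower \<tau> (raise \<tau> c) \<eta> =
    (\<Sum>l\<in>UNIV. \<Sum>m\<in>UNIV. if m = l then raise_at \<tau> l (lower_at \<tau> l c) \<eta> - lower_at \<tau> l (raise_at \<tau> l c) \<eta> else 0)"
    unfolding 1 2 sum_subtractf[symmetric]
    by (intro sum.cong refl) (auto simp: raise_lower_at_commute)
  also have "\<dots> = (\<Sum>l\<in>UNIV. raise_at \<tau> l (lower_at \<tau> l c) \<eta> - lower_at \<tau> l (raise_at \<tau> l c) \<eta>)"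
    by simp
  also have "\<dots> = (2 * of_nat i - of_nat (tdeg \<tau>)) * c \<eta>"
  proof (cases "\<eta> \<le> \<tau>")
    case True
    have "(\<Sum>l\<in>UNIV. raise_at \<tau> l (lower_at \<tau> l c) \<eta> - lower_at \<tau> l (raise_at \<tau> l c) \<eta>) =
      (\<Sum>l\<in>UNIV. (2 * of_nat (\<eta> l) - of_nat (\<tau> l)) * c \<eta>)"
      using True by (intro sum.cong refl raise_lower_at_commutator) (auto simp: le_fun_def)
    also have "\<dots> = (2 * of_nat (tdeg \<eta>) - of_nat (tdeg \<tau>)) * c \<eta>"
      by (simp add: tdeg_def sum_distrib_right[symmetric] sum_subtractf sum_distrib_left)
    finally show ?thesis using assms by (cases "c \<eta> = 0") (auto simp: box_part_def)
  next
    case False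
    have out: "c \<eta>' = 0" if "\<not> \<eta>' \<le> \<tau>" for \<eta>' using assms that by (auto simp: box_part_def)
    obtain m where m: "\<tau> m < \<eta> m" using False by (auto simp: le_fun_def not_le)
    have "raise_at \<tau> l (lower_at \<tau> l c) \<eta> - lower_at \<tau> l (raise_at \<tau> l c) \<eta> = 0" for l
    proof (cases "l = m")
      case True
      then show ?thesis using m by (simp add: raise_at_def lower_at_def)
    next
      case False
      then have "\<not> \<eta>(l := k) \<le> \<tau>" for k using m by (auto simp: le_fun_def not_le intro!: exI[of _ m])
      from out[OF this] have "c (\<eta>(l := k)) = 0" for k .
      from this this[of "\<eta> l"] show ?thesis by (simp add: raise_at_def lower_at_def)
    qed
    then show ?thesis using out[OF False] by simp
  qed
  finally show ?thesis .
qed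

lemma raise_box_part:
  assumes that: "c \<in> box_part \<tau> i"
  shows "raise \<tau> c \<in> box_part \<tau> (Suc i)"
  unfolding box_part_def
  proof (intro CollectI allI impI)
  fix \<eta> assume "raise \<tau> c \<eta> \<noteq> 0"
  then obtain l where "raise_at \<tau> l c \<eta> \<noteq> 0"
    unfolding raise_def by (meson sum.not_neutral_contains_not_neutral)
  then have l: "0 < \<eta> l" "\<eta> l \<le> \<tau> l" "c (\<eta>(l := \<eta> l - 1)) \<noteq> 0"
    by (auto simp: raise_at_def split: if_splits)
  with that have *: "\<eta>(l := \<eta> l - 1) \<le> \<tau>" "tdeg (\<eta>(l := \<eta> l - 1)) = i"
    by (auto simp: box_part_def)
  have "\<eta> k \<le> \<tau> k" for k using * l by (cases "k = l") (auto simp: le_fun_def dest: spec[of _ k])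
  then show "\<eta> \<le> \<tau> \<and> tdeg \<eta> = Suc i"
    using l * tdeg_upd[of \<eta> l "\<eta> l - 1"] by (simp add: le_fun_def)
  qed

text \<open>
  Stanley's theorem that the sum of the variables is a strong Lefschetz element of a monomial
  complete intersection: the quotient is a tensor product of irreducible \<open>sl_2\<close> representations.
\<close>

lemma monomial_complete_intersection_Lefschetz:
  fixes c :: "('n::finite \<Rightarrow> nat) \<Rightarrow> 'k::field_char_0"
  assumes "c \<in> box_part \<tau> i" "2 * i \<le> tdeg \<tau>" "(raise \<tau> ^^ (tdeg \<tau> - 2 * i)) c = (\<lambda>_. 0)"
  shows "c = (\<lambda>_. 0)"
proof (rule sl2_injective[where V = "box_part \<tau>" and E = "raise \<tau>" and F = "lower \<tau>"])
  fix i and c :: "('n \<Rightarrow> nat) \<Rightarrow> 'k"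
  show "raise \<tau> c \<in> box_part \<tau> (Suc i)" if "c \<in> box_part \<tau> i"
    using that by (rule raise_box_part)
  have lower_at_nz: "\<eta> \<le> \<tau> \<and> Suc (tdeg \<eta>) = i" if "c \<in> box_part \<tau> i" "lower_at \<tau> l c \<eta> \<noteq> 0" for l \<eta> i c
  proof -
    have "\<tau> l - \<eta> l \<noteq> 0" using that(2) by (intro notI) (simp add: lower_at_def)
    then have l: "\<eta> l < \<tau> l" "c (\<eta>(l := \<eta> l + 1)) \<noteq> 0"
      using that by (auto simp: lower_at_def)
    with that have *: "\<eta>(l := \<eta> l + 1) \<le> \<tau>" "tdeg (\<eta>(l := \<eta> l + 1)) = i"
      by (auto simp: box_part_def)
    have "\<eta> k \<le> \<tau> k" for k using * l by (cases "k = l") (auto simp: le_fun_def dest: spec[of _ k])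
    then show "\<eta> \<le> \<tau> \<and> Suc (tdeg \<eta>) = i"
      using l * tdeg_upd[of \<eta> l "\<eta> l + 1"] by (simp add: le_fun_def)
  qed
  show "lower \<tau> c \<in> box_part \<tau> i" if c: "c \<in> box_part \<tau> (Suc i)"
    unfolding box_part_def
  proof (intro CollectI allI impI)
    fix \<eta> assume "lower \<tau> c \<eta> \<noteq> 0"
    then obtain l where "lower_at \<tau> l c \<eta> \<noteq> 0"
      unfolding lower_def by (meson sum.not_neutral_contains_not_neutral)
    then show "\<eta> \<le> \<tau> \<and> tdeg \<eta> = i" using lower_at_nz[OF c] by auto
  qed
  show "lower \<tau> c = (\<lambda>_. 0)" if c: "c \<in> box_part \<tau> 0"
  proof
    fix \<eta>
    have "lower_at \<tau> l c \<eta> = 0" for l using lower_at_nz[OF c, of l \<eta>] by auto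
    then show "lower \<tau> c \<eta> = 0" by (simp add: lower_def)
  qed
next
  show "raise \<tau> (\<lambda>_. 0) = (\<lambda>_. 0)" "lower \<tau> (\<lambda>_. 0) = (\<lambda>_. 0)"
    by (auto simp: fun_eq_iff raise_def raise_at_def lower_def lower_at_def)
  show "raise \<tau> (\<lambda>x. c x + r * c' x) = (\<lambda>x. raise \<tau> c x + r * raise \<tau> c' x)" for r :: 'k and c c'
  proof
    fix \<eta>
    have "raise_at \<tau> l (\<lambda>x. c x + r * c' x) \<eta> = raise_at \<tau> l c \<eta> + r * raise_at \<tau> l c' \<eta>" for l
      by (simp add: raise_at_def)
    then show "raise \<tau> (\<lambda>x. c x + r * c' x) \<eta> = raise \<tau> c \<eta> + r * raise \<tau> c' \<eta>"
      by (simp add: raise_def sum.distrib sum_distrib_left)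
  qed
qed (use assms raise_lower_commutator in auto)

section \<open>Degeneration of a binomial to one of its monomials\<close>

text \<open>
  Semicontinuity: the determinant of the pencil is a polynomial in \<open>s\<close> that does not vanish at 0.
\<close>

lemma finite_degenerate_parameters:
  fixes M0 M1 :: "'i \<Rightarrow> 'i \<Rightarrow> 'k::field"
  assumes fin: "finite B" and "0 < m"
    and nondeg: "\<And>u. (\<forall>j\<in>B. (\<Sum>i\<in>B. u i * M0 i j) = 0) \<Longrightarrow> \<forall>i\<in>B. u i = 0"
  shows "finite {s. \<exists>u. (\<exists>i\<in>B. u i \<noteq> 0) \<and> (\<forall>j\<in>B. (\<Sum>i\<in>B. u i * (M0 i j + s ^ m * M1 i j)) = 0)}"
proof -
  obtain h where h: "bij_betw h {0..<card B} B" using ex_bij_betw_nat_finite[OF fin] by blast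
  define n where "n = card B"
  note h = h[folded n_def]
  have hB: "h i \<in> B" if "i < n" for i using h that by (auto simp: bij_betw_def)
  have reindex: "(\<Sum>i\<in>B. g i) = (\<Sum>i = 0..<n. g (h i))" for g :: "_ \<Rightarrow> 'k"
    using sum.reindex_bij_betw[OF h, of g] by simp
  define N where "N = (\<lambda>s. mat n n (\<lambda>(j, i). M0 (h i) (h j) + s ^ m * M1 (h i) (h j)))"
  define P where "P = mat n n (\<lambda>(j, i). [: M0 (h i) (h j) :] + Polynomial.monom (M1 (h i) (h j)) m)"
  have N: "N s \<in> carrier_mat n n" for s by (simp add: N_def)
  have det_N: "det (N s) = poly (det P) s" for s
  proof -
    interpret ev: comm_ring_hom "\<lambda>p. poly p s" by unfold_locales auto
    have "N s = map_mat (\<lambda>p. poly p s) P"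
      by (rule eq_matI) (auto simp: N_def P_def poly_monom mult.commute)
    then show ?thesis by simp
  qed
  have N_mult: "(N s *\<^sub>v v) $ j = (\<Sum>i = 0..<n. v $ i * (M0 (h i) (h j) + s ^ m * M1 (h i) (h j)))"
    if "v \<in> carrier_vec n" "j < n" for v j s
    using that by (simp add: N_def scalar_prod_def mult.commute)
  have "det (N 0) \<noteq> 0"
  proof
    assume "det (N 0) = 0"
    then obtain v where v: "v \<in> carrier_vec n" "v \<noteq> 0\<^sub>v n" "N 0 *\<^sub>v v = 0\<^sub>v n"
      using det_0_iff_vec_prod_zero[OF N] by blast
    define u where "u = (\<lambda>x. v $ the_inv_into {0..<n} h x)"
    have u: "u (h i) = v $ i" if "i < n" for i
      using that h by (simp add: u_def the_inv_into_f_f bij_betw_def)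
    have "\<forall>i\<in>B. u i = 0"
    proof (rule nondeg, rule ballI)
      fix x assume "x \<in> B"
      then obtain j where j: "j < n" "x = h j" using h by (auto simp: bij_betw_def)
      have "(\<Sum>i\<in>B. u i * M0 i x) = (\<Sum>i = 0..<n. v $ i * (M0 (h i) (h j) + 0 ^ m * M1 (h i) (h j)))"
        unfolding reindex using assms(2) by (intro sum.cong) (simp_all add: u j)
      also have "\<dots> = 0" using N_mult[OF v(1) j(1), of 0] v(3) j(1) by simp
      finally show "(\<Sum>i\<in>B. u i * M0 i x) = 0" .
    qed
    then have "v $ i = 0" if "i < n" for i using u[OF that] hB[OF that] by simp
    then have "v = 0\<^sub>v n" using v(1) by (intro eq_vecI) auto
    with v(2) show False by blast
  qed
  then have "det P \<noteq> 0" by (auto simp: det_N)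
  then have fin_roots: "finite {s. poly (det P) s = 0}" by (rule poly_roots_finite)
  have root: "poly (det P) s = 0"
    if u: "\<exists>i\<in>B. u i \<noteq> 0" "\<forall>j\<in>B. (\<Sum>i\<in>B. u i * (M0 i j + s ^ m * M1 i j)) = 0" for s u
  proof -
    define v where "v = vec n (\<lambda>i. u (h i))"
    have v: "v \<in> carrier_vec n" by (simp add: v_def)
    obtain i where "i < n" "u (h i) \<noteq> 0" using u(1) h by (auto simp: bij_betw_def)
    then have "v \<noteq> 0\<^sub>v n" by (auto simp: v_def vec_eq_iff)
    moreover have "N s *\<^sub>v v = 0\<^sub>v n"
    proof (rule eq_vecI)
      fix j assume "j < dim_vec (0\<^sub>v n)"
      then have j: "j < n" by simp
      have "(N s *\<^sub>v v) $ j = (\<Sum>i\<in>B. u i * (M0 i (h j) + s ^ m * M1 i (h j)))"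
        unfolding N_mult[OF v j] reindex by (intro sum.cong) (simp_all add: v_def)
      then show "(N s *\<^sub>v v) $ j = 0\<^sub>v n $ j" using u(2) hB[OF j] j by simp
    qed (simp add: N_def)
    ultimately have "det (N s) = 0" using det_0_iff_vec_prod_zero[OF N] v by blast
    then show ?thesis by (simp add: det_N)
  qed
  show ?thesis by (rule finite_subset[OF _ fin_roots]) (use root in blast)
qed

definition truncate :: "('n::finite \<Rightarrow> nat) \<Rightarrow> ('n, 'k::field) mpoly \<Rightarrow> ('n \<Rightarrow> nat) \<Rightarrow> 'k" where
  "truncate \<tau> f \<eta> = (if \<eta> \<le> \<tau> then coef f \<eta> else 0)"

lemma raise_truncate: "raise \<tau> (truncate \<tau> f) = truncate \<tau> (linear_form (\<lambda>_. 1) * f)"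
proof
  fix \<eta>
  show "raise \<tau> (truncate \<tau> f) \<eta> = truncate \<tau> (linear_form (\<lambda>_. 1) * f) \<eta>"
  proof (cases "\<eta> \<le> \<tau>")
    case True
    have "\<eta>(l := \<eta> l - 1) \<le> \<tau>" for l
      by (rule order_trans[OF _ True]) (simp add: le_fun_def)
    then have "raise_at \<tau> l (truncate \<tau> f) \<eta> = (if 0 < \<eta> l then 1 * coef f (\<eta>(l := \<eta> l - 1)) else 0)" for l
      using le_funD[OF True, of l] by (simp add: raise_at_def truncate_def)
    then show ?thesis
      using True by (simp add: raise_def truncate_def coef_linear_form_mult)
  next
    case False
    have "raise_at \<tau> l (truncate \<tau> f) \<eta> = 0" for l
    proof (rule ccontr)
      assume "raise_at \<tau> l (truncate \<tau> f) \<eta> \<noteq> 0"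
      then have *: "\<eta> l \<le> \<tau> l" "\<eta>(l := \<eta> l - 1) \<le> \<tau>" by (auto simp: raise_at_def truncate_def split: if_splits)
      have "\<eta> k \<le> \<tau> k" for k
        using * by (cases "k = l") (auto simp: le_fun_def dest: spec[of _ k])
      with False show False by (simp add: le_fun_def)
    qed
    then show ?thesis using False by (simp add: raise_def truncate_def)
  qed
qed

text \<open>
  Hence the operator \<open>raise\<close> computes powers of the sum of the variables modulo the annihilator of a
  single monomial.
\<close>

lemma raise_power_truncate: "(raise \<tau> ^^ e) (truncate \<tau> f) = truncate \<tau> (linear_form (\<lambda>_. 1) ^ e * f)"
proof (induction e)
  case (Suc e)
  then show ?case by (simp add: raise_truncate mult.assoc)
qed simp

text \<open>
  Rescaling one variable of the linear form only rescales coefficients. This turns a change of the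
  linear form into a change of the ratio of the two coefficients of the binomial.
\<close>

lemma coef_scaled_linear_form_power:
  "coef (linear_form ((\<lambda>_. 1)(p := s)) ^ e) \<eta> = s ^ \<eta> p * coef (linear_form (\<lambda>_. 1) ^ e) \<eta>"
proof (induction e arbitrary: \<eta>)
  case 0
  show ?case by (auto simp: monomial_zero_one[symmetric] coef_monomial)
next
  case (Suc e)
  have "coef (linear_form ((\<lambda>_. 1)(p := s)) ^ Suc e) \<eta> =
    (\<Sum>l\<in>UNIV. if 0 < \<eta> l then ((\<lambda>_. 1)(p := s)) l * (s ^ (\<eta>(l := \<eta> l - 1)) p * coef (linear_form (\<lambda>_. 1) ^ e) (\<eta>(l := \<eta> l - 1))) else 0)"
    unfolding power_Suc coef_linear_form_mult Suc.IH ..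
  also have "\<dots> = (\<Sum>l\<in>UNIV. s ^ \<eta> p * (if 0 < \<eta> l then coef (linear_form (\<lambda>_. 1) ^ e) (\<eta>(l := \<eta> l - 1)) else 0))"
  proof (rule sum.cong[OF refl])
    fix l
    show "(if 0 < \<eta> l then ((\<lambda>_. 1)(p := s)) l * (s ^ (\<eta>(l := \<eta> l - 1)) p * coef (linear_form (\<lambda>_. 1) ^ e) (\<eta>(l := \<eta> l - 1))) else 0) =
      s ^ \<eta> p * (if 0 < \<eta> l then coef (linear_form (\<lambda>_. 1) ^ e) (\<eta>(l := \<eta> l - 1)) else 0)"
    proof (cases "l = p")
      case True
      then show ?thesis by (cases "\<eta> p") auto
    qed simp
  qed
  also have "\<dots> = s ^ \<eta> p * coef (linear_form (\<lambda>_. 1) ^ Suc e) \<eta>"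
    by (simp only: power_Suc coef_linear_form_mult sum_distrib_left mult_1_left)
  finally show ?case .
qed

text \<open>
  Suppose that the monomials dividing \<open>X^\<beta>\<close> span the quotient. Since \<open>\<alpha> p > \<beta> p\<close>, the linear form
  \<open>s * x_p\<close> plus the sum of the other variables sees, up to rescaling, the binomial
  \<open>s ^ m * a * X^\<alpha> + b * X^\<beta>\<close>. At \<open>s = 0\<close> the pairing is that of the monomial \<open>X^\<beta>\<close>, which is
  nondegenerate by Stanley's theorem, so it stays nondegenerate for all but finitely many \<open>s\<close>.
\<close>

lemma degenerate_to_monomial_Lefschetz:
  fixes \<alpha> \<beta> :: "'n::finite \<Rightarrow> nat" and a b :: "'k::field_char_0"
  defines "F \<equiv> monomial \<alpha> a + monomial \<beta> b"
  assumes b: "b \<noteq> 0" and deg: "tdeg \<alpha> = D" "tdeg \<beta> = D" and p: "\<alpha> p = \<beta> p + m" "0 < m"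
    and span: "\<And>i f. f \<in> homogeneous_part i \<Longrightarrow>
      \<exists>g\<in>homogeneous_part i. f - g \<in> Ann F \<and> (\<forall>\<eta>. coef g \<eta> \<noteq> 0 \<longrightarrow> \<eta> \<le> \<beta>)"
  shows "strong_Lefschetz (mpoly_ring Quot Ann F) (quotient_part (Ann F))"
proof -
  let ?L = "linear_form (\<lambda>_. 1 :: 'k)"
  define B where "B = (\<lambda>i. {\<eta>. \<eta> \<le> \<beta> \<and> tdeg \<eta> = i})"
  have fin: "finite (B i)" for i by (rule finite_subset[OF _ finite_box[of \<beta>]]) (auto simp: B_def)
  define C where "C = (\<lambda>e (\<gamma> :: 'n \<Rightarrow> nat) \<mu> \<mu>'. if \<mu>' \<le> \<gamma> \<and> \<mu> \<le> \<gamma> - \<mu>' then coef (?L ^ e) (\<gamma> - \<mu>' - \<mu>) else 0)"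
  define bad where "bad = (\<lambda>i. {s. \<exists>u. (\<exists>\<mu>\<in>B i. u \<mu> \<noteq> 0) \<and>
    (\<forall>\<mu>'\<in>B i. (\<Sum>\<mu>\<in>B i. u \<mu> * (b * C (D - 2 * i) \<beta> \<mu> \<mu>' + s ^ m * (a * C (D - 2 * i) \<alpha> \<mu> \<mu>'))) = 0)})"
  have "finite (bad i)" if i: "2 * i \<le> D" for i
    unfolding bad_def
  proof (rule finite_degenerate_parameters[OF fin p(2)])
    fix u assume u: "\<forall>\<mu>'\<in>B i. (\<Sum>\<mu>\<in>B i. u \<mu> * (b * C (D - 2 * i) \<beta> \<mu> \<mu>')) = 0"
    define f where "f = (\<Sum>\<mu>\<in>B i. monomial \<mu> (u \<mu>))"
    have coef_f: "coef f \<eta> = (if \<eta> \<in> B i then u \<eta> else 0)" for \<eta>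
      using fin by (simp add: f_def coef_sum_monomial)
    have f: "f \<in> homogeneous_part i" unfolding homogeneous_part_iff by (simp add: coef_f B_def)
    have "truncate \<beta> f = (\<lambda>_. 0)"
    proof (rule monomial_complete_intersection_Lefschetz)
      show "truncate \<beta> f \<in> box_part \<beta> i" by (auto simp: box_part_def truncate_def coef_f B_def split: if_splits)
      show "2 * i \<le> tdeg \<beta>" using i deg by simp
      have "coef (?L ^ (D - 2 * i) * f) \<xi> = 0" if \<xi>: "\<xi> \<le> \<beta>" for \<xi>
      proof (rule ccontr)
        assume nz: "coef (?L ^ (D - 2 * i) * f) \<xi> \<noteq> 0"
        have "?L ^ (D - 2 * i) * f \<in> homogeneous_part (D - i)"
          using homogeneous_part_mult[OF homogeneous_part_power[OF linear_form_homogeneous[of "\<lambda>_. 1"], of "D - 2 * i"] f] i by simp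
        with nz have "tdeg \<xi> = D - i" unfolding homogeneous_part_iff by blast
        then have "\<beta> - \<xi> \<in> B i" using \<xi> deg i tdeg_diff[OF \<xi>] by (simp add: B_def le_fun_def)
        moreover have refl_diff: "\<beta> - (\<beta> - \<xi>) = \<xi>" using \<xi> by (auto simp: le_fun_def fun_eq_iff)
        moreover have "\<beta> - \<xi> \<le> \<beta>" by (simp add: le_fun_def)
        ultimately have "0 = (\<Sum>\<mu>\<in>B i. u \<mu> * (b * (if \<mu> \<le> \<xi> then coef (?L ^ (D - 2 * i)) (\<xi> - \<mu>) else 0)))"
          using bspec[OF u \<open>\<beta> - \<xi> \<in> B i\<close>] unfolding C_def refl_diff by simp
        also have "\<dots> = (\<Sum>\<mu>\<in>B i. b * coef (monomial \<mu> (u \<mu>) * ?L ^ (D - 2 * i)) \<xi>)"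
          by (intro sum.cong refl) (simp add: coef_monomial_mult)
        also have "\<dots> = b * coef (?L ^ (D - 2 * i) * f) \<xi>"
          by (simp add: f_def mult.commute[of "?L ^ _"] sum_distrib_right coef_sum sum_distrib_left)
        finally show False using b nz by simp
      qed
      then show "(raise \<beta> ^^ (tdeg \<beta> - 2 * i)) (truncate \<beta> f) = (\<lambda>_. 0)"
        unfolding raise_power_truncate deg(2) by (auto simp: truncate_def)
    qed
    then show "\<forall>\<mu>\<in>B i. u \<mu> = 0"
      by (auto simp: fun_eq_iff truncate_def coef_f B_def split: if_splits)
  qed
  then have "finite (insert 0 (\<Union>i\<in>{i. 2 * i \<le> D}. bad i))"
    by (auto intro!: finite_subset[of "{i. 2 * i \<le> D}" "{..D}"])
  then obtain s where s: "s \<noteq> 0" "\<And>i. 2 * i \<le> D \<Longrightarrow> s \<notin> bad i"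
    using ex_new_if_finite[OF infinite_UNIV_char_0[where 'a = 'k]] by blast
  let ?Ls = "linear_form ((\<lambda>_. 1)(p := s))"
  show ?thesis unfolding F_def
  proof (rule strong_Lefschetz_of_injective[OF deg linear_form_homogeneous[of "(\<lambda>_. 1)(p := s)"]], fold F_def)
    fix i f assume i: "2 * i \<le> D" and f: "f \<in> homogeneous_part i" "?Ls ^ (D - 2 * i) * f \<in> Ann F"
    let ?e = "D - 2 * i"
    obtain g where g: "g \<in> homogeneous_part i" "f - g \<in> Ann F" "\<And>\<eta>. coef g \<eta> \<noteq> 0 \<Longrightarrow> \<eta> \<le> \<beta>"
      using span[OF f(1)] by blast
    have "?Ls ^ ?e * g = ?Ls ^ ?e * f - ?Ls ^ ?e * (f - g)" by (simp add: algebra_simps)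
    then have Lg: "?Ls ^ ?e * g \<in> Ann F" using Ann_diff[OF f(2) Ann_mult[OF g(2)]] by simp
    have g_exp: "g = (\<Sum>\<mu>\<in>B i. monomial \<mu> (coef g \<mu>))"
      by (rule mpoly_expand[OF fin]) (use g in \<open>auto simp: B_def homogeneous_part_iff\<close>)
    define u where "u = (\<lambda>\<mu>. coef g \<mu> / s ^ \<mu> p)"
    have scaled: "s ^ \<mu>' p * (if \<mu>' \<le> \<gamma> then coef (?Ls ^ ?e * g) (\<gamma> - \<mu>') else 0) = s ^ \<gamma> p * (\<Sum>\<mu>\<in>B i. u \<mu> * C ?e \<gamma> \<mu> \<mu>')"
      for \<gamma> \<mu>'
    proof (cases "\<mu>' \<le> \<gamma>")
      case le: True
      have "s ^ \<mu>' p * coef (?Ls ^ ?e * g) (\<gamma> - \<mu>') = (\<Sum>\<mu>\<in>B i. s ^ \<mu>' p * coef (monomial \<mu> (coef g \<mu>) * ?Ls ^ ?e) (\<gamma> - \<mu>'))"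
      proof -
        have "?Ls ^ ?e * g = (\<Sum>\<mu>\<in>B i. monomial \<mu> (coef g \<mu>)) * ?Ls ^ ?e"
          unfolding g_exp[symmetric] by (rule mult.commute)
        then show ?thesis by (simp only: sum_distrib_right coef_sum sum_distrib_left)
      qed
      also have "\<dots> = (\<Sum>\<mu>\<in>B i. s ^ \<gamma> p * (u \<mu> * C ?e \<gamma> \<mu> \<mu>'))"
      proof (intro sum.cong refl)
        fix \<mu>
        show "s ^ \<mu>' p * coef (monomial \<mu> (coef g \<mu>) * ?Ls ^ ?e) (\<gamma> - \<mu>') = s ^ \<gamma> p * (u \<mu> * C ?e \<gamma> \<mu> \<mu>')"
        proof (cases "\<mu> \<le> \<gamma> - \<mu>'")
          case True
          have "\<mu> p + (\<mu>' p + (\<gamma> - \<mu>' - \<mu>) p) = \<gamma> p"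
            using le_funD[OF True, of p] le_funD[OF le, of p] by simp
          then have "s ^ \<gamma> p = s ^ \<mu> p * (s ^ \<mu>' p * s ^ (\<gamma> - \<mu>' - \<mu>) p)"
            by (simp only: power_add[symmetric])
          then show ?thesis
            using True le s(1) by (simp add: coef_monomial_mult C_def u_def coef_scaled_linear_form_power)
        qed (simp add: coef_monomial_mult C_def)
      qed
      finally show ?thesis using le by (simp add: sum_distrib_left)
    qed (simp add: C_def)
    have "(\<Sum>\<mu>\<in>B i. u \<mu> * (b * C ?e \<beta> \<mu> \<mu>' + s ^ m * (a * C ?e \<alpha> \<mu> \<mu>'))) = 0" for \<mu>'
    proof -
      let ?S = "\<lambda>\<gamma>. \<Sum>\<mu>\<in>B i. u \<mu> * C ?e \<gamma> \<mu> \<mu>'"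
      let ?c = "\<lambda>\<gamma>. if \<mu>' \<le> \<gamma> then coef (?Ls ^ ?e * g) (\<gamma> - \<mu>') else 0"
      have pull: "a * (t * x) + b * (t * y) = t * (a * x + b * y)" for t x y :: 'k
        by (simp add: algebra_simps)
      have "a * ?c \<alpha> + b * ?c \<beta> = 0"
        using spec[OF Lg[unfolded F_def Ann_binomial_iff], of \<mu>'] by (auto split: if_splits)
      then have "0 = a * (s ^ \<mu>' p * ?c \<alpha>) + b * (s ^ \<mu>' p * ?c \<beta>)"
        using pull[of "s ^ \<mu>' p" "?c \<alpha>" "?c \<beta>"] by simp
      also have "\<dots> = s ^ \<beta> p * (b * ?S \<beta> + s ^ m * (a * ?S \<alpha>))"
        unfolding scaled p(1) power_add by (simp add: algebra_simps)
      finally have "b * ?S \<beta> + s ^ m * (a * ?S \<alpha>) = 0" using s(1) by simp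
      then show ?thesis by (simp add: distrib_left sum.distrib sum_distrib_left mult.left_commute)
    qed
    then have "\<forall>\<mu>\<in>B i. u \<mu> = 0" using s(2)[OF i] unfolding bad_def by blast
    then have "\<forall>\<mu>\<in>B i. coef g \<mu> = 0" using s(1) by (simp add: u_def)
    then have "g = 0" by (subst g_exp) (simp add: monomial_def)
    then show "f \<in> Ann F" using g(2) by simp
  qed
qed

lemma contract_sum: "contract (sum f A) F = (\<Sum>x\<in>A. contract (f x) F)"
  by (induction A rule: infinite_finite_induct) (auto simp: contract_add_left)

text \<open>
  Contracting the summands produces two families of monomials, and the coefficients are chosen so
  that the \<open>\<beta>\<close> term of each summand cancels the \<open>\<alpha>\<close> term of its predecessor. The two terms at the ends vanish by
  hypothesis.
\<close>

lemma telescoping_sum_Ann: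
  fixes \<alpha> \<beta> :: "'n::finite \<Rightarrow> nat" and a b :: "'k::field"
  assumes b: "b \<noteq> 0" and \<eta>0: "\<not> \<eta> 0 \<le> \<beta>" and \<eta>T: "\<not> \<eta> T \<le> \<alpha>"
    and step: "\<And>t. t < T \<Longrightarrow> \<eta> (Suc t) \<le> \<beta> \<longleftrightarrow> \<eta> t \<le> \<alpha>"
      "\<And>t. t < T \<Longrightarrow> \<eta> t \<le> \<alpha> \<Longrightarrow> \<beta> - \<eta> (Suc t) = \<alpha> - \<eta> t"
  shows "(\<Sum>t\<le>T. monomial (\<eta> t) ((- a / b) ^ t)) \<in> Ann (monomial \<alpha> a + monomial \<beta> b)"
proof -
  let ?c = "\<lambda>t. (- a / b) ^ t"
  let ?Y = "\<lambda>t. if \<eta> t \<le> \<alpha> then monomial (\<alpha> - \<eta> t) (?c t * a) else 0"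
  let ?Z = "\<lambda>t. if \<eta> t \<le> \<beta> then monomial (\<beta> - \<eta> t) (?c t * b) else 0"
  have neg: "?Z (Suc t) = - ?Y t" if "t < T" for t
  proof -
    have "?c (Suc t) * b = - (?c t * a)" using b by simp
    moreover have "monomial \<gamma> (- c) = - monomial \<gamma> c" for \<gamma> :: "'n \<Rightarrow> nat" and c :: 'k
      by (rule mpoly_eqI) (simp add: coef_monomial)
    ultimately show ?thesis using step[OF that] by (simp del: power_Suc)
  qed
  have "contract (\<Sum>t\<le>T. monomial (\<eta> t) (?c t)) (monomial \<alpha> a + monomial \<beta> b) = (\<Sum>t\<le>T. ?Y t) + (\<Sum>t\<le>T. ?Z t)"
    by (simp only: contract_sum contract_add_right contract_monomial_monomial sum.distrib)
  also have "(\<Sum>t\<le>T. ?Y t) = (\<Sum>t<T. ?Y t)"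
    using \<eta>T by (simp add: lessThan_Suc_atMost[symmetric] del: lessThan_Suc_atMost)
  also have "(\<Sum>t\<le>T. ?Z t) = (\<Sum>t<T. ?Z (Suc t))"
    using \<eta>0 by (simp add: sum.atMost_shift)
  also have "\<dots> = (\<Sum>t<T. - ?Y t)" by (intro sum.cong refl neg) simp
  also have "(\<Sum>t<T. ?Y t) + (\<Sum>t<T. - ?Y t) = 0" by (simp add: sum_negf)
  finally show ?thesis by (simp add: Ann_def)
qed

text \<open>
  Exponents of a chain of monomials: each step trades a factor \<open>x_p ^ m\<close> for the product of the powers
  \<open>x_l ^ (\<beta> l - \<alpha> l)\<close>, that is, it divides by \<open>x ^ \<alpha>\<close> and multiplies by \<open>x ^ \<beta>\<close>.
\<close>

definition exchange :: "('n \<Rightarrow> nat) \<Rightarrow> ('n \<Rightarrow> nat) \<Rightarrow> 'n \<Rightarrow> nat \<Rightarrow> ('n \<Rightarrow> nat) \<Rightarrow> nat \<Rightarrow> 'n \<Rightarrow> nat" where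
  "exchange \<alpha> \<beta> p m \<kappa> t l = (if l = p then \<beta> p + 1 - t * m else \<kappa> l + t * (\<beta> l - \<alpha> l))"

lemma exchange_sum_Ann:
  fixes \<alpha> \<beta> :: "'n::finite \<Rightarrow> nat" and a b :: "'k::field"
  assumes b: "b \<noteq> 0" and p: "\<alpha> p = \<beta> p + m" "0 < m" and le: "\<And>l. l \<noteq> p \<Longrightarrow> \<alpha> l \<le> \<beta> l"
    and T: "T * m \<le> \<beta> p + 1" and q: "q \<noteq> p" "\<alpha> q < \<kappa> q + T * (\<beta> q - \<alpha> q)"
  shows "(\<Sum>t\<le>T. monomial (exchange \<alpha> \<beta> p m \<kappa> t) ((- a / b) ^ t)) \<in> Ann (monomial \<alpha> a + monomial \<beta> b)"
proof (rule telescoping_sum_Ann[OF b])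
  let ?\<nu> = "exchange \<alpha> \<beta> p m \<kappa>"
  show "\<not> ?\<nu> 0 \<le> \<beta>" by (auto simp: le_fun_def exchange_def intro!: exI[of _ p])
  show "\<not> ?\<nu> T \<le> \<alpha>" using q by (auto simp: le_fun_def exchange_def not_le intro!: exI[of _ q])
  fix t assume "t < T"
  then have tm: "t * m + m \<le> \<beta> p + 1" using T mult_le_mono1[of "Suc t" T m] by simp
  have "?\<nu> (Suc t) l \<le> \<beta> l \<longleftrightarrow> ?\<nu> t l \<le> \<alpha> l" for l
    using le[of l] p tm by (cases "l = p") (auto simp: exchange_def)
  then show "?\<nu> (Suc t) \<le> \<beta> \<longleftrightarrow> ?\<nu> t \<le> \<alpha>" by (simp add: le_fun_def)
  assume "?\<nu> t \<le> \<alpha>"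
  then have "?\<nu> t l \<le> \<alpha> l" for l by (simp add: le_fun_def)
  then have "\<beta> l - ?\<nu> (Suc t) l = \<alpha> l - ?\<nu> t l" for l
    using le[of l] p tm by (cases "l = p") (auto simp: exchange_def)
  then show "\<beta> - ?\<nu> (Suc t) = \<alpha> - ?\<nu> t" by (simp add: fun_eq_iff)
qed

lemma monomial_mem_Ann:
  "\<not> \<mu> \<le> \<alpha> \<Longrightarrow> \<not> \<mu> \<le> \<beta> \<Longrightarrow> monomial \<mu> c \<in> Ann (monomial \<alpha> a + monomial \<beta> b)"
  by (simp add: Ann_def contract_add_right contract_monomial_monomial)

lemma tdeg_add_mult: "tdeg (\<lambda>l. x l + t * y l) = tdeg x + t * tdeg y"
  by (simp add: tdeg_def sum.distrib sum_distrib_left)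

text \<open>
  For this range of exponents the annihilator contains an element \<open>h\<close> with leading term
  \<open>x_p ^ (\<beta> p + 1)\<close> whose other terms have smaller exponent of \<open>x_p\<close>. Together with the powers of
  the other variables it rewrites every monomial into monomials dividing \<open>X^\<beta>\<close>.
\<close>

lemma box_spans_quotient:
  fixes \<alpha> \<beta> :: "'n::finite \<Rightarrow> nat" and a b :: "'k::field"
  defines "F \<equiv> monomial \<alpha> a + monomial \<beta> b"
  assumes b: "b \<noteq> 0" and deg: "tdeg \<alpha> = tdeg \<beta>"
    and p: "\<alpha> p = \<beta> p + m" "0 < m" and le: "\<And>l. l \<noteq> p \<Longrightarrow> \<alpha> l \<le> \<beta> l"
    and T: "T * m \<le> \<beta> p + 1" and q: "q \<noteq> p" "\<alpha> q < T * (\<beta> q - \<alpha> q)"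
    and f: "f \<in> homogeneous_part i"
  shows "\<exists>g\<in>homogeneous_part i. f - g \<in> Ann F \<and> (\<forall>\<eta>. coef g \<eta> \<noteq> 0 \<longrightarrow> \<eta> \<le> \<beta>)"
proof -
  define red where "red = (\<lambda>f. \<exists>g\<in>homogeneous_part i. f - g \<in> Ann F \<and> (\<forall>\<eta>. coef g \<eta> \<noteq> 0 \<longrightarrow> \<eta> \<le> \<beta>))"
  have red_Ann: "red f" if "f \<in> Ann F" for f
    unfolding red_def by (intro bexI[of _ 0]) (use that in \<open>auto simp: homogeneous_part_iff\<close>)
  have red_diff: "red (f - g)" if f: "red f" and g: "red g" for f g
  proof -
    obtain f' where f': "f' \<in> homogeneous_part i" "f - f' \<in> Ann F" "\<And>\<eta>. coef f' \<eta> \<noteq> 0 \<Longrightarrow> \<eta> \<le> \<beta>"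
      using f unfolding red_def by blast
    obtain g' where g': "g' \<in> homogeneous_part i" "g - g' \<in> Ann F" "\<And>\<eta>. coef g' \<eta> \<noteq> 0 \<Longrightarrow> \<eta> \<le> \<beta>"
      using g unfolding red_def by blast
    have "f - g - (f' - g') \<in> Ann F" using Ann_diff[OF f'(2) g'(2)] by (simp add: algebra_simps)
    moreover have "\<eta> \<le> \<beta>" if "coef (f' - g') \<eta> \<noteq> 0" for \<eta>
      using that f'(3)[of \<eta>] g'(3)[of \<eta>] by (cases "coef f' \<eta> = 0") auto
    ultimately show ?thesis
      unfolding red_def using homogeneous_part_diff[OF f'(1) g'(1)] by blast
  qed
  have red_add: "red (f + g)" if "red f" "red g" for f g
    using red_diff[OF that(1) red_diff[OF red_Ann[OF Ann_zero] that(2)]] by simp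
  have red_sum: "red (sum f A)" if "\<And>x. x \<in> A \<Longrightarrow> red (f x)" for f :: "'x \<Rightarrow> _" and A
    using that by (induction A rule: infinite_finite_induct) (auto simp: red_add red_Ann Ann_zero)
  let ?\<nu> = "exchange \<alpha> \<beta> p m (\<lambda>_. 0)"
  define h where "h = (\<Sum>t\<le>T. monomial (?\<nu> t) ((- a / b) ^ t))"
  have tm: "t * m \<le> \<beta> p + 1" if "t \<le> T" for t
    using T mult_le_mono1[OF that, of m] by linarith
  have h: "h \<in> Ann F"
    unfolding h_def F_def by (rule exchange_sum_Ann[where q = q]) (use b p le T q in auto)
  have red_monomial: "red (monomial \<mu> c)" if "tdeg \<mu> = i" for \<mu> c
    using that
  proof (induction "\<mu> p" arbitrary: \<mu> c rule: less_induct)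
    case less
    consider "\<mu> \<le> \<beta>" | l where "l \<noteq> p" "\<beta> l < \<mu> l" | "\<beta> p < \<mu> p"
      unfolding le_fun_def by (metis not_le)
    then show ?case
    proof cases
      case 1
      then show ?thesis unfolding red_def using less.prems
        by (intro bexI[of _ "monomial \<mu> c"]) (auto simp: Ann_zero coef_monomial homogeneous_part_iff split: if_splits)
    next
      case 2
      then have "\<not> \<mu> l \<le> \<alpha> l" "\<not> \<mu> l \<le> \<beta> l" using le[of l] by auto
      then have "\<not> \<mu> \<le> \<alpha>" "\<not> \<mu> \<le> \<beta>" by (auto simp: le_fun_def)
      then show ?thesis unfolding F_def by (intro red_Ann[unfolded F_def] monomial_mem_Ann)
    next
      case 3
      define \<mu>' where "\<mu>' = \<mu>(p := \<mu> p - (\<beta> p + 1))"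
      define \<kappa> where "\<kappa> = (\<lambda>t l. \<mu>' l + ?\<nu> t l)"
      have prod: "monomial \<mu>' c * h = (\<Sum>t\<le>T. monomial (\<kappa> t) (c * (- a / b) ^ t))"
        by (simp add: h_def sum_distrib_left monomial_mult_monomial \<kappa>_def)
      have \<kappa>0: "\<kappa> 0 = \<mu>" using 3 by (auto simp: \<kappa>_def \<mu>'_def exchange_def fun_eq_iff)
      have "red (monomial (\<kappa> (Suc t)) (c * (- a / b) ^ Suc t))" if "t < T" for t
      proof (rule less.hyps)
        have tm': "Suc t * m \<le> \<beta> p + 1" using tm[of "Suc t"] that by simp
        then have "\<kappa> (Suc t) p + Suc t * m = \<mu> p" using 3 by (simp add: \<kappa>_def \<mu>'_def exchange_def)
        moreover have "0 < Suc t * m" using p(2) by simp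
        ultimately show "\<kappa> (Suc t) p < \<mu> p" by linarith
        have "\<kappa> (Suc t) l + Suc t * \<alpha> l = \<mu> l + Suc t * \<beta> l" for l
        proof (cases "l = p")
          case True
          then show ?thesis using \<open>\<kappa> (Suc t) p + Suc t * m = \<mu> p\<close> p(1) by (simp add: algebra_simps)
        next
          case False
          have "Suc t * (\<beta> l - \<alpha> l) + Suc t * \<alpha> l = Suc t * \<beta> l"
            unfolding add_mult_distrib2[symmetric] using le[OF False] by simp
          then show ?thesis using False by (simp add: \<kappa>_def \<mu>'_def exchange_def)
        qed
        then have "tdeg (\<kappa> (Suc t)) + Suc t * tdeg \<alpha> = tdeg \<mu> + Suc t * tdeg \<beta>"
          unfolding tdeg_add_mult[symmetric] by simp
        then show "tdeg (\<kappa> (Suc t)) = i" using deg less.prems by simp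
      qed
      then have "red (\<Sum>t<T. monomial (\<kappa> (Suc t)) (c * (- a / b) ^ Suc t))" by (intro red_sum) auto
      moreover have "monomial \<mu>' c * h = monomial \<mu> c + (\<Sum>t<T. monomial (\<kappa> (Suc t)) (c * (- a / b) ^ Suc t))"
        unfolding prod by (simp add: sum.atMost_shift \<kappa>0 del: power_Suc)
      moreover have "red (monomial \<mu>' c * h)" using h by (intro red_Ann Ann_mult)
      ultimately show ?thesis
        using red_diff[of "monomial \<mu>' c * h" "\<Sum>t<T. monomial (\<kappa> (Suc t)) (c * (- a / b) ^ Suc t)"] by simp
    qed
  qed
  have "f = (\<Sum>\<mu>\<in>{\<mu>. tdeg \<mu> = i}. monomial \<mu> (coef f \<mu>))"
    by (rule mpoly_expand[OF finite_tdeg]) (use f in \<open>auto simp: homogeneous_part_iff\<close>)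
  moreover have "red (\<Sum>\<mu>\<in>{\<mu>. tdeg \<mu> = i}. monomial \<mu> (coef f \<mu>))"
    by (intro red_sum red_monomial) auto
  ultimately show ?thesis unfolding red_def by simp
qed

section \<open>General linear forms in two variables\<close>

lemma pderiv_sum_poly: "pderiv (sum f A) = (\<Sum>x\<in>A. pderiv (f x))"
  by (induction A rule: infinite_finite_induct) (auto simp: pderiv_add)

text \<open>
  A Wronskian argument: a space of dimension at most \<open>w\<close> of univariate polynomials over a field of
  characteristic 0 contains a nonzero element vanishing to order \<open>w\<close> at only finitely many points. If
  \<open>g\<close> is a nonzero element of the space, the map \<open>f \<mapsto> f' g - f g'\<close> has kernel spanned by \<open>g\<close>, so it lowers the
  dimension; it lowers the order of vanishing by only one at points where \<open>g\<close> does not vanish.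
\<close>

lemma finite_high_order_zeros:
  fixes V :: "'k::field_char_0 poly set"
  assumes "\<And>f :: nat \<Rightarrow> 'k poly. \<forall>i\<le>w. f i \<in> V \<Longrightarrow>
    \<exists>y. (\<exists>i\<le>w. y i \<noteq> 0) \<and> (\<Sum>i\<le>w. smult (y i) (f i)) = 0"
  shows "finite {c. \<exists>f\<in>V. f \<noteq> 0 \<and> [:- c, 1:] ^ w dvd f}"
  using assms
proof (induction w arbitrary: V)
  case 0
  have "f = 0" if "f \<in> V" for f using 0[of "\<lambda>_. f"] that by auto
  then have "{c. \<exists>f\<in>V. f \<noteq> 0 \<and> [:- c, 1:] ^ 0 dvd f} = {}" by blast
  then show ?case by (simp only: finite.emptyI)
next
  case (Suc w)
  show ?case
  proof (cases "\<exists>g\<in>V. g \<noteq> 0")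
    case False
    then have "{c. \<exists>f\<in>V. f \<noteq> 0 \<and> [:- c, 1:] ^ Suc w dvd f} = {}" by blast
    then show ?thesis by (simp only: finite.emptyI)
  next
    case True
    then obtain g where g: "g \<in> V" "g \<noteq> 0" by blast
    \<comment> \<open>The Wronskian with \<open>g\<close>.\<close>
    define \<Delta> where "\<Delta> = (\<lambda>f. pderiv f * g - f * pderiv g)"
    have \<Delta>_sum: "\<Delta> (\<Sum>i\<le>w. smult (y i) (f i)) = (\<Sum>i\<le>w. smult (y i) (\<Delta> (f i)))" for y :: "nat \<Rightarrow> 'k" and f
      by (simp add: \<Delta>_def pderiv_sum_poly pderiv_smult sum_distrib_right sum_subtractf smult_diff_right)
    have "finite {c. \<exists>f\<in>\<Delta> ` V. f \<noteq> 0 \<and> [:- c, 1:] ^ w dvd f}"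
    proof (rule Suc.IH)
      fix f :: "nat \<Rightarrow> 'k poly" assume "\<forall>i\<le>w. f i \<in> \<Delta> ` V"
      then have "\<forall>i. \<exists>h. i \<le> w \<longrightarrow> h \<in> V \<and> f i = \<Delta> h" by blast
      then obtain h where h: "\<And>i. i \<le> w \<Longrightarrow> h i \<in> V \<and> f i = \<Delta> (h i)" by metis
      define h' where "h' = (\<lambda>i. if i \<le> w then h i else g)"
      have "\<forall>i\<le>Suc w. h' i \<in> V" using h g by (simp add: h'_def)
      then obtain y where y: "\<exists>i\<le>Suc w. y i \<noteq> 0" "(\<Sum>i\<le>Suc w. smult (y i) (h' i)) = 0"
        using Suc.prems by blast
      have sum0: "(\<Sum>i\<le>w. smult (y i) (h i)) + smult (y (Suc w)) g = 0"
        using y(2) by (simp add: h'_def)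
      have "\<exists>i\<le>w. y i \<noteq> 0"
      proof (rule ccontr)
        assume none: "\<not> ?thesis"
        then have "smult (y (Suc w)) g = 0" using sum0 by simp
        then have "y (Suc w) = 0" using g by simp
        with none y(1) show False by (auto simp: le_Suc_eq)
      qed
      moreover have "(\<Sum>i\<le>w. smult (y i) (h i)) = smult (- y (Suc w)) g"
        using sum0 by (simp add: eq_neg_iff_add_eq_0)
      then have "\<Delta> (\<Sum>i\<le>w. smult (y i) (h i)) = 0"
        by (simp add: \<Delta>_def pderiv_smult pderiv_minus mult.commute)
      then have "(\<Sum>i\<le>w. smult (y i) (f i)) = 0"
        unfolding \<Delta>_sum using h by simp
      ultimately show "\<exists>y. (\<exists>i\<le>w. y i \<noteq> 0) \<and> (\<Sum>i\<le>w. smult (y i) (f i)) = 0" by blast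
    qed
    moreover have "finite {c. poly g c = 0}" using g(2) by (rule poly_roots_finite)
    moreover have "c \<in> {c. \<exists>f\<in>\<Delta> ` V. f \<noteq> 0 \<and> [:- c, 1:] ^ w dvd f} \<union> {c. poly g c = 0}"
      if "f \<in> V" "f \<noteq> 0" "[:- c, 1:] ^ Suc w dvd f" for c f
    proof (cases "poly g c = 0")
      case False
      let ?x = "[:- c, 1:]"
      have ord: "Suc w \<le> order c f"
        using that(2,3) order_divides[of c "Suc w" f] by (simp del: power_Suc)
      have f': "pderiv f \<noteq> 0"
      proof
        assume "pderiv f = 0"
        then obtain e where "f = [:e:]" using pderiv_iszero by blast
        with that(2) have "poly f c \<noteq> 0" by simp
        then show False using order_0I[of f c] ord by simp
      qed
      have ord': "order c f = Suc (order c (pderiv f))"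
        using ord that(2) by (intro order_pderiv) (auto simp: order_root)
      have "?x ^ w dvd pderiv f"
        using ord ord' f' by (simp add: order_divides)
      moreover have "?x ^ w dvd f" by (rule power_le_dvd[OF that(3)]) simp
      ultimately have dvd: "?x ^ w dvd \<Delta> f" unfolding \<Delta>_def by (intro dvd_diff dvd_mult2)
      have "\<Delta> f \<noteq> 0"
      proof
        assume "\<Delta> f = 0"
        then have eq: "pderiv f * g = f * pderiv g" by (simp add: \<Delta>_def)
        have "pderiv f * g \<noteq> 0" using f' g by simp
        moreover have "order c g = 0" using False by (rule order_0I)
        ultimately have "order c (pderiv f) = order c f + order c (pderiv g)"
          using eq by (metis order_mult add.right_neutral)
        with ord' show False by simp
      qed
      then show ?thesis using dvd that(1) by blast
    qed simp
    then have "{c. \<exists>f\<in>V. f \<noteq> 0 \<and> [:- c, 1:] ^ Suc w dvd f} \<subseteq>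
      {c. \<exists>f\<in>\<Delta> ` V. f \<noteq> 0 \<and> [:- c, 1:] ^ w dvd f} \<union> {c. poly g c = 0}" by blast
    ultimately show ?thesis by (meson finite_UnI finite_subset)
  qed
qed

lemma poly_with_coeffs:
  obtains r :: "'k::field poly" where "degree r \<le> m" "\<And>s. s \<le> m \<Longrightarrow> Polynomial.coeff r s = y s"
proof
  let ?r = "\<Sum>s\<le>m. Polynomial.monom (y s) s"
  show "degree ?r \<le> m" by (intro degree_sum_le) (auto intro: le_trans[OF degree_monom_le])
  show "Polynomial.coeff ?r s = y s" if "s \<le> m" for s using that by (simp add: coeff_sum)
qed

lemma poly_linearly_dependent:
  fixes f :: "'d \<Rightarrow> 'k::field poly"
  assumes "finite D" "\<And>i. i \<in> D \<Longrightarrow> degree (f i) \<le> n" "Suc n < card D"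
  shows "\<exists>y. (\<exists>i\<in>D. y i \<noteq> 0) \<and> (\<Sum>i\<in>D. smult (y i) (f i)) = 0"
proof -
  obtain y where y: "\<exists>i\<in>D. y i \<noteq> 0" "\<forall>e\<in>{..n}. (\<Sum>i\<in>D. y i * Polynomial.coeff (f i) e) = 0"
    using underdetermined_system[of "{..n}" D "\<lambda>e i. Polynomial.coeff (f i) e"] assms by auto
  have "(\<Sum>i\<in>D. smult (y i) (f i)) = 0"
  proof (rule poly_eqI)
    fix e
    have "(\<Sum>i\<in>D. y i * Polynomial.coeff (f i) e) = 0"
    proof (cases "e \<le> n")
      case False
      then have "Polynomial.coeff (f i) e = 0" if "i \<in> D" for i
        using assms(2)[OF that] by (intro coeff_eq_0) simp
      then show ?thesis by simp
    qed (use y in simp)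
    then show "Polynomial.coeff (\<Sum>i\<in>D. smult (y i) (f i)) e = Polynomial.coeff 0 e"
      by (simp add: coeff_sum)
  qed
  with y(1) show ?thesis by blast
qed

lemma degree_shift_mult_le: "degree u \<le> m \<Longrightarrow> degree ([:c, 1:] ^ e * u) \<le> e + m" for u :: "'k::field poly"
proof -
  assume "degree u \<le> m"
  moreover have "degree ([:c, 1:] ^ e * u) \<le> degree ([:c, 1:] ^ e) + degree u" by (rule degree_mult_le)
  moreover have "degree ([:c, 1:] ^ e) = e" by (simp add: degree_linear_power)
  ultimately show ?thesis by linarith
qed

lemma shifted_power_expansion:
  fixes u :: "'k::field poly"
  assumes "degree u \<le> m"
  shows "\<exists>v. u = (\<Sum>k\<le>m. smult (v k) ([:c, 1:] ^ (m - k)))"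
  using assms
proof (induction m arbitrary: u)
  case 0
  then obtain e where "u = [:e:]" by (auto elim: degree_eq_zeroE)
  then show ?case by (intro exI[of _ "\<lambda>_. e"]) simp
next
  case (Suc m)
  have "poly (u - [:poly u (- c):]) (- c) = 0" by simp
  then obtain u' where u': "u - [:poly u (- c):] = [:c, 1:] * u'"
    unfolding poly_eq_0_iff_dvd by (auto elim: dvdE)
  have "degree u' \<le> m"
  proof (cases "u' = 0")
    case False
    then have "degree ([:c, 1:] * u') = Suc (degree u')" by (simp add: degree_mult_eq del: mult_pCons_left)
    moreover have "degree (u - [:poly u (- c):]) \<le> Suc m" using Suc.prems by (intro degree_diff_le) auto
    ultimately show ?thesis using u' by simp
  qed simp
  then obtain v where v: "u' = (\<Sum>k\<le>m. smult (v k) ([:c, 1:] ^ (m - k)))" using Suc.IH by blast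
  let ?v = "v(Suc m := poly u (- c))"
  have "(\<Sum>k\<le>Suc m. smult (?v k) ([:c, 1:] ^ (Suc m - k))) =
    (\<Sum>k\<le>m. smult (v k) ([:c, 1:] * [:c, 1:] ^ (m - k))) + [:poly u (- c):]"
    by (simp add: Suc_diff_le del: mult_pCons_left)
  also have "(\<Sum>k\<le>m. smult (v k) ([:c, 1:] * [:c, 1:] ^ (m - k))) = [:c, 1:] * u'"
    unfolding v sum_distrib_left by (simp only: mult_smult_right)
  also have "[:c, 1:] * u' + [:poly u (- c):] = u" using u' by (simp add: algebra_simps)
  finally show ?case by (intro exI[of _ ?v]) (rule sym)
qed

text \<open>
  Binary forms of degree \<open>n\<close> are encoded as univariate polynomials of degree at most \<open>n\<close>, and a dual
  form of degree \<open>d\<close> as a linear functional. The set \<open>W n\<close> is then the degree \<open>n\<close> part of the annihilator.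
  Multiplication by the linear form \<open>x + c y\<close> becomes multiplication by \<open>[:c, 1:]\<close>.
\<close>

locale dual_form =
  fixes L :: "'k::field_char_0 poly \<Rightarrow> 'k" and d :: nat
  assumes L_add: "L (f + g) = L f + L g" and L_smult: "L (smult c f) = c * L f"
begin

definition W :: "nat \<Rightarrow> 'k poly set" where
  "W n = {f. degree f \<le> n \<and> (\<forall>s. n + s \<le> d \<longrightarrow> L (f * Polynomial.monom 1 s) = 0)}"

lemma L_zero: "L 0 = 0"
  using L_smult[of 0 0] by simp

lemma L_sum: "L (sum f A) = (\<Sum>x\<in>A. L (f x))"
  by (induction A rule: infinite_finite_induct) (auto simp: L_zero L_add)

lemma L_mult_expand:
  assumes "degree r \<le> m"
  shows "L (f * r) = (\<Sum>s\<le>m. Polynomial.coeff r s * L (f * Polynomial.monom 1 s))"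
proof -
  have "r = (\<Sum>s\<le>m. Polynomial.monom (Polynomial.coeff r s) s)"
    using poly_as_sum_of_monoms'[OF assms] by simp
  then have "f * r = (\<Sum>s\<le>m. smult (Polynomial.coeff r s) (f * Polynomial.monom 1 s))"
    by (metis (no_types, lifting) mult_smult_right smult_monom mult.right_neutral sum.cong sum_distrib_left)
  then show ?thesis by (simp add: L_sum L_smult)
qed

lemma W_mult: "f \<in> W n \<Longrightarrow> degree r \<le> m \<Longrightarrow> f * r \<in> W (n + m)"
  unfolding W_def
proof (intro CollectI conjI allI impI)
  assume f: "f \<in> {f. degree f \<le> n \<and> (\<forall>s. n + s \<le> d \<longrightarrow> L (f * Polynomial.monom 1 s) = 0)}" and r: "degree r \<le> m"
  show "degree (f * r) \<le> n + m" using degree_mult_le[of f r] f r by auto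
  fix s assume s: "n + m + s \<le> d"
  have "degree (r * Polynomial.monom 1 s) \<le> m + s"
    using degree_mult_le[of r "Polynomial.monom 1 s"] r degree_monom_le[of "1::'k" s] by linarith
  then have "L (f * (r * Polynomial.monom 1 s)) = 0"
    unfolding L_mult_expand[OF \<open>degree _ \<le> m + s\<close>] using f s by (intro sum.neutral) auto
  then show "L (f * r * Polynomial.monom 1 s) = 0" by (simp only: mult.assoc)
qed

lemma W_zero: "0 \<in> W n" by (simp add: W_def L_zero)

lemma W_add: "f \<in> W n \<Longrightarrow> g \<in> W n \<Longrightarrow> f + g \<in> W n"
  by (auto simp: W_def degree_add_le distrib_right L_add)

lemma W_smult: "f \<in> W n \<Longrightarrow> smult c f \<in> W n"
  by (auto simp: W_def L_smult intro: le_trans[OF degree_smult_le])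

text \<open>
  If the annihilator has no element of degree \<open>k\<close>, the \<open>k + 1\<close> conditions that define it in degree
  \<open>d - k\<close> are independent, so its dimension there is \<open>(d - k + 1) - (k + 1) = d - 2 * k\<close>. The dual
  polynomials \<open>v s\<close> witness this independence.
\<close>

lemma W_dependent:
  assumes k: "W k = {0}" "2 * k \<le> d" and f: "\<forall>i\<le>d - 2 * k. f i \<in> W (d - k)"
  shows "\<exists>y. (\<exists>i\<le>d - 2 * k. y i \<noteq> 0) \<and> (\<Sum>i\<le>d - 2 * k. smult (y i) (f i)) = 0"
proof -
  let ?t = "Polynomial.monom (1::'k)"
  have "\<exists>v. degree v \<le> d - k \<and> (\<forall>s'\<le>k. L (v * ?t s') = (if s' = s then 1 else 0))" for s
  proof -
    have "\<exists>x. \<forall>s'\<in>{..k}. (\<Sum>j\<in>{..d - k}. L (?t j * ?t s') * x j) = (if s' = s then 1 else 0)"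
    proof (rule Fredholm_alternative)
      fix y assume y: "\<forall>j\<in>{..d - k}. (\<Sum>s'\<in>{..k}. y s' * L (?t j * ?t s')) = 0"
      obtain r where deg: "degree r \<le> k" and coeff: "\<And>s. s \<le> k \<Longrightarrow> Polynomial.coeff r s = y s"
        by (rule poly_with_coeffs[of "k" y]) blast
      have "r \<in> W k" unfolding W_def
      proof (intro CollectI conjI allI impI deg)
        fix j assume "k + j \<le> d"
        then have "(\<Sum>s'\<in>{..k}. y s' * L (?t j * ?t s')) = 0" using y by auto
        then show "L (r * ?t j) = 0"
          using L_mult_expand[OF deg, of "?t j"] coeff by (simp add: mult.commute[of r])
      qed
      then have "r = 0" using k by auto
      then have "y s' = 0" if "s' \<le> k" for s' using coeff[OF that] by simp
      then show "(\<Sum>s'\<in>{..k}. y s' * (if s' = s then 1 else 0)) = 0" by (intro sum.neutral) auto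
    qed auto
    then obtain x where x: "\<And>s'. s' \<le> k \<Longrightarrow> (\<Sum>j\<le>d - k. L (?t j * ?t s') * x j) = (if s' = s then 1 else 0)" by auto
    obtain v where deg: "degree v \<le> d - k" and coeff: "\<And>s. s \<le> d - k \<Longrightarrow> Polynomial.coeff v s = x s"
      by (rule poly_with_coeffs[of "d - k" x]) blast
    have "L (v * ?t s') = (\<Sum>j\<le>d - k. L (?t j * ?t s') * x j)" for s'
      using L_mult_expand[OF deg, of "?t s'"] coeff by (simp add: mult.commute)
    then show ?thesis using x deg by auto
  qed
  then have "\<forall>s. \<exists>v. degree v \<le> d - k \<and> (\<forall>s'\<le>k. L (v * ?t s') = (if s' = s then 1 else 0))" ..
  from choice[OF this] obtain v where v: "\<And>s. degree (v s) \<le> d - k"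
    "\<And>s s'. s' \<le> k \<Longrightarrow> L (v s * ?t s') = (if s' = s then 1 else 0)" by blast
  \<comment> \<open>Together these are \<open>d - k + 2\<close> polynomials of degree at most \<open>d - k\<close>.\<close>
  let ?D = "{..d - 2 * k} <+> {..k}"
  have "\<exists>y. (\<exists>i\<in>?D. y i \<noteq> 0) \<and> (\<Sum>i\<in>?D. smult (y i) (case_sum f v i)) = 0"
  proof (rule poly_linearly_dependent[of _ _ "d - k"])
    show "degree (case_sum f v i) \<le> d - k" if "i \<in> ?D" for i using that f v by (auto simp: W_def)
    show "Suc (d - k) < card ?D" using k by (simp add: card_Plus)
  qed simp
  then obtain y where y1: "\<exists>i\<in>?D. y i \<noteq> 0" and "(\<Sum>i\<in>?D. smult (y i) (case_sum f v i)) = 0" by blast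
  then have y2: "(\<Sum>i\<le>d - 2 * k. smult (y (Inl i)) (f i)) + (\<Sum>s\<le>k. smult (y (Inr s)) (v s)) = 0"
    by (simp add: sum.Plus)
  have y0: "y (Inr s) = 0" if s: "s \<le> k" for s
  proof -
    have "0 = L (((\<Sum>i\<le>d - 2 * k. smult (y (Inl i)) (f i)) + (\<Sum>s\<le>k. smult (y (Inr s)) (v s))) * ?t s)"
      unfolding y2 by (simp add: L_zero)
    also have "\<dots> = (\<Sum>i\<le>d - 2 * k. y (Inl i) * L (f i * ?t s)) + (\<Sum>s'\<le>k. y (Inr s') * L (v s' * ?t s))"
      by (simp add: distrib_right sum_distrib_right L_add L_sum L_smult)
    also have "(\<Sum>i\<le>d - 2 * k. y (Inl i) * L (f i * ?t s)) = 0"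
      using f s k(2) by (intro sum.neutral) (auto simp: W_def)
    also have "(\<Sum>s'\<le>k. y (Inr s') * L (v s' * ?t s)) = (\<Sum>s'\<le>k. if s' = s then y (Inr s) else 0)"
      using v(2)[OF s] by (intro sum.cong) auto
    also have "\<dots> = y (Inr s)" using s by simp
    finally show ?thesis by simp
  qed
  then have "\<exists>i\<le>d - 2 * k. y (Inl i) \<noteq> 0" using y1 by auto
  moreover have "(\<Sum>i\<le>d - 2 * k. smult (y (Inl i)) (f i)) = 0" using y2 y0 by simp
  ultimately show ?thesis by (intro exI[of _ "\<lambda>i. y (Inl i)"]) blast
qed

text \<open>
  The initial degree of the annihilator. It is at most \<open>d + 1\<close>, because \<open>W (d + 1)\<close> contains all
  polynomials of degree at most \<open>d + 1\<close>.
\<close>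

definition initial_degree :: nat where "initial_degree = (LEAST n. W n \<noteq> {0})"

lemma W_below_initial_degree: "k < initial_degree \<Longrightarrow> W k = {0}"
  unfolding initial_degree_def by (metis not_less_Least)

lemma W_initial_degree: "W initial_degree \<noteq> {0}"
proof -
  have "1 \<in> W (Suc d)" by (simp add: W_def)
  then have "W (Suc d) \<noteq> {0}" by auto
  then show ?thesis unfolding initial_degree_def by (rule LeastI)
qed

text \<open>
  If a relation \<open>g\<close> of lowest degree does not vanish at the root of \<open>[:c, 1:]\<close>, a suitable multiple
  of it can be subtracted to make any \<open>f\<close> divisible by \<open>[:c, 1:]\<close>; iterating gives the lemma.
\<close>

lemma division_by_first_relation:
  assumes g: "g \<in> W initial_degree" "poly g (- c) \<noteq> 0" and "0 < initial_degree" and f: "degree f \<le> e + (initial_degree - 1)"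
  shows "\<exists>u. degree u \<le> initial_degree - 1 \<and> f - [:c, 1:] ^ e * u \<in> W (e + (initial_degree - 1))"
  using f
proof (induction e arbitrary: f)
  case 0
  then show ?case by (intro exI[of _ f]) (simp add: W_zero)
next
  case (Suc e)
  define h where "h = smult (poly f (- c) / poly g (- c)) g"
  have initial_degree: "Suc e + (initial_degree - 1) = initial_degree + e" using assms(3) by simp
  have h: "h \<in> W (initial_degree + e)" using W_mult[OF W_smult[OF g(1)], of 1 e] by (simp add: h_def)
  have "poly (f - h) (- c) = 0" using g(2) by (simp add: h_def)
  then obtain f' where f': "f - h = [:c, 1:] * f'"
    unfolding poly_eq_0_iff_dvd by (auto elim: dvdE)
  have "degree f' \<le> e + (initial_degree - 1)"
  proof (cases "f' = 0")
    case False
    then have "degree ([:c, 1:] * f') = Suc (degree f')" by (simp add: degree_mult_eq del: mult_pCons_left)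
    moreover have "degree (f - h) \<le> initial_degree + e" using Suc.prems h initial_degree by (intro degree_diff_le) (auto simp: W_def)
    ultimately show ?thesis using f' initial_degree by simp
  qed simp
  then obtain u where u: "degree u \<le> initial_degree - 1" "f' - [:c, 1:] ^ e * u \<in> W (e + (initial_degree - 1))"
    using Suc.IH by blast
  have "(f' - [:c, 1:] ^ e * u) * [:c, 1:] \<in> W (e + (initial_degree - 1) + 1)" by (rule W_mult[OF u(2)]) simp
  moreover have "e + (initial_degree - 1) + 1 = initial_degree + e" using assms(3) by simp
  ultimately have "(f' - [:c, 1:] ^ e * u) * [:c, 1:] \<in> W (initial_degree + e)" by (simp only:)
  then have mem: "h + (f' - [:c, 1:] ^ e * u) * [:c, 1:] \<in> W (initial_degree + e)" by (rule W_add[OF h])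
  have "h + (f' - y * u) * x = (h + x * f') - x * y * u" for x y by (simp add: algebra_simps)
  moreover have "h + [:c, 1:] * f' = f" unfolding f'[symmetric] by simp
  ultimately have "f - [:c, 1:] ^ Suc e * u \<in> W (initial_degree + e)" using mem by (simp only: power_Suc)
  then show ?case using u(1) unfolding initial_degree by blast
qed

text \<open>
  For general \<open>c\<close>, the degree \<open>n\<close> part of the quotient is spanned by the classes of \<open>y ^ k * (x + c y) ^ (n - k)\<close> with
  \<open>k\<close> at most \<open>n\<close>, \<open>d - n\<close> and the initial degree minus one. So the quotient is a union of
  strings, the \<open>k\<close>-th one living in degrees \<open>k, \<dots>, d - k\<close>. The first part says that the strings are
  independent, by the Wronskian argument. The second part is trivial if the minimum is \<open>n\<close>, division by
  the first relation in the middle degrees, and dual to the first part if the minimum is \<open>d - n\<close>.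
\<close>

lemma general_shift_basis:
  assumes "0 < initial_degree"
  shows "\<exists>c. (\<forall>k u. k < initial_degree \<longrightarrow> 2 * k \<le> d \<longrightarrow> degree u \<le> k \<longrightarrow> [:c, 1:] ^ (d - 2 * k) * u \<in> W (d - k) \<longrightarrow> u = 0) \<and>
    (\<forall>n f. n \<le> d \<longrightarrow> degree f \<le> n \<longrightarrow>
      (\<exists>v. f - (\<Sum>k\<le>min n (min (d - n) (initial_degree - 1)). smult (v k) ([:c, 1:] ^ (n - k))) \<in> W n))"
proof -
  obtain g where g: "g \<in> W initial_degree" "g \<noteq> 0" using W_initial_degree W_zero by blast
  define bad where "bad = (\<lambda>k. {c. \<exists>f\<in>W (d - k). f \<noteq> 0 \<and> [:- c, 1:] ^ (d - 2 * k) dvd f})"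
  have "finite (bad k)" if "k < initial_degree" "2 * k \<le> d" for k
    unfolding bad_def using W_dependent[OF W_below_initial_degree[OF that(1)] that(2)]
    by (rule finite_high_order_zeros)
  then have "finite ({c. poly g c = 0} \<union> (\<Union>k\<in>{k. k < initial_degree \<and> 2 * k \<le> d}. bad k))"
    using poly_roots_finite[OF g(2)] by auto
  then obtain c' where c': "c' \<notin> {c. poly g c = 0} \<union> (\<Union>k\<in>{k. k < initial_degree \<and> 2 * k \<le> d}. bad k)"
    using ex_new_if_finite[OF infinite_UNIV_char_0[where 'a = 'k]] by blast
  define c where "c = - c'"
  have gc: "poly g (- c) \<noteq> 0" using c' by (simp add: c_def)
  have indep: "u = 0" if "k < initial_degree" "2 * k \<le> d" "[:c, 1:] ^ (d - 2 * k) * u \<in> W (d - k)" for k u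
  proof (rule ccontr)
    assume "u \<noteq> 0"
    then have "[:c, 1:] ^ (d - 2 * k) * u \<noteq> 0" by simp
    moreover have "[:- c', 1:] ^ (d - 2 * k) dvd [:c, 1:] ^ (d - 2 * k) * u" by (simp add: c_def)
    ultimately have "c' \<in> bad k" unfolding bad_def using that(3) by blast
    then show False using c' that by auto
  qed
  have "\<exists>u. degree u \<le> min n (min (d - n) (initial_degree - 1)) \<and> f - [:c, 1:] ^ (n - min n (min (d - n) (initial_degree - 1))) * u \<in> W n"
    if n: "n \<le> d" "degree f \<le> n" for n f
  proof -
    define K where "K = min n (min (d - n) (initial_degree - 1))"
    consider "K = n" | "K = initial_degree - 1" "initial_degree - 1 \<le> n" | "K = d - n" "d - n \<le> n" "d - n < initial_degree"
      using assms unfolding K_def by linarith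
    then have "\<exists>u. degree u \<le> K \<and> f - [:c, 1:] ^ (n - K) * u \<in> W n"
    proof cases
      case 1
      then show ?thesis using n by (intro exI[of _ f]) (simp add: W_zero)
    next
      case 2
      then show ?thesis
        using division_by_first_relation[OF g(1) gc assms, of f "n - (initial_degree - 1)"] n by simp
    next
      case 3
      let ?t = "Polynomial.monom (1::'k)"
      let ?T = "[:c, 1:] ^ (n - K)"
      have "\<exists>x. \<forall>r\<in>{..K}. (\<Sum>j\<in>{..K}. L (?T * ?t j * ?t r) * x j) = L (f * ?t r)"
      proof (rule Fredholm_alternative)
        fix y assume y: "\<forall>j\<in>{..K}. (\<Sum>r\<in>{..K}. y r * L (?T * ?t j * ?t r)) = 0"
        obtain r where deg: "degree r \<le> K" and coeff: "\<And>s. s \<le> K \<Longrightarrow> Polynomial.coeff r s = y s"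
          by (rule poly_with_coeffs[of "K" y]) blast
        have "?T * r \<in> W n" unfolding W_def
        proof (intro CollectI conjI allI impI)
          show "degree (?T * r) \<le> n" using degree_shift_mult_le[OF deg, of c "n - K"] 3 by simp
          fix j assume "n + j \<le> d"
          then have "(\<Sum>r\<in>{..K}. y r * L (?T * ?t j * ?t r)) = 0" using y 3 by auto
          then have "L (?T * ?t j * r) = 0"
            using L_mult_expand[OF deg, of "?T * ?t j"] coeff by simp
          moreover have "?T * r * ?t j = ?T * ?t j * r" by (simp only: ac_simps)
          ultimately show "L (?T * r * ?t j) = 0" by (simp only:)
        qed
        moreover have e: "d - 2 * K = n - K" "d - K = n" and K: "K < initial_degree" "2 * K \<le> d"
          using 3 n by auto
        ultimately have "[:c, 1:] ^ (d - 2 * K) * r \<in> W (d - K)" unfolding e by simp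
        then have "r = 0" by (rule indep[OF K])
        then have "y s = 0" if "s \<le> K" for s using coeff[OF that] by simp
        then show "(\<Sum>s\<in>{..K}. y s * L (f * ?t s)) = 0" by (intro sum.neutral) auto
      qed auto
      then obtain x where x: "\<And>r. r \<le> K \<Longrightarrow> (\<Sum>j\<le>K. L (?T * ?t j * ?t r) * x j) = L (f * ?t r)" by auto
      obtain u where deg: "degree u \<le> K" and coeff: "\<And>s. s \<le> K \<Longrightarrow> Polynomial.coeff u s = x s"
        by (rule poly_with_coeffs[of "K" x]) blast
      have Lu: "L (?T * u * ?t r) = L (f * ?t r)" if "r \<le> K" for r
      proof -
        have comm: "?T * ?t r * ?t j = ?T * ?t j * ?t r" for j by (simp only: ac_simps)
        have "L (?T * u * ?t r) = L (?T * ?t r * u)" by (simp only: ac_simps)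
        also have "\<dots> = (\<Sum>j\<le>K. L (?T * ?t j * ?t r) * x j)"
          unfolding L_mult_expand[OF deg] comm using coeff
          by (intro sum.cong) (simp_all add: mult.commute)
        finally show ?thesis using x[OF that] by simp
      qed
      have "f - ?T * u \<in> W n" unfolding W_def
      proof (intro CollectI conjI allI impI)
        show "degree (f - ?T * u) \<le> n"
          using degree_shift_mult_le[OF deg, of c "n - K"] 3 n by (intro degree_diff_le) auto
        fix s assume "n + s \<le> d"
        then have "s \<le> K" using 3 by simp
        have "L (f * ?t s - ?T * u * ?t s) = L (f * ?t s) - L (?T * u * ?t s)"
          using L_add[of "f * ?t s - ?T * u * ?t s" "?T * u * ?t s"] by simp
        then show "L ((f - ?T * u) * ?t s) = 0" using Lu[OF \<open>s \<le> K\<close>] by (simp only: left_diff_distrib) simp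
      qed
      then show ?thesis using deg by blast
    qed
    then show ?thesis by (simp only: K_def)
  qed
  note span = this
  have "\<exists>v. f - (\<Sum>k\<le>min n (min (d - n) (initial_degree - 1)). smult (v k) ([:c, 1:] ^ (n - k))) \<in> W n"
    if n: "n \<le> d" "degree f \<le> n" for n f
  proof -
    define K where "K = min n (min (d - n) (initial_degree - 1))"
    obtain u where u: "degree u \<le> K" "f - [:c, 1:] ^ (n - K) * u \<in> W n"
      using span[OF n] unfolding K_def by blast
    obtain v where v: "u = (\<Sum>k\<le>K. smult (v k) ([:c, 1:] ^ (K - k)))"
      using shifted_power_expansion[OF u(1)] by blast
    have "[:c, 1:] ^ (n - K) * u = (\<Sum>k\<le>K. smult (v k) ([:c, 1:] ^ (n - k)))"
      unfolding v sum_distrib_left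
    proof (intro sum.cong refl)
      fix k assume "k \<in> {..K}"
      then have "n - k = (n - K) + (K - k)" by (auto simp: K_def)
      then have "[:c, 1:] ^ (n - k) = [:c, 1:] ^ (n - K) * [:c, 1:] ^ (K - k)"
        by (simp only: power_add)
      then show "[:c, 1:] ^ (n - K) * smult (v k) ([:c, 1:] ^ (K - k)) = smult (v k) ([:c, 1:] ^ (n - k))"
        by (simp only: mult_smult_right)
    qed
    with u(2) have "f - (\<Sum>k\<le>K. smult (v k) ([:c, 1:] ^ (n - k))) \<in> W n" by simp
    then show ?thesis unfolding K_def by (rule exI[of _ v])
  qed
  note expand = this
  show ?thesis
    by (intro exI[of _ c] conjI allI impI) (rule indep, assumption+, rule expand, assumption+)
qed

end

section \<open>A binary binomial times a monomial\<close>

text \<open>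
  The binomial is \<open>a X_p ^ m + b X_q ^ m\<close> times a monomial, so its quotient is the tensor
  product of a codimension two algebra in \<open>x_p, x_q\<close> and a monomial complete intersection in the other
  variables.
\<close>

locale two_variable_binomial =
  fixes \<alpha> \<beta> :: "'n::finite \<Rightarrow> nat" and a b :: "'k::field_char_0" and p q :: 'n and m :: nat
  assumes a: "a \<noteq> 0" and pq: "p \<noteq> q" and m: "0 < m"
    and \<alpha>p: "\<alpha> p = \<beta> p + m" and \<beta>q: "\<beta> q = \<alpha> q + m"
    and rest: "\<And>l. l \<noteq> p \<Longrightarrow> l \<noteq> q \<Longrightarrow> \<beta> l = \<alpha> l"
begin

definition F where "F = monomial \<alpha> a + monomial \<beta> b"

definition d where "d = \<alpha> p + \<alpha> q"

definition functional :: "'k poly \<Rightarrow> 'k" where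
  "functional f = a * Polynomial.coeff f (\<alpha> p) + b * Polynomial.coeff f (\<beta> p)"

sublocale dual_form functional d
  by unfold_locales (simp_all add: functional_def algebra_simps)

lemma initial_degree_pos: "0 < initial_degree"
proof (rule ccontr)
  assume "\<not> ?thesis"
  then have "W 0 \<noteq> {0}" using W_initial_degree by simp
  then obtain f where f: "f \<in> W 0" "f \<noteq> 0" using W_zero by blast
  then obtain e where e: "f = [:e:]" by (auto simp: W_def elim: degree_eq_zeroE)
  have "functional (f * Polynomial.monom 1 (\<alpha> p)) = 0"
  proof -
    have "0 + \<alpha> p \<le> d" by (simp add: d_def)
    with f(1) show ?thesis unfolding W_def by blast
  qed
  then have "a * e = 0" using m \<alpha>p by (simp add: e functional_def)
  with a f e show False by simp
qed

text \<open>
  The coefficient of the monomial \<open>\<xi>\<close> in the variables other than \<open>x_p, x_q\<close>, restricted to degree \<open>n\<close> in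
  \<open>x_p, x_q\<close> and dehomogenised at \<open>x_q = 1\<close>.
\<close>

definition slice :: "('n, 'k) mpoly \<Rightarrow> nat \<Rightarrow> ('n \<Rightarrow> nat) \<Rightarrow> 'k poly" where
  "slice f n \<xi> = (\<Sum>r\<le>n. Polynomial.monom (coef f (\<xi>(p := r, q := n - r))) r)"

lemma coeff_slice: "Polynomial.coeff (slice f n \<xi>) r = (if r \<le> n then coef f (\<xi>(p := r, q := n - r)) else 0)"
  by (simp add: slice_def coeff_sum)

lemma degree_slice: "degree (slice f n \<xi>) \<le> n"
  by (rule degree_le) (simp add: coeff_slice)

definition off_pq :: "('n \<Rightarrow> nat) \<Rightarrow> bool" where
  "off_pq \<xi> \<longleftrightarrow> \<xi> p = 0 \<and> \<xi> q = 0"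

definition small :: "('n \<Rightarrow> nat) \<Rightarrow> bool" where
  "small \<xi> \<longleftrightarrow> off_pq \<xi> \<and> \<xi> \<le> \<alpha>"

lemma tdeg_place: "off_pq \<xi> \<Longrightarrow> tdeg (\<xi>(p := r, q := s)) = tdeg \<xi> + r + s"
  using tdeg_upd[of "\<xi>(p := r)" q s] tdeg_upd[of \<xi> p r] pq by (simp add: off_pq_def)

lemma slice_functional:
  assumes \<xi>: "small \<xi>" and s: "n + s \<le> d"
  defines "\<rho> \<equiv> (\<lambda>l. \<alpha> l - \<xi> l)(p := s, q := d - n - s)"
  shows "(if \<rho> \<le> \<alpha> then a * coef f (\<alpha> - \<rho>) else 0) + (if \<rho> \<le> \<beta> then b * coef f (\<beta> - \<rho>) else 0) =
    functional (slice f n \<xi> * Polynomial.monom 1 s)"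
proof -
  have eq: "(if \<rho> \<le> \<gamma> then coef f (\<gamma> - \<rho>) else 0) = Polynomial.coeff (slice f n \<xi> * Polynomial.monom 1 s) (\<gamma> p)"
    if \<gamma>: "\<gamma> p + \<gamma> q = d" "\<And>l. l \<noteq> p \<Longrightarrow> l \<noteq> q \<Longrightarrow> \<gamma> l = \<alpha> l" for \<gamma>
  proof -
    have le: "\<rho> \<le> \<gamma> \<longleftrightarrow> s \<le> \<gamma> p \<and> \<gamma> p - s \<le> n"
    proof
      assume "\<rho> \<le> \<gamma>"
      from le_funD[OF this, of p] le_funD[OF this, of q] show "s \<le> \<gamma> p \<and> \<gamma> p - s \<le> n"
        using pq \<gamma>(1) by (auto simp: \<rho>_def)
    next
      assume *: "s \<le> \<gamma> p \<and> \<gamma> p - s \<le> n"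
      have "\<rho> l \<le> \<gamma> l" for l
        using * \<gamma>(1) s \<gamma>(2)[of l] by (cases "l = p"; cases "l = q") (auto simp: \<rho>_def pq)
      then show "\<rho> \<le> \<gamma>" by (simp add: le_fun_def)
    qed
    moreover have "\<gamma> - \<rho> = \<xi>(p := \<gamma> p - s, q := n - (\<gamma> p - s))" if "s \<le> \<gamma> p \<and> \<gamma> p - s \<le> n"
    proof
      fix l
      have "\<xi> l \<le> \<alpha> l" using \<xi> by (simp add: small_def le_fun_def)
      then show "(\<gamma> - \<rho>) l = (\<xi>(p := \<gamma> p - s, q := n - (\<gamma> p - s))) l"
        using that \<gamma>(1) s \<gamma>(2)[of l] pq by (cases "l = p"; cases "l = q") (auto simp: \<rho>_def)
    qed
    moreover have "Polynomial.coeff (slice f n \<xi> * Polynomial.monom 1 s) (\<gamma> p) =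
      (if s \<le> \<gamma> p then Polynomial.coeff (slice f n \<xi>) (\<gamma> p - s) else 0)"
      by (simp add: mult.commute[of _ "Polynomial.monom 1 s"] coeff_monom_mult)
    ultimately show ?thesis by (simp add: coeff_slice)
  qed
  have "\<beta> p + \<beta> q = d" using \<alpha>p \<beta>q by (simp add: d_def)
  then show ?thesis
    using eq[of \<alpha>] eq[of \<beta>] rest by (auto simp: functional_def d_def)
qed

text \<open>
  The annihilator is a tensor product too: outside the monomials dividing the common factor in the other
  variables there is no condition, and inside each slice is tested against the binary binomial.
\<close>

lemma Ann_slices:
  "f \<in> Ann F \<longleftrightarrow> (\<forall>\<xi> n. small \<xi> \<longrightarrow> slice f n \<xi> \<in> W n)"
proof
  assume f: "f \<in> Ann F"
  show "\<forall>\<xi> n. small \<xi> \<longrightarrow> slice f n \<xi> \<in> W n"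
    unfolding W_def
  proof (intro allI impI CollectI conjI degree_slice)
    fix \<xi> n s assume "small \<xi>" "n + s \<le> d"
    from slice_functional[OF this, of f] show "functional (slice f n \<xi> * Polynomial.monom 1 s) = 0"
      using spec[OF f[unfolded F_def Ann_binomial_iff], of "(\<lambda>l. \<alpha> l - \<xi> l)(p := s, q := d - n - s)"]
      by (simp only:)
  qed
next
  assume W: "\<forall>\<xi> n. small \<xi> \<longrightarrow> slice f n \<xi> \<in> W n"
  show "f \<in> Ann F"
    unfolding F_def Ann_binomial_iff
  proof
    fix \<rho>
    show "(if \<rho> \<le> \<alpha> then a * coef f (\<alpha> - \<rho>) else 0) + (if \<rho> \<le> \<beta> then b * coef f (\<beta> - \<rho>) else 0) = 0"
    proof (cases "\<rho> \<le> \<alpha> \<or> \<rho> \<le> \<beta>")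
      case True
      then have le: "\<rho> l \<le> \<alpha> l" if "l \<noteq> p" "l \<noteq> q" for l
        using rest[OF that] le_funD[of \<rho> \<alpha> l] le_funD[of \<rho> \<beta> l] by auto
      have sum: "\<rho> p + \<rho> q \<le> d"
        using True
      proof
        assume "\<rho> \<le> \<alpha>"
        from le_funD[OF this, of p] le_funD[OF this, of q] show ?thesis by (simp add: d_def)
      next
        assume "\<rho> \<le> \<beta>"
        from le_funD[OF this, of p] le_funD[OF this, of q] show ?thesis using \<alpha>p \<beta>q by (simp add: d_def)
      qed
      define \<xi> where "\<xi> = (\<lambda>l. \<alpha> l - \<rho> l)(p := 0, q := 0)"
      define n where "n = d - \<rho> p - \<rho> q"
      have small: "small \<xi>" by (auto simp: small_def off_pq_def \<xi>_def le_fun_def)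
      have "\<rho> l = ((\<lambda>l. \<alpha> l - \<xi> l)(p := \<rho> p, q := d - n - \<rho> p)) l" for l
        using le[of l] sum pq by (cases "l = p"; cases "l = q") (auto simp: \<xi>_def n_def)
      then have \<rho>: "\<rho> = (\<lambda>l. \<alpha> l - \<xi> l)(p := \<rho> p, q := d - n - \<rho> p)" by (rule ext)
      have "functional (slice f n \<xi> * Polynomial.monom 1 (\<rho> p)) = 0"
        using W small sum unfolding W_def n_def by auto
      then show ?thesis
        using slice_functional[OF small, of n "\<rho> p" f] sum unfolding \<rho>[symmetric] by (simp add: n_def)
    qed auto
  qed
qed

lemma slice_linear_form_mult:
  fixes c :: 'k
  defines "z \<equiv> linear_form ((\<lambda>_. 1)(q := c))"
  assumes \<xi>: "off_pq \<xi>"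
  shows "slice (z * f) 0 \<xi> =
      (\<Sum>l\<in>UNIV - {p, q}. if 0 < \<xi> l then slice f 0 (\<xi>(l := \<xi> l - 1)) else 0)" (is ?A)
    and "slice (z * f) (Suc n) \<xi> = [:c, 1:] * slice f n \<xi> +
      (\<Sum>l\<in>UNIV - {p, q}. if 0 < \<xi> l then slice f (Suc n) (\<xi>(l := \<xi> l - 1)) else 0)" (is ?B)
proof -
  have split: "(\<Sum>l\<in>UNIV. g l) = g p + g q + (\<Sum>l\<in>UNIV - {p, q}. g l)" for g :: "'n \<Rightarrow> 'k"
  proof -
    have "(\<Sum>l\<in>UNIV. g l) = g p + (\<Sum>l\<in>UNIV - {p}. g l)" by (rule sum.remove) auto
    also have "(\<Sum>l\<in>UNIV - {p}. g l) = g q + (\<Sum>l\<in>UNIV - {p} - {q}. g l)" by (rule sum.remove) (use pq in auto)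
    also have "UNIV - {p} - {q} = UNIV - {p, q}" by auto
    finally show ?thesis by (simp add: add.assoc)
  qed
  have main: "coef (z * f) (\<xi>(p := r, q := s)) =
    (if 0 < r then coef f (\<xi>(p := r - 1, q := s)) else 0) +
    (if 0 < s then c * coef f (\<xi>(p := r, q := s - 1)) else 0) +
    (\<Sum>l\<in>UNIV - {p, q}. if 0 < \<xi> l then coef f ((\<xi>(l := \<xi> l - 1))(p := r, q := s)) else 0)" for r s
  proof -
    have "(\<Sum>l\<in>UNIV - {p, q}. if 0 < (\<xi>(p := r, q := s)) l then ((\<lambda>_. 1)(q := c)) l * coef f ((\<xi>(p := r, q := s))(l := (\<xi>(p := r, q := s)) l - 1)) else 0) =
      (\<Sum>l\<in>UNIV - {p, q}. if 0 < \<xi> l then coef f ((\<xi>(l := \<xi> l - 1))(p := r, q := s)) else 0)"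
    proof (rule sum.cong[OF refl])
      fix l assume "l \<in> UNIV - {p, q}"
      then have l: "l \<noteq> p" "l \<noteq> q" by auto
      then have "(\<xi>(p := r, q := s))(l := \<xi> l - 1) = (\<xi>(l := \<xi> l - 1))(p := r, q := s)"
        by (simp add: fun_upd_twist)
      then show "(if 0 < (\<xi>(p := r, q := s)) l then ((\<lambda>_. 1)(q := c)) l * coef f ((\<xi>(p := r, q := s))(l := (\<xi>(p := r, q := s)) l - 1)) else 0) =
        (if 0 < \<xi> l then coef f ((\<xi>(l := \<xi> l - 1))(p := r, q := s)) else 0)"
        using l by simp
    qed
    moreover have "\<xi>(q := s', p := r') = \<xi>(p := r', q := s')" for r' s'
      using pq by (auto simp: fun_eq_iff)
    ultimately show ?thesis
      unfolding z_def coef_linear_form_mult split[of "\<lambda>l. if 0 < (\<xi>(p := r, q := s)) l then _ l else 0"]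
      using pq by simp
  qed
  have coeff_if: "Polynomial.coeff (if P then g else 0) r = (if P then Polynomial.coeff g r else 0)" for P g r
    by simp
  show ?A
    by (rule poly_eqI) (simp add: coeff_slice main coeff_sum coeff_if cong: if_cong)
  show ?B
  proof (rule poly_eqI)
    fix r
    have "Polynomial.coeff ([:c, 1:] * slice f n \<xi>) r =
      (if 0 < r then Polynomial.coeff (slice f n \<xi>) (r - 1) else 0) + c * Polynomial.coeff (slice f n \<xi>) r"
      by (cases r) simp_all
    also have "\<dots> = (if r \<le> Suc n then (if 0 < r then coef f (\<xi>(p := r - 1, q := Suc n - r)) else 0) +
        (if 0 < Suc n - r then c * coef f (\<xi>(p := r, q := Suc n - r - 1)) else 0) else 0)"
      by (cases r) (auto simp: coeff_slice)
    finally show "Polynomial.coeff (slice (z * f) (Suc n) \<xi>) r = Polynomial.coeff ([:c, 1:] * slice f n \<xi> +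
      (\<Sum>l\<in>UNIV - {p, q}. if 0 < \<xi> l then slice f (Suc n) (\<xi>(l := \<xi> l - 1)) else 0)) r"
      by (simp add: coeff_slice[of "z * f"] main coeff_sum coeff_if coeff_slice[of f "Suc n"] del: mult_pCons_left cong: if_cong)
  qed
qed

text \<open>
  Multiplication by \<open>1\<close> plus the sum of the variables other than \<open>x_p, x_q\<close>. The summand \<open>1\<close> records the
  linear form in \<open>x_p, x_q\<close>, whose exponent is determined by the total degree.
\<close>

definition spread :: "(('n \<Rightarrow> nat) \<Rightarrow> 'k) \<Rightarrow> ('n \<Rightarrow> nat) \<Rightarrow> 'k" where
  "spread v \<xi> = v \<xi> + (\<Sum>l\<in>UNIV - {p, q}. if 0 < \<xi> l then v (\<xi>(l := \<xi> l - 1)) else 0)"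

lemma tdeg_pred: "0 < \<xi> l \<Longrightarrow> Suc (tdeg (\<xi>(l := \<xi> l - 1))) = tdeg \<xi>"
  using tdeg_upd[of \<xi> l "\<xi> l - 1"] by simp

lemma spread_power_support:
  assumes "\<And>\<xi>. v \<xi> \<noteq> 0 \<Longrightarrow> tdeg \<xi> + k \<le> i" and "(spread ^^ e) v \<xi> \<noteq> 0"
  shows "tdeg \<xi> + k \<le> i + e"
  using assms(2)
proof (induction e arbitrary: \<xi>)
  case (Suc e)
  show ?case
  proof (rule ccontr)
    assume "\<not> ?thesis"
    then have big: "i + e < tdeg \<xi> + k" "i + Suc e < tdeg \<xi> + k" by auto
    have "(spread ^^ e) v \<xi> = 0" using Suc.IH[of \<xi>] big by fastforce
    moreover have "(spread ^^ e) v (\<xi>(l := \<xi> l - 1)) = 0" if "0 < \<xi> l" for l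
      using Suc.IH[of "\<xi>(l := \<xi> l - 1)"] tdeg_pred[of \<xi> l, OF that] big by fastforce
    ultimately have "(spread ^^ Suc e) v \<xi> = 0" by (simp add: spread_def cong: if_cong)
    with Suc.prems show False by blast
  qed
qed (use assms in simp)

text \<open>
  The linear form acts on an expansion along the strings of \<open>general_shift_basis\<close> by acting on each
  family \<open>v k\<close> of coefficients separately.
\<close>

lemma slice_power:
  assumes expand: "\<And>\<xi>. off_pq \<xi> \<Longrightarrow> tdeg \<xi> \<le> i \<Longrightarrow>
      slice f (i - tdeg \<xi>) \<xi> = (\<Sum>k\<le>K. smult (v k \<xi>) ([:c, 1:] ^ (i - tdeg \<xi> - k)))"
    and supp: "\<And>k \<xi>. v k \<xi> \<noteq> 0 \<Longrightarrow> tdeg \<xi> + k \<le> i"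
    and "off_pq \<xi>" "tdeg \<xi> \<le> i + e"
  shows "slice (linear_form ((\<lambda>_. 1)(q := c)) ^ e * f) (i + e - tdeg \<xi>) \<xi> =
    (\<Sum>k\<le>K. smult ((spread ^^ e) (v k) \<xi>) ([:c, 1:] ^ (i + e - tdeg \<xi> - k)))"
  using assms(3,4)
proof (induction e arbitrary: \<xi>)
  case 0
  then show ?case using expand by simp
next
  case (Suc e)
  let ?z = "linear_form ((\<lambda>_. 1)(q := c))"
  let ?T = "[:c, 1:]"
  let ?w = "\<lambda>k. (spread ^^ e) (v k)"
  let ?n = "i + Suc e - tdeg \<xi>"
  have supp_w: "?w k \<xi> \<noteq> 0 \<Longrightarrow> tdeg \<xi> + k \<le> i + e" for k \<xi>
    by (rule spread_power_support[of "v k"]) (rule supp)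
  have "(\<Sum>l\<in>UNIV - {p, q}. if 0 < \<xi> l then slice (?z ^ e * f) ?n (\<xi>(l := \<xi> l - 1)) else 0) =
    (\<Sum>l\<in>UNIV - {p, q}. \<Sum>k\<le>K. smult (if 0 < \<xi> l then ?w k (\<xi>(l := \<xi> l - 1)) else 0) (?T ^ (?n - k)))"
  proof (rule sum.cong[OF refl])
    fix l assume "l \<in> UNIV - {p, q}"
    then have l: "l \<noteq> p" "l \<noteq> q" by auto
    show "(if 0 < \<xi> l then slice (?z ^ e * f) ?n (\<xi>(l := \<xi> l - 1)) else 0) =
      (\<Sum>k\<le>K. smult (if 0 < \<xi> l then ?w k (\<xi>(l := \<xi> l - 1)) else 0) (?T ^ (?n - k)))"
    proof (cases "0 < \<xi> l")
      case True
      have off: "off_pq (\<xi>(l := \<xi> l - 1))" using Suc.prems(1) l by (simp add: off_pq_def)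
      have n: "i + e - tdeg (\<xi>(l := \<xi> l - 1)) = ?n" "tdeg (\<xi>(l := \<xi> l - 1)) \<le> i + e"
        using tdeg_pred[of \<xi> l, OF True] Suc.prems(2) by auto
      show ?thesis by (simp only: True if_True Suc.IH[OF off n(2), unfolded n(1)])
    qed simp
  qed
  also have "\<dots> = (\<Sum>k\<le>K. \<Sum>l\<in>UNIV - {p, q}. smult (if 0 < \<xi> l then ?w k (\<xi>(l := \<xi> l - 1)) else 0) (?T ^ (?n - k)))"
    by (rule sum.swap)
  also have "\<dots> = (\<Sum>k\<le>K. smult (\<Sum>l\<in>UNIV - {p, q}. if 0 < \<xi> l then ?w k (\<xi>(l := \<xi> l - 1)) else 0) (?T ^ (?n - k)))"
    by (simp only: smult_sum)
  finally have rest_terms: "(\<Sum>l\<in>UNIV - {p, q}. if 0 < \<xi> l then slice (?z ^ e * f) ?n (\<xi>(l := \<xi> l - 1)) else 0) =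
    (\<Sum>k\<le>K. smult (\<Sum>l\<in>UNIV - {p, q}. if 0 < \<xi> l then ?w k (\<xi>(l := \<xi> l - 1)) else 0) (?T ^ (?n - k)))" .
  have goal_rhs: "(\<Sum>k\<le>K. smult ((spread ^^ Suc e) (v k) \<xi>) (?T ^ (?n - k))) =
    (\<Sum>k\<le>K. smult (?w k \<xi>) (?T ^ (?n - k))) +
    (\<Sum>k\<le>K. smult (\<Sum>l\<in>UNIV - {p, q}. if 0 < \<xi> l then ?w k (\<xi>(l := \<xi> l - 1)) else 0) (?T ^ (?n - k)))"
    by (simp only: funpow.simps o_apply spread_def smult_add_left sum.distrib)
  show ?case
  proof (cases "tdeg \<xi> \<le> i + e")
    case True
    then have n: "?n = Suc (i + e - tdeg \<xi>)" by simp
    have "?T * slice (?z ^ e * f) (i + e - tdeg \<xi>) \<xi> = (\<Sum>k\<le>K. smult (?w k \<xi>) (?T ^ (?n - k)))"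
      unfolding Suc.IH[OF Suc.prems(1) True] sum_distrib_left
    proof (intro sum.cong refl)
      fix k
      show "?T * smult (?w k \<xi>) (?T ^ (i + e - tdeg \<xi> - k)) = smult (?w k \<xi>) (?T ^ (?n - k))"
      proof (cases "?w k \<xi> = 0")
        case False
        then have "?n - k = Suc (i + e - tdeg \<xi> - k)" using supp_w[OF False] by simp
        then show ?thesis by (simp only: mult_smult_right power_Suc)
      qed simp
    qed
    then show ?thesis
      unfolding goal_rhs rest_terms[symmetric] power_Suc mult.assoc
      unfolding n slice_linear_form_mult(2)[OF Suc.prems(1)] by simp
  next
    case False
    then have n: "?n = 0" using Suc.prems(2) by simp
    have "?w k \<xi> = 0" for k using supp_w[of k \<xi>] False by fastforce
    then show ?thesis
      unfolding goal_rhs rest_terms[symmetric] power_Suc mult.assoc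
      unfolding n slice_linear_form_mult(1)[OF Suc.prems(1)] by simp
  qed
qed

text \<open>
  The \<open>k\<close>-th string has length \<open>d - 2 * k + 1\<close>. Its tensor product with the monomial complete
  intersection in the other variables is again a monomial complete intersection, with the variable \<open>p\<close> in
  the role of the linear form in \<open>x_p, x_q\<close> and with \<open>q\<close> absent.
\<close>

definition string_box :: "nat \<Rightarrow> 'n \<Rightarrow> nat" where
  "string_box k = \<alpha>(p := d - 2 * k, q := 0)"

text \<open>
  The coefficients \<open>w\<close> of the \<open>k\<close>-th string, read as an element of degree \<open>i\<close> of the monomial
  complete intersection of \<open>string_box k\<close>; the exponent of \<open>p\<close> is determined by the degree.
\<close>

definition on_string :: "nat \<Rightarrow> nat \<Rightarrow> (('n \<Rightarrow> nat) \<Rightarrow> 'k) \<Rightarrow> ('n \<Rightarrow> nat) \<Rightarrow> 'k" where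
  "on_string k i w \<eta> = (if \<eta> \<le> string_box k \<and> tdeg \<eta> = i then w (\<eta>(p := 0)) else 0)"

lemma raise_on_string:
  assumes supp: "\<And>\<xi>. w \<xi> \<noteq> 0 \<Longrightarrow> tdeg \<xi> \<le> i"
  shows "raise (string_box k) (on_string k i w) = on_string k (Suc i) (spread w)"
proof
  fix \<eta>
  let ?\<tau> = "string_box k"
  show "raise ?\<tau> (on_string k i w) \<eta> = on_string k (Suc i) (spread w) \<eta>"
  proof (cases "\<eta> \<le> ?\<tau> \<and> tdeg \<eta> = Suc i")
    case False
    have "on_string k i w \<in> box_part ?\<tau> i" by (auto simp: box_part_def on_string_def split: if_splits)
    from raise_box_part[OF this] have "raise ?\<tau> (on_string k i w) \<eta> = 0"
      using False unfolding box_part_def by blast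
    then show ?thesis using False by (auto simp: on_string_def)
  next
    case True
    have \<eta>q: "\<eta> q = 0" using le_funD[OF conjunct1[OF True], of q] by (simp add: string_box_def)
    have le: "\<eta>(l := \<eta> l - 1) \<le> ?\<tau>" for l
      by (rule order_trans[OF _ conjunct1[OF True]]) (simp add: le_fun_def)
    have at: "raise_at ?\<tau> l (on_string k i w) \<eta> = (if 0 < \<eta> l then w (\<eta>(l := \<eta> l - 1, p := 0)) else 0)" for l
      using le_funD[OF conjunct1[OF True], of l] le[of l] tdeg_pred[of \<eta> l] True
      by (auto simp: raise_at_def on_string_def)
    have p_term: "(if 0 < \<eta> p then w (\<eta>(p := \<eta> p - 1, p := 0)) else 0) = w (\<eta>(p := 0))"
    proof (cases "0 < \<eta> p")
      case False
      then have "\<eta>(p := 0) = \<eta>" by auto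
      then have "w (\<eta>(p := 0)) = 0" using supp[of \<eta>] True by fastforce
      then show ?thesis using False by simp
    qed simp
    have "raise ?\<tau> (on_string k i w) \<eta> = (\<Sum>l\<in>UNIV. if 0 < \<eta> l then w (\<eta>(l := \<eta> l - 1, p := 0)) else 0)"
      by (simp only: raise_def at)
    also have "\<dots> = (if 0 < \<eta> p then w (\<eta>(p := \<eta> p - 1, p := 0)) else 0) +
      (\<Sum>l\<in>UNIV - {p}. if 0 < \<eta> l then w (\<eta>(l := \<eta> l - 1, p := 0)) else 0)"
      by (rule sum.remove) auto
    also have "(\<Sum>l\<in>UNIV - {p}. if 0 < \<eta> l then w (\<eta>(l := \<eta> l - 1, p := 0)) else 0) =
      (\<Sum>l\<in>UNIV - {p, q}. if 0 < \<eta> l then w (\<eta>(l := \<eta> l - 1, p := 0)) else 0)"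
      using \<eta>q by (intro sum.mono_neutral_right) auto
    also have "\<dots> = (\<Sum>l\<in>UNIV - {p, q}. if 0 < (\<eta>(p := 0)) l then w ((\<eta>(p := 0))(l := (\<eta>(p := 0)) l - 1)) else 0)"
      by (intro sum.cong refl) (auto simp: fun_upd_twist)
    finally have "raise ?\<tau> (on_string k i w) \<eta> = spread w (\<eta>(p := 0))"
      unfolding p_term spread_def .
    moreover have "on_string k (Suc i) (spread w) \<eta> = spread w (\<eta>(p := 0))"
      using True by (simp add: on_string_def)
    ultimately show ?thesis by (simp only:)
  qed
qed

lemma raise_power_on_string:
  assumes "\<And>\<xi>. w \<xi> \<noteq> 0 \<Longrightarrow> tdeg \<xi> \<le> i"
  shows "(raise (string_box k) ^^ e) (on_string k i w) = on_string k (i + e) ((spread ^^ e) w)"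
proof (induction e)
  case (Suc e)
  have "raise (string_box k) (on_string k (i + e) ((spread ^^ e) w)) = on_string k (Suc (i + e)) (spread ((spread ^^ e) w))"
    using spread_power_support[of w 0 i e] assms by (intro raise_on_string) simp
  then show ?case using Suc by simp
qed simp

lemma tdeg_string_box: "2 * k \<le> d \<Longrightarrow> tdeg (string_box k) + 2 * k = tdeg \<alpha>"
  using tdeg_upd[of "\<alpha>(p := d - 2 * k)" q 0] tdeg_upd[of \<alpha> p "d - 2 * k"] pq
  by (simp add: string_box_def d_def)

text \<open>
  Injectivity, by filtering the quotient by the string index. Multiplication by
  \<open>x_p + c x_q\<close> past the end of the \<open>k\<close>-th string lands in strings of smaller index, so on the highest
  index \<open>t\<close> that occurs the linear form acts as on a monomial complete intersection. This gives a
  contradiction with Stanley's theorem.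
\<close>

lemma expansion_vanishes:
  assumes indep: "\<And>k u. k < initial_degree \<Longrightarrow> 2 * k \<le> d \<Longrightarrow> degree u \<le> k \<Longrightarrow>
      [:c, 1:] ^ (d - 2 * k) * u \<in> W (d - k) \<Longrightarrow> u = 0"
    and i: "2 * i \<le> tdeg \<alpha>"
    and expand: "\<And>\<xi>. off_pq \<xi> \<Longrightarrow> tdeg \<xi> \<le> i \<Longrightarrow>
      slice f (i - tdeg \<xi>) \<xi> = (\<Sum>k\<le>initial_degree - 1. smult (v k \<xi>) ([:c, 1:] ^ (i - tdeg \<xi> - k)))"
    and supp: "\<And>k \<xi>. v k \<xi> \<noteq> 0 \<Longrightarrow> small \<xi> \<and> k < initial_degree \<and> tdeg \<xi> + k \<le> i \<and> i + k \<le> tdeg \<xi> + d"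
    and Ann: "linear_form ((\<lambda>_. 1)(q := c)) ^ (tdeg \<alpha> - 2 * i) * f \<in> Ann F"
  shows "v k \<xi> = 0"
proof (rule ccontr)
  assume "v k \<xi> \<noteq> 0"
  \<comment> \<open>The highest string index \<open>t\<close> that occurs.\<close>
  define S where "S = {k. \<exists>\<xi>. v k \<xi> \<noteq> 0}"
  have "S \<subseteq> {..<initial_degree}" using supp by (auto simp: S_def)
  then have fin: "finite S" by (rule finite_subset) simp
  define t where "t = Max S"
  have "S \<noteq> {}" using \<open>v k \<xi> \<noteq> 0\<close> by (auto simp: S_def)
  then have "t \<in> S" using fin by (simp add: t_def)
  then obtain \<xi>0 where \<xi>0: "v t \<xi>0 \<noteq> 0" by (auto simp: S_def)
  have above: "v k = (\<lambda>_. 0)" if "t < k" for k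
  proof (rule ccontr)
    assume "v k \<noteq> (\<lambda>_. 0)"
    then have "k \<in> S" by (auto simp: S_def fun_eq_iff)
    then show False using Max_ge[OF fin] that by (fastforce simp: t_def)
  qed
  have t: "t < initial_degree" "t \<le> i" "2 * t \<le> d" using supp[OF \<xi>0] by auto
  let ?e = "tdeg \<alpha> - 2 * i"
  let ?z = "linear_form ((\<lambda>_. 1)(q := c))"
  have "spread (\<lambda>_. 0) = (\<lambda>_. 0)" by (simp add: spread_def fun_eq_iff)
  then have spread0: "(spread ^^ e) (\<lambda>_. 0) = (\<lambda>_. 0)" for e
    by (induction e) simp_all
  have "on_string t (i - t) (v t) = (\<lambda>_. 0)"
  proof (rule monomial_complete_intersection_Lefschetz)
    show "on_string t (i - t) (v t) \<in> box_part (string_box t) (i - t)"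
      by (auto simp: box_part_def on_string_def split: if_splits)
    show "2 * (i - t) \<le> tdeg (string_box t)" using tdeg_string_box[OF t(3)] i t(2) by simp
    have e: "tdeg (string_box t) - 2 * (i - t) = ?e" using tdeg_string_box[OF t(3)] t(2) by simp
    have "on_string t (i - t + ?e) ((spread ^^ ?e) (v t)) \<eta> = 0" for \<eta>
    proof (cases "\<eta> \<le> string_box t \<and> tdeg \<eta> = i - t + ?e")
      case True
      define \<xi> where "\<xi> = \<eta>(p := 0)"
      define n where "n = i + ?e - tdeg \<xi>"
      have le: "\<eta> l \<le> string_box t l" for l using True by (simp add: le_fun_def)
      have "\<xi> l \<le> \<alpha> l" for l
        using le[of l] pq by (cases "l = p"; cases "l = q") (auto simp: \<xi>_def string_box_def)
      then have \<xi>: "small \<xi>"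
        using le[of q] by (simp add: small_def off_pq_def \<xi>_def string_box_def le_fun_def)
      have deg: "tdeg \<xi> + \<eta> p + t = i + ?e" using tdeg_upd[of \<eta> p 0] True t(2) by (simp add: \<xi>_def)
      have n: "n = t + \<eta> p" "t \<le> n" "n + t \<le> d"
        using deg le[of p] t(3) pq by (auto simp: n_def string_box_def)
      let ?w = "\<lambda>k. (spread ^^ ?e) (v k) \<xi>"
      define u where "u = (\<Sum>k\<le>t. smult (?w k) ([:c, 1:] ^ (t - k)))"
      have "slice (?z ^ ?e * f) n \<xi> = (\<Sum>k\<le>initial_degree - 1. smult (?w k) ([:c, 1:] ^ (n - k)))"
        unfolding n_def using \<xi> deg supp by (intro slice_power expand) (auto simp: small_def)
      also have "\<dots> = (\<Sum>k\<le>t. smult (?w k) ([:c, 1:] ^ (n - k)))"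
        using t(1) above spread0 by (intro sum.mono_neutral_right) auto
      also have "\<dots> = [:c, 1:] ^ (n - t) * u"
        unfolding u_def sum_distrib_left
      proof (intro sum.cong refl)
        fix k assume "k \<in> {..t}"
        then have "n - k = (n - t) + (t - k)" using n(2) by simp
        then have "[:c, 1:] ^ (n - k) = [:c, 1:] ^ (n - t) * [:c, 1:] ^ (t - k)"
          by (simp only: power_add)
        then show "smult (?w k) ([:c, 1:] ^ (n - k)) = [:c, 1:] ^ (n - t) * smult (?w k) ([:c, 1:] ^ (t - k))"
          by (simp only: mult_smult_right)
      qed
      finally have "[:c, 1:] ^ (n - t) * u \<in> W n" using Ann \<xi> unfolding Ann_slices by metis
      moreover have "degree ([:c, 1:] ^ (d - t - n)) \<le> d - t - n" by (simp add: degree_linear_power)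
      ultimately have "[:c, 1:] ^ (n - t) * u * [:c, 1:] ^ (d - t - n) \<in> W (n + (d - t - n))" by (rule W_mult)
      moreover have "n + (d - t - n) = d - t" using n by simp
      moreover have "[:c, 1:] ^ (n - t) * u * [:c, 1:] ^ (d - t - n) = [:c, 1:] ^ (d - 2 * t) * u"
      proof -
        have "d - 2 * t = (n - t) + (d - t - n)" using n by simp
        then have "[:c, 1:] ^ (d - 2 * t) = [:c, 1:] ^ (n - t) * [:c, 1:] ^ (d - t - n)" by (simp only: power_add)
        then show ?thesis by (simp only: ac_simps)
      qed
      ultimately have "[:c, 1:] ^ (d - 2 * t) * u \<in> W (d - t)" by (simp only:)
      moreover have "degree u \<le> t"
        unfolding u_def
      proof (rule degree_sum_le)
        fix k assume "k \<in> {..t}"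
        have "degree (smult (?w k) ([:c, 1:] ^ (t - k))) \<le> degree ([:c, 1:] ^ (t - k))" by (rule degree_smult_le)
        also have "\<dots> \<le> t" by (simp add: degree_linear_power)
        finally show "degree (smult (?w k) ([:c, 1:] ^ (t - k))) \<le> t" .
      qed simp
      ultimately have "u = 0" using indep t by blast
      \<comment> \<open>Only the summand \<open>k = t\<close> survives at the root of \<open>[:c, 1:]\<close>.\<close>
      moreover have "poly u (- c) = ?w t"
      proof -
        have "poly u (- c) = (\<Sum>k\<le>t. if k = t then ?w t else 0)"
          unfolding u_def poly_sum by (intro sum.cong) (auto simp: poly_power)
        then show ?thesis by simp
      qed
      ultimately have "?w t = 0" by simp
      then show ?thesis using True by (simp add: on_string_def \<xi>_def)
    qed (auto simp: on_string_def)
    then show "(raise (string_box t) ^^ (tdeg (string_box t) - 2 * (i - t))) (on_string t (i - t) (v t)) = (\<lambda>_. 0)"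
      unfolding e using supp by (subst raise_power_on_string) (auto simp: fun_eq_iff, fastforce)
  qed
  moreover have "on_string t (i - t) (v t) (\<xi>0(p := i - tdeg \<xi>0 - t)) = v t \<xi>0"
  proof -
    have \<xi>0': "small \<xi>0" "tdeg \<xi>0 + t \<le> i" "i + t \<le> tdeg \<xi>0 + d" using supp[OF \<xi>0] by auto
    have "\<xi>0(p := i - tdeg \<xi>0 - t) \<le> string_box t"
    proof (rule le_funI)
      fix l
      show "(\<xi>0(p := i - tdeg \<xi>0 - t)) l \<le> string_box t l"
        using \<xi>0' le_funD[of \<xi>0 \<alpha> l] pq
        by (cases "l = p"; cases "l = q") (auto simp: small_def off_pq_def string_box_def)
    qed
    moreover have "tdeg (\<xi>0(p := i - tdeg \<xi>0 - t)) = i - t"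
      using tdeg_upd[of \<xi>0 p "i - tdeg \<xi>0 - t"] \<xi>0' by (auto simp: small_def off_pq_def)
    moreover have "\<xi>0(p := 0) = \<xi>0" using \<xi>0' by (auto simp: small_def off_pq_def fun_eq_iff)
    ultimately show ?thesis by (simp add: on_string_def)
  qed
  ultimately show False using \<xi>0 by simp
qed

text \<open>
  Every class has a representative \<open>g\<close> whose slices are expanded along the strings. The slices of \<open>f\<close> at
  exponents that are not \<open>small\<close> or of degree above \<open>d\<close> in \<open>x_p, x_q\<close> are dropped, as they contribute
  elements of the annihilator.
\<close>

lemma expansion_exists:
  assumes span: "\<And>n f. n \<le> d \<Longrightarrow> degree f \<le> n \<Longrightarrow>
      \<exists>v. f - (\<Sum>k\<le>min n (min (d - n) (initial_degree - 1)). smult (v k) ([:c, 1:] ^ (n - k))) \<in> W n"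
    and f: "f \<in> homogeneous_part i"
  shows "\<exists>g v. f - g \<in> Ann F \<and>
    (\<forall>\<xi>. off_pq \<xi> \<longrightarrow> tdeg \<xi> \<le> i \<longrightarrow>
      slice g (i - tdeg \<xi>) \<xi> = (\<Sum>k\<le>initial_degree - 1. smult (v k \<xi>) ([:c, 1:] ^ (i - tdeg \<xi> - k)))) \<and>
    (\<forall>k \<xi>. v k \<xi> \<noteq> 0 \<longrightarrow> small \<xi> \<and> k < initial_degree \<and> tdeg \<xi> + k \<le> i \<and> i + k \<le> tdeg \<xi> + d) \<and>
    ((\<forall>k \<xi>. v k \<xi> = 0) \<longrightarrow> g = 0)"
proof -
  let ?P = "initial_degree - 1"
  let ?K = "\<lambda>n. min n (min (d - n) ?P)"
  have "\<exists>v. i - tdeg \<xi> \<le> d \<longrightarrow>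
    slice f (i - tdeg \<xi>) \<xi> - (\<Sum>k\<le>?K (i - tdeg \<xi>). smult (v k) ([:c, 1:] ^ (i - tdeg \<xi> - k))) \<in> W (i - tdeg \<xi>)" for \<xi>
    using span[OF _ degree_slice, of "i - tdeg \<xi>" f \<xi>] by blast
  then have "\<forall>\<xi>. \<exists>v. i - tdeg \<xi> \<le> d \<longrightarrow>
    slice f (i - tdeg \<xi>) \<xi> - (\<Sum>k\<le>?K (i - tdeg \<xi>). smult (v k) ([:c, 1:] ^ (i - tdeg \<xi> - k))) \<in> W (i - tdeg \<xi>)" ..
  from choice[OF this] obtain v0 where v0: "\<And>\<xi>. i - tdeg \<xi> \<le> d \<Longrightarrow>
    slice f (i - tdeg \<xi>) \<xi> - (\<Sum>k\<le>?K (i - tdeg \<xi>). smult (v0 \<xi> k) ([:c, 1:] ^ (i - tdeg \<xi> - k))) \<in> W (i - tdeg \<xi>)"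
    by blast
  define v where "v = (\<lambda>k \<xi>. if small \<xi> \<and> tdeg \<xi> \<le> i \<and> i - tdeg \<xi> \<le> d \<and> k \<le> ?K (i - tdeg \<xi>) then v0 \<xi> k else 0)"
  define Q where "Q = (\<lambda>\<xi>. \<Sum>k\<le>?P. smult (v k \<xi>) ([:c, 1:] ^ (i - tdeg \<xi> - k)))"
  define B where "B = {\<eta> :: 'n \<Rightarrow> nat. tdeg \<eta> = i}"
  define g where "g = (\<Sum>\<eta>\<in>B. monomial \<eta> (Polynomial.coeff (Q (\<eta>(p := 0, q := 0))) (\<eta> p)))"
  have coef_g: "coef g \<eta> = (if tdeg \<eta> = i then Polynomial.coeff (Q (\<eta>(p := 0, q := 0))) (\<eta> p) else 0)" for \<eta>
    by (simp add: g_def coef_sum_monomial B_def finite_tdeg)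
  have supp: "small \<xi> \<and> k < initial_degree \<and> tdeg \<xi> + k \<le> i \<and> i + k \<le> tdeg \<xi> + d" if "v k \<xi> \<noteq> 0" for k \<xi>
    using that initial_degree_pos by (auto simp: v_def split: if_splits)
  have degQ: "degree (Q \<xi>) \<le> i - tdeg \<xi>" for \<xi>
    unfolding Q_def
  proof (rule degree_sum_le)
    fix k
    have "degree (smult (v k \<xi>) ([:c, 1:] ^ (i - tdeg \<xi> - k))) \<le> degree ([:c, 1:] ^ (i - tdeg \<xi> - k))" by (rule degree_smult_le)
    also have "\<dots> \<le> i - tdeg \<xi>" by (simp add: degree_linear_power)
    finally show "degree (smult (v k \<xi>) ([:c, 1:] ^ (i - tdeg \<xi> - k))) \<le> i - tdeg \<xi>" .
  qed simp
  have slice_g: "slice g (i - tdeg \<xi>) \<xi> = Q \<xi>" if \<xi>: "off_pq \<xi>" "tdeg \<xi> \<le> i" for \<xi>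
  proof (rule poly_eqI)
    fix r
    show "Polynomial.coeff (slice g (i - tdeg \<xi>) \<xi>) r = Polynomial.coeff (Q \<xi>) r"
    proof (cases "r \<le> i - tdeg \<xi>")
      case True
      have "tdeg (\<xi>(p := r, q := i - tdeg \<xi> - r)) = i" using tdeg_place[OF \<xi>(1)] True \<xi>(2) by simp
      moreover have "\<xi>(p := r, q := i - tdeg \<xi> - r, p := 0, q := 0) = \<xi>"
        using \<xi>(1) by (auto simp: off_pq_def fun_eq_iff)
      ultimately show ?thesis using True pq by (simp add: coeff_slice coef_g)
    next
      case False
      then have "Polynomial.coeff (Q \<xi>) r = 0" using degQ[of \<xi>] by (intro coeff_eq_0) simp
      then show ?thesis using False by (simp add: coeff_slice)
    qed
  qed
  have slice_zero: "slice h n \<xi> = 0" if "h \<in> homogeneous_part i" "off_pq \<xi>" "n + tdeg \<xi> \<noteq> i" for h n \<xi>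
  proof (rule poly_eqI)
    fix r
    have "coef h (\<xi>(p := r, q := n - r)) = 0" if "r \<le> n"
      using \<open>h \<in> _\<close> \<open>n + tdeg \<xi> \<noteq> i\<close> tdeg_place[OF \<open>off_pq \<xi>\<close>, of r "n - r"] that
      unfolding homogeneous_part_iff by fastforce
    then show "Polynomial.coeff (slice h n \<xi>) r = Polynomial.coeff 0 r" by (simp add: coeff_slice)
  qed
  have slice_diff: "slice (f - g) n \<xi> = slice f n \<xi> - slice g n \<xi>" for n \<xi>
    by (rule poly_eqI) (simp add: coeff_slice)
  have hom_g: "g \<in> homogeneous_part i" unfolding homogeneous_part_iff by (simp add: coef_g)
  have "f - g \<in> Ann F"
    unfolding Ann_slices
  proof (intro allI impI)
    fix \<xi> n assume \<xi>: "small \<xi>"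
    show "slice (f - g) n \<xi> \<in> W n"
    proof (cases "n + tdeg \<xi> = i")
      case True
      then have n: "n = i - tdeg \<xi>" "tdeg \<xi> \<le> i" by auto
      show ?thesis
      proof (cases "n \<le> d")
        case le: True
        have "Q \<xi> = (\<Sum>k\<le>?K n. smult (v0 \<xi> k) ([:c, 1:] ^ (n - k)))"
          unfolding Q_def using n le \<xi> by (intro sum.mono_neutral_cong_right) (auto simp: v_def)
        then show ?thesis
          using v0[of \<xi>] le n slice_g[of \<xi>] \<xi> by (simp add: slice_diff small_def)
      next
        case False
        then show ?thesis using degree_slice by (simp add: W_def)
      qed
    next
      case False
      then show ?thesis
        using slice_zero[OF f, of \<xi> n] slice_zero[OF hom_g, of \<xi> n] \<xi>
        by (simp add: slice_diff W_zero small_def)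
    qed
  qed
  moreover have "g = 0" if "\<forall>k \<xi>. v k \<xi> = 0"
    using that by (intro mpoly_eqI) (simp add: coef_g Q_def)
  ultimately show ?thesis
    using slice_g supp unfolding Q_def by (intro exI[of _ g] exI[of _ v]) blast
qed

text \<open>
  The symmetry of the strings about \<open>d / 2\<close> makes the boxes \<open>string_box k\<close>, shifted by \<open>k\<close>, all symmetric
  about half of the socle degree; therefore the same power of the linear form is the right one for all of them.
\<close>

lemma two_variable_binomial_Lefschetz:
  "strong_Lefschetz (mpoly_ring Quot Ann (monomial \<alpha> a + monomial \<beta> b)) (quotient_part (Ann (monomial \<alpha> a + monomial \<beta> b)))"
proof -
  obtain c where indep: "\<And>k u. k < initial_degree \<Longrightarrow> 2 * k \<le> d \<Longrightarrow> degree u \<le> k \<Longrightarrow>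
      [:c, 1:] ^ (d - 2 * k) * u \<in> W (d - k) \<Longrightarrow> u = 0"
    and span: "\<And>n f. n \<le> d \<Longrightarrow> degree f \<le> n \<Longrightarrow>
      \<exists>v. f - (\<Sum>k\<le>min n (min (d - n) (initial_degree - 1)). smult (v k) ([:c, 1:] ^ (n - k))) \<in> W n"
    using general_shift_basis[OF initial_degree_pos] by blast
  have deg: "tdeg \<beta> = tdeg \<alpha>"
  proof -
    have "\<beta> = \<alpha>(p := \<beta> p, q := \<beta> q)" using rest by (auto simp: fun_eq_iff)
    then show ?thesis
      using tdeg_upd[of "\<alpha>(p := \<beta> p)" q "\<beta> q"] tdeg_upd[of \<alpha> p "\<beta> p"] pq \<alpha>p \<beta>q by simp
  qed
  let ?z = "linear_form ((\<lambda>_. 1)(q := c))"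
  show ?thesis
  proof (rule strong_Lefschetz_of_injective[OF refl deg linear_form_homogeneous[of "(\<lambda>_. 1)(q := c)"]], fold F_def)
    fix i f assume i: "2 * i \<le> tdeg \<alpha>" and f: "f \<in> homogeneous_part i" "?z ^ (tdeg \<alpha> - 2 * i) * f \<in> Ann F"
    obtain g v where g: "f - g \<in> Ann F"
      and expand: "\<And>\<xi>. off_pq \<xi> \<Longrightarrow> tdeg \<xi> \<le> i \<Longrightarrow>
        slice g (i - tdeg \<xi>) \<xi> = (\<Sum>k\<le>initial_degree - 1. smult (v k \<xi>) ([:c, 1:] ^ (i - tdeg \<xi> - k)))"
      and supp: "\<And>k \<xi>. v k \<xi> \<noteq> 0 \<Longrightarrow> small \<xi> \<and> k < initial_degree \<and> tdeg \<xi> + k \<le> i \<and> i + k \<le> tdeg \<xi> + d"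
      and zero: "(\<And>k \<xi>. v k \<xi> = 0) \<Longrightarrow> g = 0"
      using expansion_exists[OF span f(1)] by blast
    have "?z ^ (tdeg \<alpha> - 2 * i) * g = ?z ^ (tdeg \<alpha> - 2 * i) * f - ?z ^ (tdeg \<alpha> - 2 * i) * (f - g)"
      by (simp add: algebra_simps)
    then have "?z ^ (tdeg \<alpha> - 2 * i) * g \<in> Ann F" using Ann_diff[OF f(2) Ann_mult[OF g]] by simp
    then have "v k \<xi> = 0" for k \<xi>
      using expansion_vanishes[of c i g v k \<xi>] indep i expand supp by blast
    then have "g = 0" by (rule zero)
    then show "f \<in> Ann F" using g by simp
  qed
qed

end

section \<open>Binomials that define a complete intersection\<close>

lemma complete_intersection_generators:
  fixes F :: "('n::finite, 'k::field) mpoly"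
  assumes "complete_intersection mpoly_ring (Ann F)" and "finite D"
    and "\<And>\<mu> l g. \<mu> \<in> D \<Longrightarrow> 0 < \<mu> l \<Longrightarrow> g \<in> Ann F \<Longrightarrow> coef g (\<mu>(l := \<mu> l - 1)) = 0"
    and "\<And>\<mu>. \<mu> \<in> D \<Longrightarrow> \<exists>g\<in>Ann F. \<forall>\<mu>'\<in>D. coef g \<mu>' = (if \<mu>' = \<mu> then 1 else 0)"
  shows "card D \<le> card (UNIV :: 'n set)"
proof -
  obtain fs where fs: "regular_sequence mpoly_ring fs" "Ann F = Idl\<^bsub>mpoly_ring\<^esub> (set fs)"
    using assms(1) unfolding complete_intersection_def by blast
  have "card D \<le> length fs" by (rule generators_lower_bound[OF fs(2) assms(2-4)])
  also have "\<dots> \<le> card (UNIV :: 'n set)" by (rule regular_sequence_length[OF fs(1)])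
  finally show ?thesis .
qed

text \<open>
  In these two lemmas the coefficient at \<open>\<mu>\<close> is the only one in its equation of \<open>Ann_binomial_iff\<close>.
\<close>

lemma coef_Ann_zero_left:
  assumes "g \<in> Ann (monomial \<alpha> a + monomial \<beta> b)" "a \<noteq> 0" "\<mu> \<le> \<alpha>" "\<beta> l + \<mu> l < \<alpha> l"
  shows "coef g \<mu> = 0"
proof -
  have "\<alpha> - (\<alpha> - \<mu>) = \<mu>" "\<alpha> - \<mu> \<le> \<alpha>" using assms(3) by (auto simp: le_fun_def fun_eq_iff)
  moreover have "\<not> \<alpha> - \<mu> \<le> \<beta>" using assms(4) by (auto simp: le_fun_def not_le intro!: exI[of _ l])
  ultimately show ?thesis
    using spec[OF assms(1)[unfolded Ann_binomial_iff], of "\<alpha> - \<mu>"] assms(2) by simp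
qed

lemma coef_Ann_zero_right:
  assumes "g \<in> Ann (monomial \<alpha> a + monomial \<beta> b)" "b \<noteq> 0" "\<mu> \<le> \<beta>" "\<alpha> l + \<mu> l < \<beta> l"
  shows "coef g \<mu> = 0"
  using coef_Ann_zero_left[of g \<beta> b \<alpha> a \<mu> l] assms by (simp add: add.commute)

lemma dual_monomial:
  "monomial \<mu> 1 \<in> Ann F \<Longrightarrow> \<exists>g\<in>Ann F. \<forall>\<mu>'\<in>D. coef g \<mu>' = (if \<mu>' = \<mu> then 1 else 0)"
  by (intro bexI[of _ "monomial \<mu> 1"]) (auto simp: coef_monomial)

text \<open>
  If both monomials exceed the other one in at least two variables, the powers
  \<open>x_l ^ (max (\<alpha> l) (\<beta> l) + 1)\<close> are minimal generators, and so is the monomial \<open>pair\<close>, whose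
  exponent exceeds \<open>\<beta>\<close> at \<open>p1\<close> and \<open>\<alpha>\<close> at \<open>q1\<close>. These are \<open>N + 1\<close> minimal generators.
\<close>

lemma not_complete_intersection_of_two_two:
  fixes \<alpha> \<beta> :: "'n::finite \<Rightarrow> nat" and a b :: "'k::field"
  assumes nz: "a \<noteq> 0" "b \<noteq> 0" and p: "p1 \<noteq> p2" "\<beta> p1 < \<alpha> p1" "\<beta> p2 < \<alpha> p2"
    and q: "q1 \<noteq> q2" "\<alpha> q1 < \<beta> q1" "\<alpha> q2 < \<beta> q2"
  shows "\<not> complete_intersection mpoly_ring (Ann (monomial \<alpha> a + monomial \<beta> b))"
proof
  let ?F = "monomial \<alpha> a + monomial \<beta> b"
  assume ci: "complete_intersection mpoly_ring (Ann ?F)"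
  define pow where "pow = (\<lambda>x::'n. (\<lambda>_. 0)(x := max (\<alpha> x) (\<beta> x) + 1))"
  define pair where "pair = (\<lambda>_::'n. 0::nat)(p1 := \<beta> p1 + 1, q1 := \<alpha> q1 + 1)"
  have distinct: "p1 \<noteq> q1" "p1 \<noteq> q2" "p2 \<noteq> q1" "p2 \<noteq> q2" using p q by auto
  have inj: "inj pow" by (rule injI) (auto simp: pow_def fun_eq_iff split: if_splits)
  have "pair \<noteq> pow x" for x
  proof
    assume "pair = pow x"
    from fun_cong[OF this, of p1] fun_cong[OF this, of q1] distinct show False
      by (auto simp: pair_def pow_def split: if_splits)
  qed
  then have "card (insert pair (range pow)) = Suc (card (UNIV :: 'n set))"
    using inj by (subst card_insert_disjoint) (auto simp: card_image)
  moreover have "card (insert pair (range pow)) \<le> card (UNIV :: 'n set)"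
  proof (rule complete_intersection_generators[OF ci])
    fix \<mu> l g assume \<mu>: "\<mu> \<in> insert pair (range pow)" "0 < \<mu> l" and g: "g \<in> Ann ?F"
    from \<mu>(1) consider "\<mu> = pair" | x where "\<mu> = pow x" by blast
    then show "coef g (\<mu>(l := \<mu> l - 1)) = 0"
    proof cases
      case 1
      then consider "l = p1" | "l = q1" using \<mu>(2) by (auto simp: pair_def split: if_splits)
      then show ?thesis
      proof cases
        case l: 1
        show ?thesis
          by (rule coef_Ann_zero_right[OF g nz(2), of _ q2])
             (use 1 l p q distinct in \<open>auto simp: pair_def le_fun_def\<close>)
      next
        case l: 2
        show ?thesis
          by (rule coef_Ann_zero_left[OF g nz(1), of _ p2])
             (use 1 l p q distinct in \<open>auto simp: pair_def le_fun_def\<close>)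
      qed
    next
      case 2
      then have l: "l = x" using \<mu>(2) by (auto simp: pow_def split: if_splits)
      have \<mu>': "\<mu>(l := \<mu> l - 1) = (\<lambda>_. 0)(x := max (\<alpha> x) (\<beta> x))" unfolding 2 l pow_def by simp
      show ?thesis
      proof (cases "\<beta> x \<le> \<alpha> x")
        case True
        define r where "r = (if x = p1 then p2 else p1)"
        have "r \<noteq> x" "\<beta> r < \<alpha> r" using p by (auto simp: r_def)
        then show ?thesis unfolding \<mu>'
          by (intro coef_Ann_zero_left[OF g nz(1), of _ r]) (use True in \<open>auto simp: le_fun_def\<close>)
      next
        case False
        define r where "r = (if x = q1 then q2 else q1)"
        have "r \<noteq> x" "\<alpha> r < \<beta> r" using q by (auto simp: r_def)
        then show ?thesis unfolding \<mu>'
          by (intro coef_Ann_zero_right[OF g nz(2), of _ r]) (use False in \<open>auto simp: le_fun_def\<close>)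
      qed
    qed
  next
    fix \<mu> assume "\<mu> \<in> insert pair (range pow)"
    then consider "\<mu> = pair" | x where "\<mu> = pow x" by blast
    then have "\<not> \<mu> \<le> \<alpha> \<and> \<not> \<mu> \<le> \<beta>"
    proof cases
      case 1
      then have "\<alpha> q1 < \<mu> q1" "\<beta> p1 < \<mu> p1" using distinct by (auto simp: pair_def)
      then show ?thesis by (auto simp: le_fun_def not_le)
    next
      case 2
      then have "\<alpha> x < \<mu> x" "\<beta> x < \<mu> x" by (auto simp: pow_def)
      then show ?thesis by (auto simp: le_fun_def not_le)
    qed
    then show "\<exists>g\<in>Ann ?F. \<forall>\<mu>'\<in>insert pair (range pow). coef g \<mu>' = (if \<mu>' = \<mu> then 1 else 0)"
      by (intro dual_monomial monomial_mem_Ann) auto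
  qed simp
  ultimately show False by simp
qed

text \<open>
  The case that \<open>box_spans_quotient\<close> does not cover. There are again \<open>N + 1\<close> minimal generators: the \<open>N - 1\<close> powers
  \<open>x_l ^ (\<beta> l + 1)\<close> with \<open>l \<noteq> p\<close>, and for \<open>j = q1, q2\<close> a telescoping sum along the \<open>chain\<close> that starts at
  the monomial \<open>lead j\<close> and leaves the range of \<open>\<alpha>\<close> at its last index \<open>T\<close>. The coefficient at
  \<open>lead j\<close> vanishes on multiples by variables because the same chain divided by \<open>x_j\<close>
  stays in the range of \<open>\<alpha>\<close> for all \<open>t \<le> T\<close>, so that the coefficients of an annihilating element vanish from
  the last index downwards.
\<close>

lemma not_complete_intersection_of_one_two:
  fixes \<alpha> \<beta> :: "'n::finite \<Rightarrow> nat" and a b :: "'k::field"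
  assumes nz: "a \<noteq> 0" "b \<noteq> 0" and p: "\<alpha> p = \<beta> p + m" "0 < m" and le: "\<And>l. l \<noteq> p \<Longrightarrow> \<alpha> l \<le> \<beta> l"
    and q: "q1 \<noteq> q2" "\<alpha> q1 < \<beta> q1" "\<alpha> q2 < \<beta> q2"
    and small: "\<And>T l. T * m \<le> \<beta> p + 1 \<Longrightarrow> l \<noteq> p \<Longrightarrow> T * (\<beta> l - \<alpha> l) \<le> \<alpha> l"
  shows "\<not> complete_intersection mpoly_ring (Ann (monomial \<alpha> a + monomial \<beta> b))"
proof
  let ?F = "monomial \<alpha> a + monomial \<beta> b"
  assume ci: "complete_intersection mpoly_ring (Ann ?F)"
  define T where "T = (\<beta> p + 1) div m"
  have T: "T * m \<le> \<beta> p + 1" by (simp add: T_def)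
  have T': "\<beta> p + 1 < T * m + m"
    using dividend_less_div_times[OF p(2), of "\<beta> p + 1"] by (simp add: T_def add.commute)
  have tm: "t * m \<le> \<beta> p + 1" if "t \<le> T" for t
    using T mult_le_mono1[OF that, of m] by linarith
  define \<nu> where "\<nu> = (\<lambda>l. \<beta> l - \<alpha> l)"
  have t\<nu>: "t * \<nu> l \<le> \<alpha> l" if "t \<le> T" "l \<noteq> p" for t l
    using small[OF tm[OF that(1)] that(2)] by (simp add: \<nu>_def)
  define pow where "pow = (\<lambda>x::'n. (\<lambda>_. 0)(x := \<beta> x + 1))"
  define chain where "chain = (\<lambda>r j. exchange \<alpha> \<beta> p m ((\<lambda>_. 0)(j := \<alpha> j - T * \<nu> j + r)))"
  define lead where "lead = (\<lambda>j. (\<lambda>_::'n. 0::nat)(p := \<beta> p + 1, j := \<alpha> j - T * \<nu> j + 1))"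
  have chain0: "chain 1 j 0 = lead j" if "j \<noteq> p" for j using that by (auto simp: chain_def exchange_def lead_def fun_eq_iff)
  have qp: "q1 \<noteq> p" "q2 \<noteq> p" using p q by auto
  define D where "D = insert (lead q1) (insert (lead q2) (pow ` (UNIV - {p})))"
  have inj: "inj_on pow (UNIV - {p})" by (rule inj_onI) (auto simp: pow_def fun_eq_iff split: if_splits)
  have lead_pow: "lead j \<noteq> pow x" if "j \<noteq> p" "x \<noteq> p" for j x
    using that by (auto simp: lead_def pow_def fun_eq_iff intro!: exI[of _ p])
  have lead_lead: "lead q1 \<noteq> lead q2"
    using q qp by (auto simp: lead_def fun_eq_iff intro!: exI[of _ q1])
  have "card (pow ` (UNIV - {p})) = card (UNIV :: 'n set) - 1"
    using inj by (simp add: card_image card_Diff_singleton)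
  moreover have "lead q1 \<notin> insert (lead q2) (pow ` (UNIV - {p}))" "lead q2 \<notin> pow ` (UNIV - {p})"
    using lead_lead lead_pow qp by auto
  moreover have "0 < card (UNIV :: 'n set)" by (simp add: card_gt_0_iff)
  ultimately have "card D = Suc (card (UNIV :: 'n set))" unfolding D_def by simp
  moreover have "card D \<le> card (UNIV :: 'n set)"
  proof (rule complete_intersection_generators[OF ci])
    fix \<mu> l g assume \<mu>: "\<mu> \<in> D" "0 < \<mu> l" and g: "g \<in> Ann ?F"
    from \<mu>(1) consider j j' where "\<mu> = lead j" "j \<noteq> p" "j' \<noteq> p" "j \<noteq> j'" "\<alpha> j < \<beta> j" "\<alpha> j' < \<beta> j'"
      | x where "\<mu> = pow x" "x \<noteq> p" unfolding D_def using q qp by blast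
    then show "coef g (\<mu>(l := \<mu> l - 1)) = 0"
    proof cases
      case 1
      then consider "l = p" | "l = j" using \<mu>(2) by (auto simp: lead_def split: if_splits)
      then show ?thesis
      proof cases
        case l: 1
        show ?thesis
          by (rule coef_Ann_zero_right[OF g nz(2), of _ j'])
             (use 1 l in \<open>auto simp: lead_def le_fun_def\<close>)
      next
        case l: 2
        have "coef g (chain 0 j t) = 0" if "t \<le> T" for t
          using that
        proof (induction t rule: inc_induct)
          have bound: "chain 0 j t \<le> \<alpha>" if "t \<le> T" for t
          proof (rule le_funI)
            fix l
            have "\<alpha> j - T * \<nu> j + t * \<nu> j \<le> \<alpha> j"
              using t\<nu>[OF order_refl 1(2)] mult_le_mono1[OF that, of "\<nu> j"] by linarith
            then show "chain 0 j t l \<le> \<alpha> l" using t\<nu>[OF that, of l] p by (auto simp: chain_def exchange_def \<nu>_def)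
          qed
          {
            case base
            show ?case
              by (rule coef_Ann_zero_left[OF g nz(1) bound, of _ p])
                 (use T T' p in \<open>auto simp: chain_def exchange_def\<close>)
          next
            case (step t)
            have tm': "t * m + m \<le> \<beta> p + 1" using tm[of "Suc t"] step.hyps by (simp add: add.commute)
            note b' = le_funD[OF bound[OF less_imp_le[OF step.hyps(2)]]]
            have "\<alpha> - (\<alpha> - chain 0 j t) = chain 0 j t" "\<alpha> - chain 0 j t \<le> \<alpha>"
              using b' by (auto simp: le_fun_def fun_eq_iff)
            moreover have "(\<beta> - (\<alpha> - chain 0 j t)) l = chain 0 j (Suc t) l" for l
              using b'[of l] le[of l] tm' p by (auto simp: chain_def exchange_def \<nu>_def add_ac)
            then have "\<beta> - (\<alpha> - chain 0 j t) = chain 0 j (Suc t)" by (rule ext)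
            ultimately show ?case
              using spec[OF g[unfolded Ann_binomial_iff], of "\<alpha> - chain 0 j t"] nz(1) step.IH
              by (simp split: if_splits)
          }
        qed
        moreover have "\<mu>(l := \<mu> l - 1) = chain 0 j 0"
          using 1 l by (auto simp: lead_def chain_def exchange_def fun_eq_iff)
        ultimately show ?thesis by simp
      qed
    next
      case 2
      then have l: "l = x" using \<mu>(2) by (auto simp: pow_def split: if_splits)
      have \<mu>': "\<mu>(l := \<mu> l - 1) = (\<lambda>_. 0)(x := \<beta> x)" unfolding 2 l pow_def by simp
      define r where "r = (if x = q1 then q2 else q1)"
      have "r \<noteq> x" "\<alpha> r < \<beta> r" using q by (auto simp: r_def)
      then show ?thesis unfolding \<mu>'
        by (intro coef_Ann_zero_right[OF g nz(2), of _ r]) (auto simp: le_fun_def)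
    qed
  next
    fix \<mu> assume "\<mu> \<in> D"
    then consider j j' where "\<mu> = lead j" "j \<noteq> p" "j' \<noteq> p" "j \<noteq> j'" "\<alpha> j < \<beta> j" "\<alpha> j' < \<beta> j'"
        "\<And>\<mu>'. \<mu>' \<in> D \<Longrightarrow> \<mu>' = lead j \<or> \<mu>' = lead j' \<or> (\<exists>x. x \<noteq> p \<and> \<mu>' = pow x)"
      | x where "\<mu> = pow x" "x \<noteq> p" unfolding D_def using q qp by blast
    then show "\<exists>g\<in>Ann ?F. \<forall>\<mu>'\<in>D. coef g \<mu>' = (if \<mu>' = \<mu> then 1 else 0)"
    proof cases
      case 1
      define h where "h = (\<Sum>t\<le>T. monomial (chain 1 j t) ((- a / b) ^ t))"
      have coef_h: "coef h \<mu>' = (\<Sum>t\<le>T. if chain 1 j t = \<mu>' then (- a / b) ^ t else 0)" for \<mu>'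
        by (simp add: h_def coef_sum coef_monomial cong: if_cong)
      have "h \<in> Ann ?F"
        unfolding h_def chain_def
        by (rule exchange_sum_Ann[where q = j])
           (use nz(2) p le T 1(2) t\<nu>[OF order_refl 1(2)] in \<open>auto simp: \<nu>_def\<close>)
      moreover have "coef h \<mu>' = (if \<mu>' = \<mu> then 1 else 0)" if "\<mu>' \<in> D" for \<mu>'
      proof -
        have start: "t = 0" if "t \<le> T" "chain 1 j t p = \<beta> p + 1" for t
        proof -
          have "\<beta> p + 1 - t * m = \<beta> p + 1" using that(2) by (simp add: chain_def exchange_def)
          with tm[OF that(1)] have "t * m = 0" by linarith
          then show ?thesis using p(2) by simp
        qed
        from 1(7)[OF that] consider "\<mu>' = lead j" | "\<mu>' = lead j'" | x where "x \<noteq> p" "\<mu>' = pow x" by blast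
        then show ?thesis
        proof cases
          case \<mu>': 1
          have "chain 1 j t = \<mu>' \<longleftrightarrow> t = 0" if "t \<le> T" for t
            using start[OF that] chain0[OF 1(2)] 1(2) \<mu>' by (auto simp: lead_def)
          then have "coef h \<mu>' = (\<Sum>t\<le>T. if t = 0 then 1 else 0)"
            unfolding coef_h by (intro sum.cong) auto
          then show ?thesis using 1(1) \<mu>' by simp
        next
          case \<mu>': 2
          have ne: "lead j' \<noteq> lead j" using 1 by (auto simp: lead_def fun_eq_iff intro!: exI[of _ j])
          have "chain 1 j t \<noteq> \<mu>'" if "t \<le> T" for t
          proof
            assume eq: "chain 1 j t = \<mu>'"
            then have "t = 0" using start[OF that] 1(3) \<mu>' by (simp add: lead_def)
            then show False using eq chain0[OF 1(2)] \<mu>' ne by simp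
          qed
          then have "coef h \<mu>' = 0" unfolding coef_h by (intro sum.neutral) auto
          then show ?thesis using 1(1) \<mu>' ne by simp
        next
          case \<mu>': 3
          have "chain 1 j t \<noteq> \<mu>'" if "t \<le> T" for t
          proof
            assume eq: "chain 1 j t = \<mu>'"
            have "t \<noteq> 0"
            proof
              assume "t = 0"
              with fun_cong[OF eq, of p] \<mu>' show False by (simp add: chain_def exchange_def pow_def)
            qed
            then have "chain 1 j t j \<noteq> 0" "chain 1 j t j' \<noteq> 0" using 1 by (auto simp: chain_def exchange_def \<nu>_def)
            then show False using eq \<mu>' 1(4) by (auto simp: pow_def split: if_splits)
          qed
          then have "coef h \<mu>' = 0" unfolding coef_h by (intro sum.neutral) auto
          moreover have "lead j \<noteq> pow x" using 1(2) \<mu>'(1) by (rule lead_pow)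
          ultimately show ?thesis using 1(1) \<mu>'(2) by auto
        qed
      qed
      ultimately show ?thesis by blast
    next
      case 2
      then have "\<alpha> x < \<mu> x" "\<beta> x < \<mu> x" using le[of x] by (auto simp: pow_def)
      then have "\<not> \<mu> \<le> \<alpha>" "\<not> \<mu> \<le> \<beta>" by (auto simp: le_fun_def not_le)
      then show ?thesis by (intro dual_monomial monomial_mem_Ann)
    qed
  qed (simp add: D_def)
  ultimately show False by simp
qed

lemma exists_less_of_tdeg_eq:
  assumes "tdeg \<alpha> = tdeg \<beta>" "\<beta> p < \<alpha> p"
  shows "\<exists>q. \<alpha> q < \<beta> q"
proof (rule ccontr)
  assume "\<not> ?thesis"
  then have "\<beta> l \<le> \<alpha> l" for l by (auto simp: not_less)
  then have "tdeg \<beta> < tdeg \<alpha>" unfolding tdeg_def using assms(2) by (intro sum_strict_mono_ex1) auto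
  with assms(1) show False by simp
qed

text \<open>
  If some multiple \<open>T\<close> as in \<open>box_spans_quotient\<close> exists, the quotient degenerates to a monomial one. Otherwise
  the complete intersection hypothesis leaves a single variable in which \<open>X^\<beta>\<close> exceeds \<open>X^\<alpha>\<close>.
\<close>

lemma one_sided_Lefschetz:
  fixes \<alpha> \<beta> :: "'n::finite \<Rightarrow> nat" and a b :: "'k::field_char_0"
  assumes nz: "a \<noteq> 0" "b \<noteq> 0" and deg: "tdeg \<alpha> = tdeg \<beta>"
    and p: "\<beta> p < \<alpha> p" and le: "\<And>l. l \<noteq> p \<Longrightarrow> \<alpha> l \<le> \<beta> l"
    and ci: "complete_intersection mpoly_ring (Ann (monomial \<alpha> a + monomial \<beta> b))"
  shows "strong_Lefschetz (mpoly_ring Quot Ann (monomial \<alpha> a + monomial \<beta> b))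
    (quotient_part (Ann (monomial \<alpha> a + monomial \<beta> b)))"
proof -
  define m where "m = \<alpha> p - \<beta> p"
  have m: "\<alpha> p = \<beta> p + m" "0 < m" using p by (auto simp: m_def)
  show ?thesis
  proof (cases "\<exists>T l. T * m \<le> \<beta> p + 1 \<and> l \<noteq> p \<and> \<alpha> l < T * (\<beta> l - \<alpha> l)")
    case True
    then obtain T l where "T * m \<le> \<beta> p + 1" "l \<noteq> p" "\<alpha> l < T * (\<beta> l - \<alpha> l)" by blast
    then show ?thesis
      using nz(2) deg m le
      by (intro degenerate_to_monomial_Lefschetz[OF nz(2) deg refl m] box_spans_quotient[where T = T and q = l and p = p and m = m]) auto
  next
    case False
    obtain q where q: "\<alpha> q < \<beta> q" using exists_less_of_tdeg_eq[of \<alpha> \<beta> p] deg p by blast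
    have only: "l = q" if "\<alpha> l < \<beta> l" for l
    proof (rule ccontr)
      assume "l \<noteq> q"
      have "T * (\<beta> l - \<alpha> l) \<le> \<alpha> l" if "T * m \<le> \<beta> p + 1" "l \<noteq> p" for T l
        using False that by (meson not_less)
      then show False
        using not_complete_intersection_of_one_two[OF nz m le \<open>l \<noteq> q\<close> that q] ci by blast
    qed
    have pq: "p \<noteq> q" using p q by auto
    have rest: "\<beta> l = \<alpha> l" if "l \<noteq> p" "l \<noteq> q" for l
      using only[of l] le[of l] that by (meson antisym_conv not_le)
    have "\<beta> = \<alpha>(p := \<beta> p, q := \<beta> q)" using rest by (auto simp: fun_eq_iff)
    then have "tdeg \<beta> + \<alpha> q + \<alpha> p = tdeg \<alpha> + \<beta> p + \<beta> q"
      using tdeg_upd[of "\<alpha>(p := \<beta> p)" q "\<beta> q"] tdeg_upd[of \<alpha> p "\<beta> p"] pq by simp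
    then have "\<beta> q = \<alpha> q + m" using deg m by simp
    then interpret two_variable_binomial \<alpha> \<beta> a b p q m
      using nz pq m rest by unfold_locales auto
    show ?thesis by (rule two_variable_binomial_Lefschetz)
  qed
qed

theorem proposition3p2:
  fixes F :: "('n::finite, 'k::field_char_0) mpoly"
  assumes "F \<noteq> 0"
    and "homogeneous F"
    and "is_binomial F"
    and "complete_intersection mpoly_ring (Ann F)"
  shows "strong_Lefschetz (mpoly_ring Quot Ann F) (quotient_part (Ann F))"
proof -
  obtain \<alpha>' \<beta>' a b where ab: "\<alpha>' \<noteq> \<beta>'" "a \<noteq> 0" "b \<noteq> 0"
    and F': "F = Poly_Mapping.single \<alpha>' a + Poly_Mapping.single \<beta>' b"
    using assms(3) unfolding is_binomial_def by blast
  define \<alpha> where "\<alpha> = Poly_Mapping.lookup \<alpha>'"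
  define \<beta> where "\<beta> = Poly_Mapping.lookup \<beta>'"
  have F: "F = monomial \<alpha> a + monomial \<beta> b"
    by (simp add: F' \<alpha>_def \<beta>_def monomial_def lookup_inverse)
  have ne: "\<alpha> \<noteq> \<beta>" using ab(1) by (simp add: \<alpha>_def \<beta>_def)
  obtain D where "F \<in> homogeneous_part D" using assms(2) unfolding homogeneous_def by blast
  moreover have "coef F \<alpha> \<noteq> 0" "coef F \<beta> \<noteq> 0" using ab ne by (simp_all add: F coef_monomial)
  ultimately have deg: "tdeg \<alpha> = tdeg \<beta>" unfolding homogeneous_part_iff by auto
  have F_swap: "F = monomial \<beta> b + monomial \<alpha> a" by (simp add: F add.commute)
  obtain l where "\<alpha> l \<noteq> \<beta> l" using ne by (auto simp: fun_eq_iff)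
  then have "\<alpha> l < \<beta> l \<or> \<beta> l < \<alpha> l" by linarith
  then have "(\<exists>p. \<beta> p < \<alpha> p) \<and> (\<exists>q. \<alpha> q < \<beta> q)"
    using exists_less_of_tdeg_eq[OF deg] exists_less_of_tdeg_eq[OF deg[symmetric]] by blast
  then obtain p q where p: "\<beta> p < \<alpha> p" and q: "\<alpha> q < \<beta> q" by blast
  consider "\<And>l. l \<noteq> p \<Longrightarrow> \<alpha> l \<le> \<beta> l" | "\<And>l. l \<noteq> q \<Longrightarrow> \<beta> l \<le> \<alpha> l"
    | p' q' where "p' \<noteq> p" "\<beta> p' < \<alpha> p'" "q' \<noteq> q" "\<alpha> q' < \<beta> q'"
    by (meson not_le)
  then show ?thesis
  proof cases
    case 1
    then show ?thesis using one_sided_Lefschetz[OF ab(2,3) deg p] assms(4) unfolding F by blast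
  next
    case 2
    then show ?thesis
      using one_sided_Lefschetz[OF ab(3,2) deg[symmetric] q] assms(4) unfolding F_swap by blast
  next
    case 3
    then show ?thesis
      using not_complete_intersection_of_two_two[OF ab(2,3) 3(1) 3(2) p 3(3) 3(4) q] assms(4)
      unfolding F by blast
  qed
qed

end
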